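(* Let $\kappa\in\mathbb{N}$, $\eta\in\{2,3,\ldots\}\cup\{\infty\}$, $p\in\mathbb{N}$, $p\ge2$. Let $\pmb{\lambda}=\{\lambda_{-k}\}_{k=0}^{\kappa-1}\cup\{\lambda_{i,j}\}_{i,j=1}^{\eta,p}\subset(0,\infty)$ be such that $\lambda_{i,j}>1$ for $i\in\mathbb{N}\cap[1,\eta]$, $j\in\mathbb{N}\cap[2,p]$, and $\sum_{i=1}^{\eta}\lambda_{i,1}^2<\infty$. Let $\{K_i\}_{i=1}^{\eta}\subset\mathbb{Q}\cap\left[\frac12,\frac{p+\kappa}{2}\right]$ with $2K_i\in\mathbb{N}$, and put $N_i=2K_i-1$. For $i\in\mathbb{N}\cap[1,\eta]$ set $s_{i,k}=\prod_{j=2}^{k+2}\lambda_{i,j}^2-\prod_{j=2}^{k+1}\lambda_{i,j}^2$ for $k\in\mathbb{N}\cap[0,p-2]$. Then the following are equivalent: (i) there exists a completely hyperexpansive completion $S_{\pmb{\lambda}'}\in\mathbf{B}(\ell^2(V_{\eta,\kappa}))$ of $\pmb{\lambda}$ such that $\mathrm{ind}_1(\tau^{\pmb{\lambda}'}_{i,1})=K_i$ for every $i\in\mathbb{N}\cap[1,\eta]$; (ii) for every $i\in\mathbb{N}\cap[1,\eta]$ there exist $s_{i,-1},\ldots,s_{i,-\kappa-1}\in(0,\infty)$ such that for every $i$: $s_{i,k}\in(t_1((s_{i,k+1},\ldots,s_{i,p-2})),\infty)$ for $k\in\mathbb{Z}\cap[p-N_i-2,p-3]$; $s_{i,k}=t_1((s_{i,k+1},\ldots,s_{i,k+N_i+1}))$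 for $k\in\mathbb{Z}\cap[-\kappa-1,p-N_i-3]$; $\sup_{i}s_{i,0}<\infty$; and, if $\kappa=0$, $1+\sum_{i=1}^{\eta}\lambda_{i,1}^2s_{i,-1}\le\sum_{i=1}^{\eta}\lambda_{i,1}^2$, while if $\kappa>0$, $1+\sum_{i=1}^{\eta}\lambda_{i,1}^2s_{i,-1}=\sum_{i=1}^{\eta}\lambda_{i,1}^2$, $1+\prod_{j=0}^{k-1}\lambda_{-j}^2\sum_{i=1}^{\eta}\lambda_{i,1}^2s_{i,-k-1}=\lambda_{-k+1}^2$ for $k\in\mathbb{N}\cap[1,\kappa-1]$, $1+\prod_{j=0}^{\kappa-1}\lambda_{-j}^2\sum_{i=1}^{\eta}\lambda_{i,1}^2s_{i,-\kappa-1}\le\lambda_{-\kappa+1}^2$.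
   Context: Empty products equal $1$; $\mathbb{N}=\{0,1,\ldots\}$. The tree $\mathcal{T}_{\eta,\kappa}$ has vertices $V_{\eta,\kappa}=\{-k:k\in\mathbb{N}\cap[0,\kappa]\}\sqcup\{(i,j):i\in\mathbb{N}\cap[1,\eta],j\ge1\}$ and edges $(-k,-k+1)$ ($1\le k\le\kappa$), $(0,(i,1))$, $((i,j),(i,j+1))$. A weighted shift with weights $(\lambda_v)_{v\neq\mathrm{root}}$ (bounded iff $\sup_v\sum_{u\text{ child of }v}|\lambda_u|^2<\infty$) acts by $S_{\pmb{\lambda}}e_v=\sum_{u\text{ child of }v}\lambda_ue_u$. A completion of the data $\{\lambda_{-k}\}_{k=0}^{\kappa-1}\cup\{\lambda_{i,j}\}_{i,j=1}^{\eta,p}$ is a bounded weighted shift on $\mathcal{T}_{\eta,\kappa}$ whose weights at $-k$ ($k\le\kappa-1$) and $(i,j)$ ($j\le p$) equal the given ones. A real sequence $(a_k)_{k\ge0}$ is completely alternating if $\sum_{k=0}^{n}(-1)^k\binom nk a_{k+m}\le0$ for all $m\ge0$, $n\ge1$; $T$ is completely hyperexpansive if $(\|T^nf\|^2)_n$ is completely alternating for each $f$. Then $\tau^{\pmb{\lambda}'}_{i,1}$ is the unique Borel measure $\tau$ on $[0,1]$ with $\|S_{\pmb{\lambda}'}^ne_{(i,1)}\|^2=1+\int(1+t+\cdots+t^{n-1})\,d\tau$, $n\ge1$. For a finitely supported measure $\mu$ on $(0,1]$, $\mathrm{ind}_1(\mu)=\#(\mathrm{supp}\,\mu\cap(0,1))+\frac12\chi_{\mathrm{supp}\,\mu}(1)$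 (and $\infty$ otherwise). For a finite sequence $\mathbf{s}=(s_0,\ldots,s_n)$ and $0<a<b$, $\mathcal{M}_{a,b}(\mathbf{s})$ is the set of positive Borel measures on $[a,b]$ with $k$-th moments $s_k$, $k=0,\ldots,n$; $t_{a,b}(\mathbf{s})=\inf\{\int\frac1t\,d\mu:\mu\in\mathcal{M}_{a,b}(\mathbf{s})\}$ ($\inf\varnothing=\infty$) and $t_1(\mathbf{s})=\inf_{0<a<b\le1}t_{a,b}(\mathbf{s})$. *)

theory Defs
  imports "HOL-Analysis.Analysis" "HOL-Library.Extended_Nat"
begin

text \<open>Vertex -k is Neg k; vertex (i,j) is Br i j.\<close>
datatype vtx = Neg nat | Br nat nat

definition Idx :: "enat \<Rightarrow> nat set" where
  "Idx eta = {i. 1 \<le> i \<and> enat i \<le> eta}"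

definition Vt :: "enat \<Rightarrow> nat \<Rightarrow> vtx set" where
  "Vt eta kappa = {Neg k | k. k \<le> kappa} \<union> {Br i j | i j. i \<in> Idx eta \<and> 1 \<le> j}"

text \<open>Parent map encoding the edges (-k,-k+1), (0,(i,1)), ((i,j),(i,j+1)).\<close>
fun par :: "vtx \<Rightarrow> vtx" where
  "par (Neg k) = Neg (Suc k)"
| "par (Br i j) = (if j = 1 then Neg 0 else Br i (j - 1))"

definition root :: "nat \<Rightarrow> vtx" where
  "root kappa = Neg kappa"

definition children :: "enat \<Rightarrow> nat \<Rightarrow> vtx \<Rightarrow> vtx set" where
  "children eta kappa v = {u \<in> Vt eta kappa. u \<noteq> root kappa \<and> par u = v}"

definition bounded_weights :: "enat \<Rightarrow> nat \<Rightarrow> (vtx \<Rightarrow> complex) \<Rightarrow> bool" where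
  "bounded_weights eta kappa lam \<longleftrightarrow>
     (SUP v\<in>Vt eta kappa. (\<Sum>\<^sub>\<infinity>u\<in>children eta kappa v. ennreal ((cmod (lam u))\<^sup>2))) < \<infinity>"

definition l2 :: "vtx set \<Rightarrow> (vtx \<Rightarrow> complex) set" where
  "l2 V = {f. (\<forall>v. v \<notin> V \<longrightarrow> f v = 0) \<and> (\<lambda>v. (cmod (f v))\<^sup>2) summable_on UNIV}"

definition nsq :: "(vtx \<Rightarrow> complex) \<Rightarrow> real" where
  "nsq f = (\<Sum>\<^sub>\<infinity>v. (cmod (f v))\<^sup>2)"

definition evec :: "vtx \<Rightarrow> vtx \<Rightarrow> complex" where
  "evec v = (\<lambda>u. if u = v then 1 else 0)"

text \<open>The weighted shift: (S f)(u) = lam u * f(parent u) for non-root u in V;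
  in particular S e_v = sum over children u of v of lam u e_u.\<close>
definition wshift :: "enat \<Rightarrow> nat \<Rightarrow> (vtx \<Rightarrow> complex) \<Rightarrow> (vtx \<Rightarrow> complex) \<Rightarrow> vtx \<Rightarrow> complex" where
  "wshift eta kappa lam f = (\<lambda>u. if u \<in> Vt eta kappa \<and> u \<noteq> root kappa then lam u * f (par u) else 0)"

definition completely_alternating :: "(nat \<Rightarrow> real) \<Rightarrow> bool" where
  "completely_alternating a \<longleftrightarrow>
     (\<forall>m n. n \<ge> 1 \<longrightarrow> (\<Sum>k=0..n. (-1)^k * real (n choose k) * a (k + m)) \<le> 0)"

definition CH_shift :: "enat \<Rightarrow> nat \<Rightarrow> (vtx \<Rightarrow> complex) \<Rightarrow> bool" where
  "CH_shift eta kappa lam \<longleftrightarrow>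
     (\<forall>f\<in>l2 (Vt eta kappa). completely_alternating (\<lambda>n. nsq ((wshift eta kappa lam ^^ n) f)))"

definition is_completion :: "enat \<Rightarrow> nat \<Rightarrow> nat \<Rightarrow> (vtx \<Rightarrow> real) \<Rightarrow> (vtx \<Rightarrow> complex) \<Rightarrow> bool" where
  "is_completion eta kappa p lam lam' \<longleftrightarrow>
     bounded_weights eta kappa lam' \<and>
     (\<forall>k<kappa. lam' (Neg k) = complex_of_real (lam (Neg k))) \<and>
     (\<forall>i\<in>Idx eta. \<forall>j\<in>{1..p}. lam' (Br i j) = complex_of_real (lam (Br i j)))"

definition tau :: "enat \<Rightarrow> nat \<Rightarrow> (vtx \<Rightarrow> complex) \<Rightarrow> vtx \<Rightarrow> real measure" where
  "tau eta kappa lam v = (THE \<tau>. sets \<tau> = sets (restrict_space borel {0..1::real}) \<and>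
      (\<forall>n\<ge>1. ennreal (nsq ((wshift eta kappa lam ^^ n) (evec v)))
              = 1 + (\<integral>\<^sup>+ t. ennreal (\<Sum>k<n. t ^ k) \<partial>\<tau>)))"

definition msupp :: "real measure \<Rightarrow> real set" where
  "msupp \<mu> = {t \<in> space \<mu>. \<forall>e>0. emeasure \<mu> (ball t e \<inter> space \<mu>) > 0}"

definition ind1 :: "real measure \<Rightarrow> ereal" where
  "ind1 \<mu> = (if finite (msupp \<mu>) \<and> msupp \<mu> \<subseteq> {0<..1}
     then ereal (real (card (msupp \<mu> \<inter> {0<..<1})) + (if 1 \<in> msupp \<mu> then 1/2 else 0))
     else \<infinity>)"

definition Mab :: "real \<Rightarrow> real \<Rightarrow> real list \<Rightarrow> real measure set" where
  "Mab a b s = {\<mu>. sets \<mu> = sets (restrict_space borel {a..b}) \<and> emeasure \<mu> (space \<mu>) < \<infinity> \<and>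
      (\<forall>k<length s. (\<integral>t. t ^ k \<partial>\<mu>) = s ! k)}"

definition tab :: "real \<Rightarrow> real \<Rightarrow> real list \<Rightarrow> ereal" where
  "tab a b s = (INF \<mu>\<in>Mab a b s. ereal (\<integral>t. 1 / t \<partial>\<mu>))"

definition t1 :: "real list \<Rightarrow> ereal" where
  "t1 s = (INF ab\<in>{(a, b). 0 < a \<and> a < b \<and> b \<le> (1::real)}. tab (fst ab) (snd ab) s)"

definition sdat :: "(vtx \<Rightarrow> real) \<Rightarrow> nat \<Rightarrow> nat \<Rightarrow> real" where
  "sdat lam i k = (\<Prod>j=2..k+2. (lam (Br i j))\<^sup>2) - (\<Prod>j=2..k+1. (lam (Br i j))\<^sup>2)"

text \<open>N_i = 2 K_i - 1 (an integer since 2 K_i is a natural number).\<close>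
definition Nint :: "real \<Rightarrow> int" where
  "Nint Ki = \<lfloor>2 * Ki\<rfloor> - 1"

end

theory Submission
  imports Defs "HOL-Probability.Probability" "HOL-Computational_Algebra.Polynomial"
begin

text \<open>
  For a completely hyperexpansive shift the numbers \<open>s\<^sub>i\<^sub>,\<^sub>k\<close> are the moments \<open>\<integral>t\<^sup>k d\<tau>\<^sub>i\<close> of the branch measures,
  and complete alternation of \<open>\<parallel>S\<^sup>n e\<^sub>v\<parallel>\<^sup>2\<close> at the trunk vertices says exactly that the negative moments
  \<open>s\<^sub>i\<^sub>,\<^sub>-\<^sub>1, s\<^sub>i\<^sub>,\<^sub>-\<^sub>2, \<dots>\<close> satisfy the stated (in)equalities: complete
  alternation at a vertex bounds the next negative moment and forces the measure of its child to have no mass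
  at \<open>0\<close>, so inequality is possible only at the root.

  What remains is a truncated moment problem for each branch. If a finitely supported measure on \<open>(0,1]\<close> has
  \<open>2 ind\<^sub>1 = M\<close>, then among all measures with the same first \<open>M\<close> moments it minimises \<open>\<integral>1/t\<close>, by comparing \<open>1/t\<close> with the
  polynomial interpolating it (doubly at interior atoms) on the support; with fewer moments prescribed a divided
  difference gives a strict decrease. Conversely, if \<open>s\<^sub>k\<close> exceeds this minimum, the excess becomes an atom
  at \<open>0\<close>, and Gauss or Gauss--Radau quadrature replaces the resulting measure by one on \<open>(0,1]\<close> whose index is
  larger by \<open>1/2\<close>.
\<close>

section \<open>Quadrature for finitely supported measures\<close>

text \<open>The index grows by 1/2 per strict inequality. One atom at 1 matches the top datum, and
  N_i steps down reach 2 K_i = N_i + 1, the number of moments that pins down the next lower one;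
  hence the conditions switch from strict inequality to equality exactly there.

  Mass at 0 blocks the passage from a vertex to its parent because, away from 0, the parent's
  measure is a multiple of the child's measure divided by t. Since \<open>eta\<close> may be
  infinite, the trunk measures are infinite mixtures. They are never built as measures: only their
  moment sequences and finite differences occur, as convergent sums. On the branches the Hausdorff
  moment theorem turns complete alternation into a measure and gives meaning to the
  \<open>THE\<close> in \<open>tau\<close>.

  Complete alternation need only be tested on basis vectors, because a power of the shift sends
  distinct basis vectors to orthogonal vectors. From (ii) to (i), the branch measure prescribes all
  norms along the orbit of e_(i,1); the weights beyond p are square roots of ratios of these squared
  norms, and the bound on s_(i,0) bounds those ratios.\<close>

lemma degree_prod_linear:
  fixes A :: "real set"
  shows "degree (\<Prod>z\<in>A. [:-z, 1:]) = card A"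
proof (cases "finite A")
  case True
  have "degree (\<Prod>z\<in>A. [:-z, 1:]) = (\<Sum>z\<in>A. degree [:-z, 1:])"
    by (rule degree_prod_eq_sum_degree) auto
  then show ?thesis by simp
qed simp

lemma coeff_prod_linear_card:
  fixes A :: "real set"
  shows "coeff (\<Prod>z\<in>A. [:-z, 1:]) (card A) = 1"
proof -
  have "lead_coeff (\<Prod>z\<in>A. [:-z, 1:]) = (\<Prod>z\<in>A. lead_coeff [:-z, 1:])"
    by (rule lead_coeff_prod)
  then show ?thesis by (simp add: degree_prod_linear)
qed

lemma Lagrange_interpolation:
  fixes Y :: "real set"
  assumes fin: "finite Y" and deg: "degree p < card Y"
  shows "p = (\<Sum>y\<in>Y. smult (poly p y / (\<Prod>z\<in>Y-{y}. y - z)) (\<Prod>z\<in>Y-{y}. [:-z, 1:]))"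
    (is "p = ?q")
proof (rule poly_eqI_degree[of Y])
  fix x assume x: "x \<in> Y"
  have "poly ?q x = (\<Sum>y\<in>Y. if y = x then poly p x else 0)"
    unfolding poly_sum
  proof (rule sum.cong[OF refl])
    fix y assume y: "y \<in> Y"
    show "poly (smult (poly p y / (\<Prod>z\<in>Y-{y}. y - z)) (\<Prod>z\<in>Y-{y}. [:-z, 1:])) x
        = (if y = x then poly p x else 0)"
    proof (cases "y = x")
      case True
      have "(\<Prod>z\<in>Y-{x}. x - z) \<noteq> 0" using fin by auto
      then show ?thesis using True by (simp add: poly_prod)
    next
      case False
      then have "(\<Prod>z\<in>Y-{y}. x - z) = 0" using fin x by auto
      then show ?thesis using False by (simp add: poly_prod)
    qed
  qed
  also have "\<dots> = poly p x" using fin x by simp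
  finally show "poly p x = poly ?q x" by simp
next
  have "degree ?q \<le> card Y - 1"
    by (intro degree_sum_le fin order.trans[OF degree_smult_le])
       (use fin in \<open>simp add: degree_prod_linear\<close>)
  then show "degree ?q < card Y" using deg by linarith
qed fact

text \<open>Compare the coefficients of degree \<open>card Y - 1\<close> in the Lagrange formula,
  where every basis product is monic of exactly that degree. In particular the functional on the
  left kills all polynomials of smaller degree, which is how it is used below.\<close>

lemma divided_difference:
  fixes Y :: "real set"
  assumes fin: "finite Y" and deg: "degree p < card Y"
  shows "(\<Sum>y\<in>Y. poly p y / (\<Prod>z\<in>Y-{y}. y - z)) = coeff p (card Y - 1)"
proof -
  have "coeff p (card Y - 1) = coeff (\<Sum>y\<in>Y. smult (poly p y / (\<Prod>z\<in>Y-{y}. y - z))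
      (\<Prod>z\<in>Y-{y}. [:-z, 1:])) (card Y - 1)"
    using Lagrange_interpolation[OF assms] by simp
  also have "\<dots> = (\<Sum>y\<in>Y. poly p y / (\<Prod>z\<in>Y-{y}. y - z))"
    unfolding coeff_sum coeff_smult
  proof (rule sum.cong[OF refl])
    fix y assume "y \<in> Y"
    then have "coeff (\<Prod>z\<in>Y-{y}. [:-z, 1:]) (card Y - 1) = 1"
      using coeff_prod_linear_card[of "Y - {y}"] fin by simp
    then show "poly p y / (\<Prod>z\<in>Y-{y}. y - z) * coeff (\<Prod>z\<in>Y-{y}. [:-z, 1:]) (card Y - 1)
      = poly p y / (\<Prod>z\<in>Y-{y}. y - z)" by simp
  qed
  finally show ?thesis by simp
qed

text \<open>The polynomial taking the value \<open>1 / (v y * (\<Prod>z\<in>Y-{y}. y - z))\<close> at each \<open>y \<in> Y\<close> is orthogonal,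
  with respect to the weights \<open>v\<close>, to all polynomials of smaller degree; as its values alternate in
  sign along \<open>Y\<close>, it has a root between any two neighbours in \<open>Y\<close>.\<close>
lemma Gauss_quadrature_discrete:
  fixes Y :: "real set" and v :: "real \<Rightarrow> real"
  assumes fin: "finite Y" and card: "card Y = Suc m" and v: "\<And>y. y \<in> Y \<Longrightarrow> v y > 0"
  obtains X w where "finite X" "card X = m" "\<And>x. x \<in> X \<Longrightarrow> w x > 0"
    "\<And>x. x \<in> X \<Longrightarrow> \<exists>a\<in>Y. \<exists>b\<in>Y. a < x \<and> x < b"
    "\<And>f. degree f < 2 * m \<Longrightarrow> (\<Sum>y\<in>Y. v y * poly f y) = (\<Sum>x\<in>X. w x * poly f x)"
proof -
  define c where "c y = 1 / (\<Prod>z\<in>Y-{y}. y - z)" for y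
  have c0: "c y \<noteq> 0" for y using fin by (auto simp: c_def)
  \<comment> \<open>One factor \<open>c y\<close> normalises the Lagrange basis polynomial, the
    other belongs to the prescribed value \<open>c y / v y\<close>.\<close>
  define P where "P = (\<Sum>y\<in>Y. smult ((c y / v y) * c y) (\<Prod>z\<in>Y-{y}. [:-z, 1:]))"
  have P: "poly P x = c x / v x" if x: "x \<in> Y" for x
  proof -
    have "poly P x = (\<Sum>y\<in>Y. if y = x then c x / v x else 0)"
      unfolding P_def poly_sum
    proof (rule sum.cong[OF refl])
      fix y assume y: "y \<in> Y"
      show "poly (smult (c y / v y * c y) (\<Prod>z\<in>Y-{y}. [:-z, 1:])) x = (if y = x then c x / v x else 0)"
      proof (cases "y = x")
        case True
        have "(\<Prod>z\<in>Y-{x}. x - z) \<noteq> 0" using fin by auto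
        then show ?thesis using True by (simp add: poly_prod c_def)
      next
        case False
        then have "(\<Prod>z\<in>Y-{y}. x - z) = 0" using fin x by auto
        then show ?thesis using False by (simp add: poly_prod)
      qed
    qed
    also have "\<dots> = c x / v x" using fin x by simp
    finally show ?thesis .
  qed
  have degP: "degree P \<le> m"
    unfolding P_def
    by (intro degree_sum_le fin order.trans[OF degree_smult_le])
       (use fin card in \<open>simp add: degree_prod_linear\<close>)
  have orth: "(\<Sum>y\<in>Y. v y * (poly P y * poly q y)) = 0" if "degree q < m" for q
  proof -
    have "(\<Sum>y\<in>Y. v y * (poly P y * poly q y)) = (\<Sum>y\<in>Y. poly q y / (\<Prod>z\<in>Y-{y}. y - z))"
      by (rule sum.cong[OF refl]) (use v in \<open>force simp: P c_def\<close>)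
    also have "\<dots> = coeff q (card Y - 1)"
      using that card by (intro divided_difference fin) auto
    also have "\<dots> = 0" using that card by (simp add: coeff_eq_0)
    finally show ?thesis .
  qed
  have Yne: "Y \<noteq> {}" using card by auto
  define M where "M = Max Y"
  have M: "M \<in> Y" "\<And>y. y \<in> Y \<Longrightarrow> y \<le> M" using fin Yne by (auto simp: M_def)
  have ex: "\<exists>r. y < r \<and> poly P r = 0 \<and> (\<forall>z\<in>Y. y < z \<longrightarrow> r < z)" if y: "y \<in> Y - {M}" for y
  proof -
    define y' where "y' = Min {z\<in>Y. y < z}"
    have "M \<in> {z\<in>Y. y < z}" using y M by force
    then have ne: "{z\<in>Y. y < z} \<noteq> {}" by blast
    have "y' \<in> {z\<in>Y. y < z}"
      unfolding y'_def using Min_in[OF _ ne] fin by auto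
    then have y': "y' \<in> Y" "y < y'" by auto
    have y'min: "y' \<le> z" if "z \<in> Y" "y < z" for z
      unfolding y'_def using that fin by (intro Min_le) auto
    have split: "(\<Prod>z\<in>Y-{a}. a - z) = (a - b) * (\<Prod>z\<in>Y-{y,y'}. a - z)"
      if "{a, b} = {y, y'}" "a \<noteq> b" for a b
    proof -
      have "b \<in> Y - {a}" using that y y' by auto
      moreover have "Y - {a} - {b} = Y - {y,y'}" using that by auto
      ultimately show ?thesis using fin by (simp add: prod.remove)
    qed
    \<comment> \<open>No point of \<open>Y\<close> lies strictly between the neighbours, so every
      remaining \<open>z\<close> sees both from the same side. The only negative contribution to the
      product of the two node products is \<open>(y - y') * (y' - y)\<close>, whence the sign
      change.\<close>
    have pos: "(\<Prod>z\<in>Y-{y,y'}. y - z) * (\<Prod>z\<in>Y-{y,y'}. y' - z) > 0"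
      unfolding prod.distrib[symmetric]
    proof (rule prod_pos)
      fix z assume "z \<in> Y - {y, y'}"
      then have z: "z \<in> Y" "z \<noteq> y" "z \<noteq> y'" by auto
      show "0 < (y - z) * (y' - z)"
      proof (cases "y < z")
        case True
        then have "y' < z" using y'min z by force
        then show ?thesis using True by (intro mult_neg_neg) auto
      next
        case False
        then show ?thesis using z y' by (intro mult_pos_pos) auto
      qed
    qed
    have s1: "(\<Prod>z\<in>Y-{y}. y - z) = (y - y') * (\<Prod>z\<in>Y-{y,y'}. y - z)"
      and s2: "(\<Prod>z\<in>Y-{y'}. y' - z) = (y' - y) * (\<Prod>z\<in>Y-{y,y'}. y' - z)"
      by (rule split; use y' in auto)+
    have "(\<Prod>z\<in>Y-{y}. y - z) * (\<Prod>z\<in>Y-{y'}. y' - z)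
        = - ((y' - y)\<^sup>2 * ((\<Prod>z\<in>Y-{y,y'}. y - z) * (\<Prod>z\<in>Y-{y,y'}. y' - z)))"
      unfolding s1 s2 by (simp add: power2_eq_square algebra_simps)
    also have "\<dots> < 0" using pos y' by (simp add: mult_pos_pos)
    finally have "c y * c y' < 0"
      by (simp add: c_def divide_less_0_iff mult_less_0_iff)
    then have "(c y * c y') / (v y * v y') < 0"
      using v[of y] v[of y'] y y' by (intro divide_neg_pos) auto
    then have "poly P y * poly P y' < 0" using P y y' by simp
    then obtain r where "y < r" "r < y'" "poly P r = 0"
      using poly_IVT[OF y'(2)] by blast
    then show ?thesis using y'min by force
  qed
  then obtain r where r: "\<And>y. y \<in> Y - {M} \<Longrightarrow> y < r y"
      "\<And>y. y \<in> Y - {M} \<Longrightarrow> poly P (r y) = 0"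
      "\<And>y z. y \<in> Y - {M} \<Longrightarrow> z \<in> Y \<Longrightarrow> y < z \<Longrightarrow> r y < z"
    by metis
  define X where "X = r ` (Y - {M})"
  have "inj_on r (Y - {M})"
  proof (rule linorder_inj_onI)
    fix y z assume "y < z" "y \<in> Y - {M}" "z \<in> Y - {M}"
    then have "r y < z" "z < r z" using r by auto
    then show "r y \<noteq> r z" by simp
  qed auto
  then have cX: "card X = m" using card M fin by (simp add: X_def card_image)
  have fX: "finite X" using fin by (simp add: X_def)
  have hull: "\<exists>a\<in>Y. \<exists>b\<in>Y. a < x \<and> x < b" if x: "x \<in> X" for x
  proof -
    obtain y where y: "y \<in> Y - {M}" "x = r y" using x unfolding X_def by auto
    then have "r y < M" using r(3)[of y M] M(1) M(2)[of y] by force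
    then show ?thesis using y r M by blast
  qed
  define R where "R = (\<Prod>x\<in>X. [:-x, 1:])"
  have degR: "degree R = m" using cX by (simp add: R_def degree_prod_linear)
  have R0: "R \<noteq> 0" using fX by (simp add: R_def)
  have Rroot: "poly R x = 0" if "x \<in> X" for x
    using that fX by (auto simp: R_def poly_prod)
  have degmod: "degree (f mod R) < m" if "m > 0" for f
    using degree_mod_less'[of R f] degR R0 that by (metis degree_0)
  define l where "l x = smult (1 / (\<Prod>z\<in>X-{x}. x - z)) (\<Prod>z\<in>X-{x}. [:-z, 1:])" for x
  define w where "w x = (\<Sum>y\<in>Y. v y * poly (l x) y)" for x
  have quad: "(\<Sum>y\<in>Y. v y * poly f y) = (\<Sum>x\<in>X. w x * poly f x)" if deg: "degree f < 2 * m" for f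
  proof -
    have m0: "m > 0" using deg by simp
    \<comment> \<open>\<open>P\<close> vanishes at the m points of \<open>X\<close> and has degree
      at most m, so it is a nonzero multiple of \<open>R\<close>. Thus \<open>R\<close>, whose roots
      are known, inherits the orthogonality of \<open>P\<close>.\<close>
    have "P mod R = 0"
    proof (rule poly_eqI_degree[of X])
      show "poly (P mod R) x = poly 0 x" if "x \<in> X" for x
      proof -
        have "poly (P mod R) x = poly (P - P div R * R) x"
          by (simp only: minus_div_mult_eq_mod)
        also have "\<dots> = poly P x - poly (P div R) x * poly R x"
          by (simp only: poly_diff poly_mult)
        also have "\<dots> = 0" using that r Rroot[OF that] unfolding X_def by auto
        finally show ?thesis by simp
      qed
    qed (use degmod m0 cX in auto)
    then obtain k where k: "P = R * k" by (metis mod_0_imp_dvd dvdE)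
    have "P \<noteq> 0" using P[of M] M(1) c0[of M] v[of M] by force
    then have "degree P = m + degree k" using k degR by (simp add: degree_mult_eq)
    then have "degree k = 0" using degP by simp
    then obtain a where a: "k = [:a:]" by (metis degree_eq_zeroE)
    have a0: "a \<noteq> 0" using k a \<open>P \<noteq> 0\<close> by auto
    define q where "q = f div R"
    define g where "g = f mod R"
    have fqg: "f = q * R + g" by (simp add: q_def g_def)
    have "degree q < m"
    proof (cases "q = 0")
      case False
      have "degree (q * R) = degree q + m" using False R0 degR by (simp add: degree_mult_eq)
      moreover have "degree (q * R) < 2 * m"
      proof -
        have "q * R = f - g" using fqg by simp
        moreover have "degree g < 2 * m" using degmod[OF m0, of f] by (simp add: g_def)
        ultimately show ?thesis using degree_diff_less[of f "2*m" g] deg by simp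
      qed
      ultimately show ?thesis by simp
    qed (use m0 in simp)
    then have "(\<Sum>y\<in>Y. v y * (poly P y * poly q y)) = 0" by (rule orth)
    then have "a * (\<Sum>y\<in>Y. v y * (poly R y * poly q y)) = 0"
      by (simp add: k a sum_distrib_left mult_ac)
    then have o: "(\<Sum>y\<in>Y. v y * (poly R y * poly q y)) = 0" using a0 by simp
    have gx: "poly g x = poly f x" if "x \<in> X" for x
      using Rroot[OF that] by (subst fqg) simp
    have "g = (\<Sum>x\<in>X. smult (poly g x) (l x))"
      unfolding l_def smult_smult
      using Lagrange_interpolation[OF fX, of g] degmod[OF m0] cX by (simp add: g_def)
    then have gy: "poly g y = (\<Sum>x\<in>X. poly g x * poly (l x) y)" for y
      by (metis (no_types, lifting) poly_smult poly_sum sum.cong)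
    have "(\<Sum>y\<in>Y. v y * poly f y) = (\<Sum>y\<in>Y. v y * (poly R y * poly q y)) + (\<Sum>y\<in>Y. v y * poly g y)"
      unfolding sum.distrib[symmetric] by (rule sum.cong[OF refl], subst fqg) (simp add: algebra_simps)
    also have "\<dots> = (\<Sum>y\<in>Y. \<Sum>x\<in>X. v y * (poly g x * poly (l x) y))"
      by (simp add: o gy[symmetric] sum_distrib_left[symmetric])
    also have "\<dots> = (\<Sum>x\<in>X. w x * poly g x)"
      by (subst sum.swap) (simp add: w_def sum_distrib_right sum_distrib_left mult_ac)
    also have "\<dots> = (\<Sum>x\<in>X. w x * poly f x)" by (rule sum.cong[OF refl]) (simp add: gx)
    finally show ?thesis .
  qed
  \<comment> \<open>The square of the basis polynomial \<open>l x\<close> has degree 2 m - 2, within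
    the exactness range, and picks out \<open>w x\<close> on the right-hand side; it cannot vanish
    on all m + 1 points of \<open>Y\<close>.\<close>
  have wpos: "w x > 0" if x: "x \<in> X" for x
  proof -
    have m0: "m > 0" using x cX fX by (metis card_gt_0_iff empty_iff)
    have D0: "(\<Prod>z\<in>X-{x}. x - z) \<noteq> 0" using fX by auto
    have degl: "degree (l x) = m - 1"
      using D0 x fX cX by (simp add: l_def degree_prod_linear)
    have "l x \<noteq> 0" using D0 fX by (simp add: l_def)
    have deg2: "degree (l x * l x) < 2 * m"
      using degree_mult_le[of "l x" "l x"] degl m0 by linarith
    have "poly (l x) z = (if z = x then 1 else 0)" if "z \<in> X" for z
      using D0 that x fX by (auto simp: l_def poly_prod)
    then have "(\<Sum>z\<in>X. w z * poly (l x * l x) z) = (\<Sum>z\<in>X. if z = x then w x else 0)"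
      by (intro sum.cong) auto
    then have wx: "w x = (\<Sum>y\<in>Y. v y * poly (l x * l x) y)"
      using quad[OF deg2] x fX by simp
    have "\<exists>y\<in>Y. poly (l x) y \<noteq> 0"
    proof (rule ccontr)
      assume "\<not> ?thesis"
      then have "l x = 0" using degl card
        by (intro poly_eqI_degree[of Y]) auto
      then show False using \<open>l x \<noteq> 0\<close> by simp
    qed
    then obtain y where y: "y \<in> Y" "poly (l x) y \<noteq> 0" by blast
    have "0 < (\<Sum>y\<in>Y. v y * poly (l x * l x) y)"
      using y v fin by (intro sum_pos2[of Y y]) (auto intro!: mult_pos_pos mult_nonneg_nonneg simp: less_imp_le zero_less_mult_iff)
    then show ?thesis using wx by simp
  qed
  show thesis by (rule that[OF fX cX wpos hull quad])
qed

text \<open>Twice the index \<open>ind\<^sub>1\<close> of a measure with finite support \<open>X\<close>.\<close>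
definition idx2 :: "real set \<Rightarrow> nat" where
  "idx2 X = 2 * card (X \<inter> {0<..<1}) + (if 1 \<in> X then 1 else 0)"

text \<open>A finitely supported measure \<open>\<Sum>x\<in>X. w x \<delta>\<^sub>x\<close> on \<open>(0,1]\<close>.\<close>
definition atomic :: "real set \<Rightarrow> (real \<Rightarrow> real) \<Rightarrow> bool" where
  "atomic X w \<longleftrightarrow> finite X \<and> X \<subseteq> {0<..1} \<and> (\<forall>x\<in>X. w x > 0)"

lemma atomicD:
  assumes "atomic X w"
  shows "finite X" "x \<in> X \<Longrightarrow> 0 < x" "x \<in> X \<Longrightarrow> x \<le> 1" "x \<in> X \<Longrightarrow> 0 < w x"
  using assms by (auto simp: atomic_def)

text \<open>Quadrature counts nodes, whereas the index counts an atom at 1 only once; this converts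
  between the two.\<close>

lemma idx2_eq:
  assumes "finite X" "X \<subseteq> {0<..1}"
  shows "idx2 X + (if 1 \<in> X then 1 else 0) = 2 * card X"
proof (cases "1 \<in> X")
  case True
  have "X \<inter> {0<..<1} = X - {1}" using assms by force
  moreover have "card X > 0" using True assms by (auto simp: card_gt_0_iff)
  ultimately show ?thesis using True assms by (simp add: idx2_def)
next
  case False
  then have "X \<inter> {0<..<1} = X" using assms by (auto simp: less_le)
  then show ?thesis using False by (simp add: idx2_def)
qed

text \<open>The mass at \<open>0\<close> is absorbed by Gauss quadrature when \<open>1 \<in> X\<close>, and by Gauss--Radau quadrature
  with prescribed node \<open>1\<close> otherwise.\<close>
lemma absorb_zero_atom:
  assumes at: "atomic X w" and c: "c > 0"
  obtains X' w' where "atomic X' w'" "idx2 X' = Suc (idx2 X)"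
    "\<And>f. degree f \<le> idx2 X \<Longrightarrow> (\<Sum>x\<in>X'. w' x * poly f x) = c * poly f 0 + (\<Sum>x\<in>X. w x * poly f x)"
proof -
  note X = atomicD[OF at]
  have X01: "X \<subseteq> {0<..1}" using X by auto
  have z: "0 \<notin> X" using X(2)[of 0] by auto
  define Y where "Y = insert 0 X"
  define v where "v y = (if y = 0 then c else w y)" for y
  have fY: "finite Y" and cY: "card Y = Suc (card X)" using X(1) z by (auto simp: Y_def)
  have v0: "v y > 0" if "y \<in> Y" for y using that X c by (auto simp: v_def Y_def)
  have sumY: "(\<Sum>y\<in>Y. v y * f y) = c * f 0 + (\<Sum>x\<in>X. w x * f x)" for f :: "real \<Rightarrow> real"
  proof -
    have "(\<Sum>y\<in>X. v y * f y) = (\<Sum>x\<in>X. w x * f x)"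
      using z by (intro sum.cong) (auto simp: v_def)
    then show ?thesis using X(1) z by (simp add: Y_def v_def)
  qed
  have Y01: "0 \<le> y" "y \<le> 1" if "y \<in> Y" for y using that X by (force simp: Y_def)+
  have in01: "0 < x \<and> x < 1" if "\<exists>a\<in>Y. \<exists>b\<in>Y. a < x \<and> x < b" for x
    using that Y01 by (meson le_less_trans less_le_trans)
  show thesis
  proof (cases "1 \<in> X")
    case True
    obtain X' w' where G: "finite X'" "card X' = card X" "\<And>x. x \<in> X' \<Longrightarrow> w' x > 0"
      "\<And>x. x \<in> X' \<Longrightarrow> \<exists>a\<in>Y. \<exists>b\<in>Y. a < x \<and> x < b"
      "\<And>f. degree f < 2 * card X \<Longrightarrow> (\<Sum>y\<in>Y. v y * poly f y) = (\<Sum>x\<in>X'. w' x * poly f x)"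
      by (rule Gauss_quadrature_discrete[OF fY cY, of v]) (erule v0, rule that)
    have i: "0 < x \<and> x < 1" if "x \<in> X'" for x using G(4)[OF that] in01 by blast
    have at': "atomic X' w'" unfolding atomic_def using G(1,3) i by (auto simp: less_imp_le)
    have e: "Suc (idx2 X) = 2 * card X" using idx2_eq[OF X(1) X01] True by simp
    have "1 \<notin> X'" using i by blast
    then have "idx2 X' = Suc (idx2 X)"
      using idx2_eq[of X'] at' G(2) e by (simp add: atomic_def)
    then show thesis using G(5) e sumY by (intro that[OF at']) auto
  next
    case False
    have Y1: "y < 1" if "y \<in> Y" for y
      using that Y01(2)[OF that] False by (cases "y = 1") (auto simp: Y_def)
    \<comment> \<open>The Radau device: the interior nodes are the Gauss nodes of the weights
      multiplied by 1 - t, and dividing the new weights by 1 - x undoes the factor.\<close>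
    define v1 where "v1 y = v y * (1 - y)" for y
    have v1: "v1 y > 0" if "y \<in> Y" for y using that v0 Y1 by (simp add: v1_def)
    obtain X0 w0 where G: "finite X0" "card X0 = card X" "\<And>x. x \<in> X0 \<Longrightarrow> w0 x > 0"
      "\<And>x. x \<in> X0 \<Longrightarrow> \<exists>a\<in>Y. \<exists>b\<in>Y. a < x \<and> x < b"
      "\<And>f. degree f < 2 * card X \<Longrightarrow> (\<Sum>y\<in>Y. v1 y * poly f y) = (\<Sum>x\<in>X0. w0 x * poly f x)"
      by (rule Gauss_quadrature_discrete[OF fY cY, of v1]) (erule v1, rule that)
    have i: "0 < x \<and> x < 1" if "x \<in> X0" for x using G(4)[OF that] in01 by blast
    have n1: "1 \<notin> X0" using i by blast
    have e: "idx2 X = 2 * card X" using idx2_eq[OF X(1) X01] False by simp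
    \<comment> \<open>The weight of the node 1 is forced by the total mass; its positivity has to be
      proved separately.\<close>
    define a where "a = (\<Sum>y\<in>Y. v y) - (\<Sum>x\<in>X0. w0 x / (1 - x))"
    define w' where "w' x = (if x = 1 then a else w0 x / (1 - x))" for x
    define X' where "X' = insert 1 X0"
    have sumX': "(\<Sum>x\<in>X'. w' x * f x) = a * f 1 + (\<Sum>x\<in>X0. w0 x / (1 - x) * f x)" for f :: "real \<Rightarrow> real"
    proof -
      have "(\<Sum>x\<in>X0. w' x * f x) = (\<Sum>x\<in>X0. w0 x / (1 - x) * f x)"
        using n1 by (intro sum.cong) (auto simp: w'_def)
      then show ?thesis using G(1) n1 by (simp add: X'_def w'_def)
    qed
    have quad: "(\<Sum>x\<in>X'. w' x * poly f x) = (\<Sum>y\<in>Y. v y * poly f y)" if deg: "degree f \<le> 2 * card X" for f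
    proof -
      define h where "h = f - [:poly f 1:]"
      have "poly h 1 = 0" by (simp add: h_def)
      then obtain k where k: "h = [:-1, 1:] * k" by (metis poly_eq_0_iff_dvd dvdE)
      have fk: "poly f y = poly f 1 - (1 - y) * poly k y" for y
      proof -
        have "poly h y = (y - 1) * poly k y" by (simp add: k algebra_simps)
        then show ?thesis by (simp add: h_def algebra_simps)
      qed
      have kquad: "(\<Sum>y\<in>Y. v1 y * poly k y) = (\<Sum>x\<in>X0. w0 x * poly k x)"
      \<comment> \<open>If \<open>X\<close> is empty, the Gauss rule is exact for no degree at all,
        so the zero quotient needs its own case.\<close>
      proof (cases "k = 0")
        case False
        have "degree h = Suc (degree k)" using False unfolding k by (subst degree_mult_eq) auto
        moreover have "degree h \<le> 2 * card X" unfolding h_def using deg by (intro degree_diff_le) auto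
        ultimately show ?thesis by (intro G(5)) simp
      qed simp
      have "(\<Sum>x\<in>X'. w' x * poly f x) = a * poly f 1 + (\<Sum>x\<in>X0. w0 x / (1 - x) * poly f x)"
        by (rule sumX')
      also have "(\<Sum>x\<in>X0. w0 x / (1 - x) * poly f x)
          = (\<Sum>x\<in>X0. w0 x / (1 - x)) * poly f 1 - (\<Sum>x\<in>X0. w0 x * poly k x)"
        unfolding sum_distrib_right sum_subtractf[symmetric]
      proof (rule sum.cong[OF refl])
        fix x assume "x \<in> X0"
        then have "1 - x \<noteq> 0" using i[of x] by simp
        then show "w0 x / (1 - x) * poly f x = w0 x / (1 - x) * poly f 1 - w0 x * poly k x"
          by (subst fk) (simp add: field_simps)
      qed
      also have "a * poly f 1 + ((\<Sum>x\<in>X0. w0 x / (1 - x)) * poly f 1 - (\<Sum>x\<in>X0. w0 x * poly k x))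
         = (\<Sum>y\<in>Y. v y) * poly f 1 - (\<Sum>y\<in>Y. v1 y * poly k y)"
        by (simp add: a_def kquad algebra_simps)
      also have "\<dots> = (\<Sum>y\<in>Y. v y * poly f y)"
        unfolding sum_distrib_right sum_subtractf[symmetric]
        by (rule sum.cong[OF refl], subst (2) fk) (simp add: v1_def algebra_simps)
      finally show ?thesis .
    qed
    \<comment> \<open>The square of the node polynomial of \<open>X0\<close> has degree
      \<open>2 * card X\<close>, the largest for which the rule is exact. It vanishes at every node
      but 1, so its integral isolates \<open>a\<close>.\<close>
    have a0: "a > 0"
    proof -
      define R where "R = (\<Prod>x\<in>X0. [:-x, 1:])"
      have degR: "degree R = card X" using G(2) by (simp add: R_def degree_prod_linear)
      have R0: "R \<noteq> 0" using G(1) by (simp add: R_def)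
      have Rr: "poly R x = 0" if "x \<in> X0" for x using that G(1) by (auto simp: R_def poly_prod)
      have R1: "poly R 1 \<noteq> 0" using G(1) n1 by (auto simp: R_def poly_prod)
      have "\<exists>y\<in>Y. poly R y \<noteq> 0"
      proof (rule ccontr)
        assume "\<not> ?thesis"
        then have "R = 0" using degR cY by (intro poly_eqI_degree[of Y]) auto
        then show False using R0 by simp
      qed
      then obtain y where y: "y \<in> Y" "poly R y \<noteq> 0" by blast
      have "0 < (\<Sum>y\<in>Y. v y * poly (R * R) y)"
        using y v0 fY by (intro sum_pos2[of Y y]) (auto intro!: mult_pos_pos mult_nonneg_nonneg simp: less_imp_le zero_less_mult_iff)
      also have "\<dots> = (\<Sum>x\<in>X'. w' x * poly (R * R) x)"
        using degree_mult_le[of R R] degR by (intro quad[symmetric]) simp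
      also have "\<dots> = a * (poly R 1)\<^sup>2"
        unfolding sumX' using Rr by (simp add: power2_eq_square)
      finally show ?thesis using R1 by (simp add: zero_less_mult_iff)
    qed
    have at': "atomic X' w'" using G i a0 by (force simp: atomic_def X'_def w'_def)
    have "idx2 X' = Suc (idx2 X)"
      using idx2_eq[of X'] at' G(1,2) e n1 by (simp add: atomic_def X'_def)
    then show thesis using quad e sumY by (intro that[OF at']) auto
  qed
qed

section \<open>Extremal values of the integral of \<open>1/t\<close>\<close>

text \<open>A point measure carries the discrete sigma-algebra on \<open>X\<close>. Pushing it
  forward along the identity puts it on the Borel sets of \<open>{a..1}\<close>, as
  \<open>Mab\<close> and, for a = 0, \<open>tau\<close> require.\<close>

definition disc_measure :: "real \<Rightarrow> real set \<Rightarrow> (real \<Rightarrow> real) \<Rightarrow> real measure" where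
  "disc_measure a X w = distr (point_measure X (\<lambda>x. ennreal (w x))) (restrict_space borel {a..1}) (\<lambda>x. x)"

lemma sets_disc_measure [simp, measurable_cong]:
  "sets (disc_measure a X w) = sets (restrict_space borel {a..1})"
  by (simp add: disc_measure_def)

lemma space_disc_measure [simp]: "space (disc_measure a X w) = {a..1}"
  by (simp add: disc_measure_def space_restrict_space)

lemma measurable_id_point_measure:
  "X \<subseteq> {a..1::real} \<Longrightarrow> (\<lambda>x. x) \<in> measurable (point_measure X f) (restrict_space borel {a..1})"
  by (auto simp: space_restrict_space)

lemma integral_disc_measure:
  fixes f :: "real \<Rightarrow> real"
  assumes "finite X" "X \<subseteq> {a..1}" "\<And>x. x \<in> X \<Longrightarrow> 0 \<le> w x" "f \<in> borel_measurable borel"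
  shows "(\<integral>t. f t \<partial>disc_measure a X w) = (\<Sum>x\<in>X. w x * f x)"
proof -
  have "f \<in> borel_measurable (restrict_space borel {a..1})"
    using assms(4) by (rule measurable_restrict_space1)
  then have "(\<integral>t. f t \<partial>disc_measure a X w) = (\<integral>t. f t \<partial>point_measure X (\<lambda>x. ennreal (w x)))"
    unfolding disc_measure_def
    by (intro integral_distr measurable_id_point_measure assms)
  also have "\<dots> = (\<Sum>x\<in>X. w x * f x)"
    using assms by (subst lebesgue_integral_point_measure_finite) auto
  finally show ?thesis .
qed

lemma emeasure_disc_measure:
  assumes "finite X" "X \<subseteq> {a..1}" "A \<in> sets (restrict_space borel {a..1})"
  shows "emeasure (disc_measure a X w) A = (\<Sum>x\<in>A \<inter> X. ennreal (w x))"
proof -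
  have "emeasure (disc_measure a X w) A = emeasure (point_measure X (\<lambda>x. ennreal (w x))) (A \<inter> X)"
    unfolding disc_measure_def using assms
    by (subst emeasure_distr[OF measurable_id_point_measure]) (auto simp: space_point_measure)
  also have "\<dots> = (\<Sum>x\<in>A \<inter> X. ennreal (w x))"
    using assms by (subst emeasure_point_measure_finite) auto
  finally show ?thesis .
qed

lemma t1_le_atomic:
  assumes at: "atomic X w" and s: "\<And>k. k < length s \<Longrightarrow> s ! k = (\<Sum>x\<in>X. w x * x ^ k)"
  shows "t1 s \<le> ereal (\<Sum>x\<in>X. w x / x)"
proof -
  note X = atomicD[OF at]
  \<comment> \<open>The extra 1/2 makes the minimum meaningful for empty \<open>X\<close> and keeps
    a < 1 when all mass sits at 1.\<close>
  define a where "a = Min (insert (1/2) X)"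
  have a: "0 < a" "a < 1" "X \<subseteq> {a..1}"
  proof -
    have "a \<in> insert (1/2) X" unfolding a_def using X by (intro Min_in) auto
    then show "0 < a" using X by auto
    have "a \<le> 1/2" unfolding a_def using X by (intro Min_le) auto
    then show "a < 1" by simp
    show "X \<subseteq> {a..1}" using X by (auto simp: a_def)
  qed
  let ?m = "disc_measure a X w"
  have w0: "\<And>x. x \<in> X \<Longrightarrow> 0 \<le> w x" using X by (simp add: less_imp_le)
  have "emeasure ?m (space ?m) < \<infinity>"
    using a X by (subst emeasure_disc_measure) (auto simp: sets_restrict_space)
  then have "?m \<in> Mab a 1 s"
    unfolding Mab_def using integral_disc_measure[OF X(1) a(3), of w] w0 s by auto
  then have "tab a 1 s \<le> ereal (\<integral>t. 1 / t \<partial>?m)"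
    unfolding tab_def by (rule INF_lower)
  also have "(\<integral>t. 1 / t \<partial>?m) = (\<Sum>x\<in>X. w x / x)"
    using integral_disc_measure[OF X(1) a(3), of w "\<lambda>t. 1 / t"] w0 by simp
  finally have "tab a 1 s \<le> ereal (\<Sum>x\<in>X. w x / x)" .
  moreover have "t1 s \<le> tab a 1 s"
    using INF_lower[of "(a, 1)" "{(a, b). 0 < a \<and> a < b \<and> b \<le> (1::real)}" "\<lambda>ab. tab (fst ab) (snd ab) s"] a
    by (simp add: t1_def)
  ultimately show ?thesis by simp
qed

lemma poly_eq_sum_lessThan:
  fixes q :: "'a :: comm_semiring_1 poly"
  assumes "\<And>k. k \<ge> M \<Longrightarrow> coeff q k = 0"
  shows "poly q t = (\<Sum>k<M. coeff q k * t ^ k)"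
proof -
  have "(\<Sum>k\<le>degree q. coeff q k * t ^ k) = (\<Sum>k\<in>{..degree q} \<union> {..<M}. coeff q k * t ^ k)"
    by (rule sum.mono_neutral_left) (auto simp: coeff_eq_0)
  also have "\<dots> = (\<Sum>k<M. coeff q k * t ^ k)"
    by (rule sum.mono_neutral_right) (auto simp: assms)
  finally show ?thesis by (simp add: poly_altdef)
qed

text \<open>Produces interpolants of 1/t: the polynomial agrees with 1/t at the zeros of
  \<open>Q\<close> and differs from it by - Q(t)/t elsewhere, so the sign of \<open>Q\<close>
  decides on which side of 1/t it lies.\<close>

lemma divide_one_minus_poly:
  fixes Q :: "real poly"
  assumes "poly Q 0 = 1"
  obtains q where "\<And>t. t \<noteq> 0 \<Longrightarrow> poly q t = (1 - poly Q t) / t"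
    "\<And>k. coeff q k = - coeff Q (Suc k)"
proof -
  obtain a q where q: "1 - Q = pCons a q" by (rule pCons_cases)
  have "poly (1 - Q) 0 = 0" using assms by simp
  then have "a = 0" unfolding q by simp
  then have q: "1 - Q = pCons 0 q" using q by simp
  have "poly q t = (1 - poly Q t) / t" if "t \<noteq> 0" for t
  proof -
    have "poly (1 - Q) t = t * poly q t" unfolding q by simp
    then show ?thesis using that by (simp add: field_simps)
  qed
  moreover have "coeff q k = - coeff Q (Suc k)" for k
  proof -
    have "coeff q k = coeff (1 - Q) (Suc k)" unfolding q by simp
    then show ?thesis by simp
  qed
  ultimately show thesis using that by blast
qed

text \<open>With \<open>Q t = (\<Prod>x\<in>X-{1}. (1 - t/x)\<^sup>2)\<close>, times \<open>1 - t\<close> if \<open>1 \<in> X\<close>, the polynomial \<open>(1 - Q t) / t\<close> of degree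
  less than \<open>idx2 X\<close> minorises \<open>1/t\<close> on \<open>(0,1]\<close> and agrees with it on \<open>X\<close>.\<close>
lemma t1_ge_atomic:
  assumes at: "atomic X w" and len: "length s = idx2 X"
    and s: "\<And>k. k < length s \<Longrightarrow> s ! k = (\<Sum>x\<in>X. w x * x ^ k)"
  shows "ereal (\<Sum>x\<in>X. w x / x) \<le> t1 s"
proof -
  note X = atomicD[OF at]
  \<comment> \<open>A simple zero suffices at 1, because 1 - t does not change sign on (0,1]. The
    exponents then add up to exactly \<open>idx2 X\<close>, the number of prescribed
    moments.\<close>
  define e where "e x = (if x = 1 then 1 else 2 :: nat)" for x :: real
  define Q where "Q = (\<Prod>x\<in>X. [:1, - (1/x):] ^ e x)"
  have Qt: "poly Q t = (\<Prod>x\<in>X. (1 - t / x) ^ e x)" for t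
    by (simp add: Q_def poly_prod poly_power)
  have "degree Q \<le> (\<Sum>x\<in>X. e x)"
    unfolding Q_def
  proof (rule order.trans[OF degree_prod_sum_le[OF X(1)]])
    show "sum (degree \<circ> (\<lambda>x. [:1, - (1/x):] ^ e x)) X \<le> sum e X"
    proof (rule sum_mono)
      fix x assume "x \<in> X"
      have "degree ([:1, - (1/x):] ^ e x) \<le> degree [:1, - (1/x):] * e x"
        by (rule degree_power_le)
      also have "\<dots> \<le> 1 * e x" by (intro mult_right_mono) auto
      finally show "(degree \<circ> (\<lambda>x. [:1, - (1/x):] ^ e x)) x \<le> e x" by simp
    qed
  qed
  also have "(\<Sum>x\<in>X. e x) = idx2 X"
  proof -
    have "(\<Sum>x\<in>X. e x) + (\<Sum>x\<in>X. if x = 1 then 1 else 0) = (\<Sum>x\<in>X. 2)"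
      unfolding sum.distrib[symmetric] by (rule sum.cong) (auto simp: e_def)
    then show ?thesis using idx2_eq[of X] at X(1) by (auto simp: atomic_def split: if_splits)
  qed
  finally have degQ: "degree Q \<le> idx2 X" .
  obtain q where q: "\<And>t. t \<noteq> 0 \<Longrightarrow> poly q t = (1 - poly Q t) / t"
    "\<And>k. coeff q k = - coeff Q (Suc k)"
    by (rule divide_one_minus_poly[of Q]) (auto simp: Qt)
  have qsum: "poly q t = (\<Sum>k<idx2 X. coeff q k * t ^ k)" for t
    using degQ by (intro poly_eq_sum_lessThan) (simp add: q(2) coeff_eq_0)
  have Qpos: "0 \<le> poly Q t" if "t \<le> 1" for t
    unfolding Qt by (rule prod_nonneg) (use that in \<open>auto simp: e_def\<close>)
  have Qx: "poly Q x = 0" if "x \<in> X" for x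
    unfolding Qt using X(1) X(2)[OF that] that by (auto simp: e_def intro!: bexI[of _ x])
  have main: "(\<Sum>x\<in>X. w x / x) \<le> (\<integral>t. 1 / t \<partial>\<mu>)" if ab: "0 < a" "a < b" "b \<le> 1" and mu: "\<mu> \<in> Mab a b s" for a b \<mu>
  proof -
    have sets: "sets \<mu> = sets (restrict_space borel {a..b})" and fin: "emeasure \<mu> (space \<mu>) < \<infinity>"
      and mom: "\<And>k. k < length s \<Longrightarrow> (\<integral>t. t ^ k \<partial>\<mu>) = s ! k"
      using mu by (auto simp: Mab_def)
    have space: "space \<mu> = {a..b}" using sets_eq_imp_space_eq[OF sets] by (simp add: space_restrict_space)
    interpret finite_measure \<mu> by (rule finite_measureI) (use fin in auto)
    have meas: "f \<in> borel_measurable \<mu>" if "f \<in> borel_measurable borel" for f :: "real \<Rightarrow> real"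
      using measurable_restrict_space1[OF that, of "{a..b}"] sets measurable_cong_sets by blast
    have int_pow: "integrable \<mu> (\<lambda>t. t ^ k)" for k
      by (rule integrable_const_bound[of _ 1])
         (use ab in \<open>auto simp: space intro!: AE_I2 meas power_le_one\<close>)
    have int_inv: "integrable \<mu> (\<lambda>t. 1 / t)"
      by (rule integrable_const_bound[of _ "1 / a"])
         (use ab in \<open>auto simp: space frac_le intro!: AE_I2 meas\<close>)
    have "(\<Sum>x\<in>X. w x / x) = (\<Sum>x\<in>X. w x * poly q x)"
      by (rule sum.cong[OF refl]) (use Qx X(2) in \<open>force simp: q\<close>)
    also have "\<dots> = (\<Sum>k<idx2 X. coeff q k * (\<Sum>x\<in>X. w x * x ^ k))"
      unfolding qsum sum_distrib_left by (subst sum.swap) (simp add: mult_ac)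
    also have "\<dots> = (\<Sum>k<idx2 X. coeff q k * (\<integral>t. t ^ k \<partial>\<mu>))"
      by (rule sum.cong[OF refl]) (simp add: mom s len)
    also have "\<dots> = (\<integral>t. poly q t \<partial>\<mu>)"
      unfolding qsum by (subst Bochner_Integration.integral_sum) (auto simp: int_pow)
    also have "\<dots> \<le> (\<integral>t. 1 / t \<partial>\<mu>)"
    proof (rule integral_mono[OF _ int_inv])
      show "integrable \<mu> (poly q)"
        unfolding qsum by (intro Bochner_Integration.integrable_sum integrable_mult_right int_pow)
      fix t assume "t \<in> space \<mu>"
      then have t: "0 < t" "t \<le> 1" using ab space by auto
      then show "poly q t \<le> 1 / t" using Qpos[of t] by (simp add: q divide_right_mono)
    qed
    finally show ?thesis .
  qed
  show ?thesis
    unfolding t1_def tab_def by (intro INF_greatest) (use main in auto)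
qed

lemma t1_atomic:
  assumes "atomic X w" "length s = idx2 X" "\<And>k. k < length s \<Longrightarrow> s ! k = (\<Sum>x\<in>X. w x * x ^ k)"
  shows "t1 s = ereal (\<Sum>x\<in>X. w x / x)"
  using t1_le_atomic t1_ge_atomic assms by (intro antisym) auto

text \<open>Each atom below 1 gets a partner to its right, before the next atom and before 1, while
  an atom at 1 stays single. Atoms and partners together number \<open>idx2 X\<close>, and their
  order determines the signs of a divided difference.\<close>

lemma interlacing_points:
  assumes X: "finite X" "X \<subseteq> {0<..1::real}"
  obtains z where "\<And>x. x \<in> X - {1} \<Longrightarrow> x < z x" "\<And>x. x \<in> X - {1} \<Longrightarrow> z x < 1"
    "\<And>x y. x \<in> X - {1} \<Longrightarrow> y \<in> X \<Longrightarrow> x < y \<Longrightarrow> z x < y"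
proof -
  have "\<exists>r. x < r \<and> r < 1 \<and> (\<forall>y\<in>X. x < y \<longrightarrow> r < y)" if x: "x \<in> X - {1}" for x
  proof -
    define m where "m = Min (insert 1 {y\<in>X. x < y})"
    have "x < 1" using x X by (auto simp: less_le)
    have "m \<in> insert 1 {y\<in>X. x < y}" unfolding m_def using X by (intro Min_in) auto
    then have "x < m" using \<open>x < 1\<close> by auto
    have "m \<le> y" if "y \<in> insert 1 {y\<in>X. x < y}" for y
      unfolding m_def using X that by (intro Min_le) auto
    then have "m \<le> 1" "\<And>y. y \<in> X \<Longrightarrow> x < y \<Longrightarrow> m \<le> y" by auto
    moreover obtain r where "x < r" "r < m" using dense[OF \<open>x < m\<close>] by blast
    ultimately show ?thesis by force
  qed
  then show thesis using that by metis
qed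

text \<open>Perturb along the divided difference over \<open>X\<close> and interlacing points; it annihilates polynomials
  of degree at most \<open>idx2 X - 2\<close>, strictly decreases the integral of \<open>1/t\<close>, and is positive off \<open>X\<close>.\<close>
lemma t1_less_atomic:
  assumes at: "atomic X w" and len: "length s < idx2 X"
    and s: "\<And>k. k < length s \<Longrightarrow> s ! k = (\<Sum>x\<in>X. w x * x ^ k)"
  shows "t1 s < ereal (\<Sum>x\<in>X. w x / x)"
proof -
  note X = atomicD[OF at]
  have X01: "X \<subseteq> {0<..1}" using X by auto
  define X0 where "X0 = X - {1}"
  obtain z where z: "\<And>x. x \<in> X0 \<Longrightarrow> x < z x" "\<And>x. x \<in> X0 \<Longrightarrow> z x < 1"
    "\<And>x y. x \<in> X0 \<Longrightarrow> y \<in> X \<Longrightarrow> x < y \<Longrightarrow> z x < y"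
    by (rule interlacing_points[OF X(1) X01, folded X0_def]) (rule that)
  have fX0: "finite X0" using X by (simp add: X0_def)
  have zmono: "z x < z y" if "x \<in> X0" "y \<in> X0" "x < y" for x y
  proof -
    have "z x < y" using that z(3)[of x y] by (auto simp: X0_def)
    then show ?thesis using z(1)[of y] that by simp
  qed
  have inj: "inj_on z X0"
    by (rule linorder_inj_onI) (use zmono in force)+
  have zX: "z x \<notin> X" if "x \<in> X0" for x
  proof
    assume "z x \<in> X"
    then have "z x < z x" using z(3)[of x "z x"] z(1)[of x] that by auto
    then show False by simp
  qed
  define Z where "Z = z ` X0"
  have disj: "X \<inter> Z = {}" using zX by (auto simp: Z_def)
  define Y where "Y = X \<union> Z"
  have fZ: "finite Z" and fY: "finite Y" using X fX0 by (auto simp: Y_def Z_def)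
  have Ypos: "0 < y" if "y \<in> Y" for y
    using that X(2) z(1) by (force simp: Y_def Z_def X0_def)
  have Y1: "y \<le> 1" if "y \<in> Y" for y
    using that X(3) z(2) by (force simp: Y_def Z_def)
  have cY: "card Y = idx2 X"
  proof -
    have "card Y = card X + card X0"
      using X(1) fX0 disj inj by (simp add: Y_def Z_def card_Un_disjoint card_image)
    moreover have "card X0 + (if 1 \<in> X then 1 else 0) = card X"
      using X(1) card_gt_0_iff[of X] by (auto simp: X0_def)
    ultimately show ?thesis using idx2_eq[OF X(1) X01] by simp
  qed
  define M where "M = idx2 X"
  have M0: "M > 0" using len by (simp add: M_def)
  \<comment> \<open>Up to sign these are the divided-difference weights over \<open>Y\<close>; the
    sign is fixed so that the new points, which carry no mass yet, receive positive weight.\<close>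
  define \<sigma> where "\<sigma> y = - 1 / (\<Prod>y'\<in>Y-{y}. y' - y)" for y
  have \<sigma>c: "\<sigma> y = (-1) ^ M / (\<Prod>y'\<in>Y-{y}. y - y')" if "y \<in> Y" for y
  proof -
    have "(\<Prod>y'\<in>Y-{y}. y' - y) = (\<Prod>y'\<in>Y-{y}. (-1) * (y - y'))" by simp
    also have "\<dots> = (-1) ^ (M - 1) * (\<Prod>y'\<in>Y-{y}. y - y')"
      unfolding prod.distrib using that cY fY by (simp add: M_def)
    finally show ?thesis using M0
      by (cases M) (auto simp: \<sigma>_def uminus_power_if)
  qed
  have \<sigma>_sum: "(\<Sum>y\<in>Y. \<sigma> y * poly f y) = (-1) ^ M * coeff f (M - 1)" if "degree f < M" for f
  proof -
    have "(\<Sum>y\<in>Y. \<sigma> y * poly f y) = (-1) ^ M * (\<Sum>y\<in>Y. poly f y / (\<Prod>y'\<in>Y-{y}. y - y'))"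
      unfolding sum_distrib_left by (rule sum.cong) (auto simp: \<sigma>c)
    also have "(\<Sum>y\<in>Y. poly f y / (\<Prod>y'\<in>Y-{y}. y - y')) = coeff f (M - 1)"
      using divided_difference[OF fY, of f] that cY by (simp add: M_def)
    finally show ?thesis .
  qed
  have \<sigma>_pow: "(\<Sum>y\<in>Y. \<sigma> y * y ^ k) = 0" if "k < M - 1" for k
    using \<sigma>_sum[of "monom 1 k"] that by (simp add: poly_monom degree_monom_eq)
  \<comment> \<open>On \<open>Y\<close> the function 1/t agrees with a polynomial of degree at most
    M - 1. The functional reads off the coefficient of degree M - 1, which up to sign is the product
    of all 1/y; the two sign factors \<open>(-1) ^ M\<close> cancel.\<close>
  have \<sigma>_inv: "(\<Sum>y\<in>Y. \<sigma> y / y) < 0"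
  proof -
    define Q where "Q = (\<Prod>y\<in>Y. [:1, - (1/y):])"
    have Qt: "poly Q t = (\<Prod>y\<in>Y. 1 - t / y)" for t by (simp add: Q_def poly_prod)
    have degQ: "degree Q = M"
    proof -
      have "degree Q = (\<Sum>y\<in>Y. degree [:1, - (1/y):])"
        unfolding Q_def by (rule degree_prod_eq_sum_degree) auto
      also have "\<dots> = (\<Sum>y\<in>Y. 1)" by (rule sum.cong) (use Ypos in force)+
      finally show ?thesis using cY by (simp add: M_def)
    qed
    obtain q where q: "\<And>t. t \<noteq> 0 \<Longrightarrow> poly q t = (1 - poly Q t) / t"
      "\<And>k. coeff q k = - coeff Q (Suc k)"
      by (rule divide_one_minus_poly[of Q]) (auto simp: Qt)
    have "degree q \<le> M - 1"
      using degQ M0 by (intro degree_le) (auto simp: q(2) coeff_eq_0)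
    then have "degree q < M" using M0 by simp
    then have "(\<Sum>y\<in>Y. \<sigma> y * poly q y) = (-1) ^ M * coeff q (M - 1)" by (rule \<sigma>_sum)
    also have "(\<Sum>y\<in>Y. \<sigma> y * poly q y) = (\<Sum>y\<in>Y. \<sigma> y / y)"
    proof (rule sum.cong[OF refl])
      fix y assume y: "y \<in> Y"
      then have "poly Q y = 0" unfolding Qt using fY Ypos[OF y] by (auto intro!: bexI[of _ y])
      then show "\<sigma> y * poly q y = \<sigma> y / y" using Ypos[OF y] by (simp add: q)
    qed
    also have "coeff q (M - 1) = - coeff Q M" using M0 by (simp add: q(2))
    also have "coeff Q M = lead_coeff Q" using degQ by simp
    also have "\<dots> = (\<Prod>y\<in>Y. lead_coeff [:1, - (1/y):])"
      unfolding Q_def by (rule lead_coeff_prod)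
    also have "\<dots> = (\<Prod>y\<in>Y. (-1) * (1 / y))"
      by (rule prod.cong) (use Ypos in force)+
    also have "\<dots> = (-1) ^ M * (\<Prod>y\<in>Y. 1 / y)"
      unfolding prod.distrib using cY by (simp add: M_def)
    finally have "(\<Sum>y\<in>Y. \<sigma> y / y) = - (((-1) ^ M * (-1) ^ M) * (\<Prod>y\<in>Y. 1 / y))" by simp
    also have "((-1) ^ M * (-1) ^ M :: real) = 1" by (simp flip: power_add)
    also have "- (1 * (\<Prod>y\<in>Y. 1 / y)) < 0" using Ypos by (simp add: prod_pos)
    finally show ?thesis .
  qed
  \<comment> \<open>The nodes other than \<open>z x\<close> are its partner x, the pairs y,
    \<open>z y\<close> for the other atoms, and possibly 1. Each pair lies on one side of
    \<open>z x\<close>, and 1 lies to its right, so x - \<open>z x\<close> is the only uncompensated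
    negative factor.\<close>
  have \<sigma>_pos: "\<sigma> (z x) > 0" if x: "x \<in> X0" for x
  proof -
    have "Y - {z x} = (X \<inter> {1}) \<union> (X0 \<union> z ` (X0 - {x}))"
      using inj zX x by (auto simp: Y_def Z_def X0_def inj_on_def)
    moreover have "(X \<inter> {1}) \<inter> (X0 \<union> z ` (X0 - {x})) = {}" "X0 \<inter> z ` (X0 - {x}) = {}"
      using zX z(2) by (force simp: X0_def)+
    ultimately have "(\<Prod>y\<in>Y-{z x}. y - z x)
        = (\<Prod>y\<in>X \<inter> {1}. y - z x) * ((\<Prod>y\<in>X0. y - z x) * (\<Prod>y\<in>z ` (X0 - {x}). y - z x))"
      using X(1) fX0 by (simp add: prod.union_disjoint)
    also have "(\<Prod>y\<in>z ` (X0 - {x}). y - z x) = (\<Prod>y\<in>X0 - {x}. z y - z x)"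
      using inj by (subst prod.reindex) (auto simp: inj_on_def)
    also have "(\<Prod>y\<in>X0. y - z x) = (x - z x) * (\<Prod>y\<in>X0 - {x}. y - z x)"
      using fX0 x by (simp add: prod.remove)
    also have "(\<Prod>y\<in>X \<inter> {1}. y - z x) * ((x - z x) * (\<Prod>y\<in>X0 - {x}. y - z x) * (\<Prod>y\<in>X0 - {x}. z y - z x))
        = (x - z x) * ((\<Prod>y\<in>X \<inter> {1}. y - z x) * (\<Prod>y\<in>X0 - {x}. (y - z x) * (z y - z x)))"
      by (simp add: prod.distrib mult_ac)
    also have "\<dots> < 0"
    proof (rule mult_neg_pos)
      have "0 < (\<Prod>y\<in>X \<inter> {1}. y - z x)" using z(2)[OF x] by (intro prod_pos) auto
      moreover have "0 < (\<Prod>y\<in>X0 - {x}. (y - z x) * (z y - z x))"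
      proof (rule prod_pos)
        fix y assume y: "y \<in> X0 - {x}"
        show "0 < (y - z x) * (z y - z x)"
        proof (cases "x < y")
          case True
          then show ?thesis using z(3)[OF x, of y] zmono[of x y] x y
            by (intro mult_pos_pos) (auto simp: X0_def)
        next
          case False
          then have "y < x" using y by auto
          then show ?thesis using z(1)[OF x] zmono[of y x] x y
            by (intro mult_neg_neg) auto
        qed
      qed
      ultimately show "0 < (\<Prod>y\<in>X \<inter> {1}. y - z x) * (\<Prod>y\<in>X0 - {x}. (y - z x) * (z y - z x))"
        by (rule mult_pos_pos)
    qed (use z(1)[OF x] in simp)
    finally show ?thesis by (simp add: \<sigma>_def divide_neg_neg)
  qed
  \<comment> \<open>\<open>S\<close> dominates every ratio of a perturbation to the weight at an old
    atom, so the step 1 / (1 + S) leaves all old weights positive.\<close>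
  define S where "S = (\<Sum>x\<in>X. \<bar>\<sigma> x\<bar> / w x)"
  have S0: "S \<ge> 0" unfolding S_def using X(4) by (intro sum_nonneg divide_nonneg_nonneg) (auto simp: less_imp_le)
  define \<epsilon> where "\<epsilon> = 1 / (1 + S)"
  have \<epsilon>: "\<epsilon> > 0" using S0 by (simp add: \<epsilon>_def)
  define w' where "w' y = (if y \<in> X then w y else 0) + \<epsilon> * \<sigma> y" for y
  have sumw': "(\<Sum>y\<in>Y. w' y * f y) = (\<Sum>x\<in>X. w x * f x) + \<epsilon> * (\<Sum>y\<in>Y. \<sigma> y * f y)" for f :: "real \<Rightarrow> real"
  proof -
    have "(\<Sum>y\<in>Y. w' y * f y) = (\<Sum>y\<in>Y. if y \<in> X then w y * f y else 0) + \<epsilon> * (\<Sum>y\<in>Y. \<sigma> y * f y)"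
      unfolding sum_distrib_left sum.distrib[symmetric]
      by (rule sum.cong) (auto simp: w'_def algebra_simps)
    also have "(\<Sum>y\<in>Y. if y \<in> X then w y * f y else 0) = (\<Sum>x\<in>X. w x * f x)"
      using fY by (subst sum.inter_restrict[symmetric]) (auto simp: Y_def Int_absorb1)
    finally show ?thesis .
  qed
  have w'pos: "w' y > 0" if "y \<in> Y" for y
  proof (cases "y \<in> X")
    case True
    have "\<bar>\<sigma> y\<bar> / w y \<le> S"
      unfolding S_def using True X by (intro member_le_sum) (auto simp: less_imp_le)
    then have "\<bar>\<sigma> y\<bar> \<le> S * w y" using X(4)[OF True] by (simp add: field_simps)
    then have "\<bar>\<sigma> y\<bar> < (1 + S) * w y" using X(4)[OF True] by (simp add: algebra_simps)
    then have "\<epsilon> * \<bar>\<sigma> y\<bar> < w y" using S0 by (simp add: \<epsilon>_def field_simps)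
    moreover have "- (\<epsilon> * \<bar>\<sigma> y\<bar>) \<le> \<epsilon> * \<sigma> y" using mult_left_mono[of "- \<bar>\<sigma> y\<bar>" "\<sigma> y" \<epsilon>] \<epsilon> by simp
    ultimately show ?thesis using True by (simp add: w'_def)
  next
    case False
    then obtain x where "x \<in> X0" "y = z x" using \<open>y \<in> Y\<close> by (auto simp: Y_def Z_def)
    then show ?thesis using False \<sigma>_pos \<epsilon> by (simp add: w'_def)
  qed
  have at': "atomic Y w'" using fY w'pos Ypos Y1 by (auto simp: atomic_def)
  have "t1 s \<le> ereal (\<Sum>y\<in>Y. w' y / y)"
  proof (rule t1_le_atomic[OF at'])
    fix k assume "k < length s"
    then show "s ! k = (\<Sum>y\<in>Y. w' y * y ^ k)"
      using s[of k] \<sigma>_pow[of k] sumw'[of "\<lambda>y. y ^ k"] len by (simp add: M_def)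
  qed
  also have "(\<Sum>y\<in>Y. w' y / y) < (\<Sum>x\<in>X. w x / x)"
    using sumw'[of "\<lambda>y. 1 / y"] \<sigma>_inv \<epsilon> by (simp add: mult_pos_neg)
  finally show ?thesis by simp
qed

section \<open>Backward extension of moment sequences\<close>

lemma atomic_rescale:
  assumes "atomic X w" "\<And>x. x \<in> X \<Longrightarrow> g x > 0"
  shows "atomic X (\<lambda>x. w x * g x)"
  using assms by (auto simp: atomic_def)

text \<open>Induct by dropping the first entry. If a measure fits the tail, dividing it by t gives
  the right moments from order 1 on and too small a moment of order 0. The deficit, positive by the
  extremal value \<open>t1_atomic\<close>, is put at 0, where it affects order 0 only, and is then
  absorbed. The start is a single atom at 1, of index 1/2.\<close>

lemma atomic_moments_exist:
  assumes "u n > 0" "\<And>k. k < n \<Longrightarrow> t1 (map u [Suc k..<Suc n]) < ereal (u k)"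
  shows "\<exists>X w. atomic X w \<and> idx2 X = Suc n \<and> (\<forall>k\<le>n. u k = (\<Sum>x\<in>X. w x * x ^ k))"
  using assms
proof (induction n arbitrary: u)
  case 0
  have "atomic {1} (\<lambda>_. u 0)" using 0 by (auto simp: atomic_def)
  moreover have "idx2 {1} = Suc 0" by (simp add: idx2_def)
  ultimately show ?case by (intro exI[of _ "{1}"] exI[of _ "\<lambda>_. u 0"]) auto
next
  case (Suc n)
  define u' where "u' k = u (Suc k)" for k
  have map': "map u' [k..<m] = map u [Suc k..<Suc m]" for k m
    unfolding u'_def map_Suc_upt[symmetric] by simp
  have "\<exists>X w. atomic X w \<and> idx2 X = Suc n \<and> (\<forall>k\<le>n. u' k = (\<Sum>x\<in>X. w x * x ^ k))"
  proof (rule Suc.IH)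
    show "u' n > 0" using Suc.prems(1) by (simp add: u'_def)
    show "t1 (map u' [Suc k..<Suc n]) < ereal (u' k)" if "k < n" for k
      unfolding map' using Suc.prems(2)[of "Suc k"] that by (simp add: u'_def)
  qed
  then obtain X w where X: "atomic X w" "idx2 X = Suc n" "\<And>k. k \<le> n \<Longrightarrow> u' k = (\<Sum>x\<in>X. w x * x ^ k)"
    by blast
  note Xp = atomicD[OF X(1)]
  have "t1 (map u' [0..<Suc n]) = ereal (\<Sum>x\<in>X. w x / x)"
    by (rule t1_atomic[OF X(1)]) (use X in \<open>auto simp del: upt_Suc\<close>)
  moreover have "t1 (map u' [0..<Suc n]) < ereal (u 0)"
    unfolding map' using Suc.prems(2)[of 0] by simp
  ultimately have "(\<Sum>x\<in>X. w x / x) < u 0" by simp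
  then have c: "u 0 - (\<Sum>x\<in>X. w x / x) > 0" by simp
  have at1: "atomic X (\<lambda>x. w x * (1 / x))"
    using Xp by (intro atomic_rescale[OF X(1)]) simp
  obtain X' w' where X': "atomic X' w'" "idx2 X' = Suc (idx2 X)"
    "\<And>f. degree f \<le> idx2 X \<Longrightarrow> (\<Sum>x\<in>X'. w' x * poly f x)
       = (u 0 - (\<Sum>x\<in>X. w x / x)) * poly f 0 + (\<Sum>x\<in>X. (w x * (1 / x)) * poly f x)"
    by (rule absorb_zero_atom[OF at1 c]) (rule that)
  have "u k = (\<Sum>x\<in>X'. w' x * x ^ k)" if "k \<le> Suc n" for k
  proof -
    have "(\<Sum>x\<in>X'. w' x * x ^ k) = (u 0 - (\<Sum>x\<in>X. w x / x)) * 0 ^ k + (\<Sum>x\<in>X. (w x * (1 / x)) * x ^ k)"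
      using X'(3)[of "monom 1 k"] that X(2) by (simp add: poly_monom degree_monom_eq)
    also have "\<dots> = u k"
    proof (cases k)
      case 0
      then show ?thesis by simp
    next
      case (Suc j)
      have "(\<Sum>x\<in>X. (w x * (1 / x)) * x ^ k) = (\<Sum>x\<in>X. w x * x ^ j)"
        by (rule sum.cong[OF refl]) (use Suc Xp(2) in force)
      then show ?thesis using X(3)[of j] Suc that by (simp add: u'_def)
    qed
    finally show ?thesis by simp
  qed
  then show ?case using X' X(2) by (metis)
qed

lemma powi_shift_moment:
  assumes "atomic X w" "x \<in> X"
  shows "w x * x powi (m + int j) = w x * x powi m * x ^ j"
  using atomicD(2)[OF assms] by (simp add: power_int_add)

text \<open>Multiplying the weights by \<open>x powi (k + 1)\<close> turns moments of orders k + 1,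
  k + 2, ... into ordinary ones, so the extremal results apply to every window. The top N + 1 values
  determine a measure of index (N + 1)/2; below them each window has exactly \<open>idx2 X\<close>
  entries and forces the next value. Conversely, the windows in the strict range are shorter than
  \<open>idx2 X\<close>.\<close>

lemma backward_extension_iff:
  fixes s :: "int \<Rightarrow> real"
  assumes sq: "s q > 0" and lo: "lo \<le> q - int N"
  shows "(\<forall>k\<in>{q - int N..q - 1}. t1 (map s [k + 1..q]) < ereal (s k)) \<and>
     (\<forall>k\<in>{lo..q - int N - 1}. ereal (s k) = t1 (map s [k + 1..k + int N + 1]))
   \<longleftrightarrow> (\<exists>X w. atomic X w \<and> idx2 X = Suc N \<and> (\<forall>k\<in>{lo..q}. s k = (\<Sum>x\<in>X. w x * x powi k)))"
    (is "?L \<longleftrightarrow> ?R")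
proof
  assume L: ?L
  define u where "u j = s (q - int N + int j)" for j
  have mapu: "map u [Suc k..<Suc N] = map s [q - int N + int k + 1..q]" if "k < N" for k
    using that by (intro nth_equalityI) (auto simp: u_def algebra_simps simp del: upt_Suc)
  have "\<exists>X w. atomic X w \<and> idx2 X = Suc N \<and> (\<forall>k\<le>N. u k = (\<Sum>x\<in>X. w x * x ^ k))"
  proof (rule atomic_moments_exist)
    show "u N > 0" using sq by (simp add: u_def)
    show "t1 (map u [Suc k..<Suc N]) < ereal (u k)" if "k < N" for k
      unfolding mapu[OF that] using L that by (auto simp: u_def)
  qed
  then obtain X w where X: "atomic X w" "idx2 X = Suc N" "\<And>k. k \<le> N \<Longrightarrow> u k = (\<Sum>x\<in>X. w x * x ^ k)"
    by blast
  note Xp = atomicD[OF X(1)]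
  \<comment> \<open>\<open>u\<close> counts orders from q - N, so dividing by t to the power q - N
    restores the original orders.\<close>
  define v where "v x = w x * x powi (int N - q)" for x
  have at: "atomic X v" unfolding v_def using Xp by (intro atomic_rescale[OF X(1)]) simp
  have top: "s k = (\<Sum>x\<in>X. v x * x powi k)" if "k \<in> {q - int N..q}" for k
  proof -
    define j where "j = nat (k - q + int N)"
    have j: "k = q - int N + int j" "j \<le> N" using that by (auto simp: j_def)
    have "s k = (\<Sum>x\<in>X. w x * x ^ j)" using X(3)[OF j(2)] by (simp add: u_def j(1))
    also have "\<dots> = (\<Sum>x\<in>X. v x * x powi k)"
    proof (rule sum.cong[OF refl])
      fix x assume "x \<in> X"
      then have "x \<noteq> 0" using Xp by auto
      then have "x powi (int N - q) * x powi k = x ^ j"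
        by (simp add: j(1) power_int_add[symmetric])
      then show "w x * x ^ j = v x * x powi k" by (simp add: v_def mult.assoc)
    qed
    finally show ?thesis .
  qed
  \<comment> \<open>The range grows downwards by one order per step; cutting it off at
    \<open>lo\<close> makes the claim meaningful for every \<open>j\<close>.\<close>
  have "\<forall>k\<in>{max lo (q - int N - int j)..q}. s k = (\<Sum>x\<in>X. v x * x powi k)" for j
  proof (induction j)
    case 0
    then show ?case using top by auto
  next
    case (Suc j)
    show ?case
    proof
      fix k assume k: "k \<in> {max lo (q - int N - int (Suc j))..q}"
      show "s k = (\<Sum>x\<in>X. v x * x powi k)"
      proof (cases "k \<ge> q - int N - int j")
        case True
        then show ?thesis using Suc k by auto
      next
        case False
        then have k: "k = q - int N - int j - 1" "lo \<le> k" using k by auto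
        have "ereal (s k) = t1 (map s [k + 1..k + int N + 1])" using L k by auto
        also have "\<dots> = ereal (\<Sum>x\<in>X. v x * x powi (k + 1) / x)"
        proof (rule t1_atomic)
          show "atomic X (\<lambda>x. v x * x powi (k + 1))"
            using Xp by (intro atomic_rescale[OF at]) simp
          show "length (map s [k + 1..k + int N + 1]) = idx2 X" using X by simp
          fix i assume i: "i < length (map s [k + 1..k + int N + 1])"
          then have "map s [k + 1..k + int N + 1] ! i = s (k + 1 + int i)" by simp
          also have "\<dots> = (\<Sum>x\<in>X. v x * x powi (k + 1 + int i))"
            using Suc k i by auto
          also have "\<dots> = (\<Sum>x\<in>X. v x * x powi (k + 1) * x ^ i)"
            by (rule sum.cong[OF refl]) (rule powi_shift_moment[OF at])
          finally show "map s [k + 1..k + int N + 1] ! i = (\<Sum>x\<in>X. v x * x powi (k + 1) * x ^ i)" .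
        qed
        also have "(\<Sum>x\<in>X. v x * x powi (k + 1) / x) = (\<Sum>x\<in>X. v x * x powi k)"
          by (rule sum.cong[OF refl]) (use Xp(2) in \<open>force simp: power_int_add\<close>)
        finally show ?thesis by simp
      qed
    qed
  qed
  from this[of "nat (q - int N - lo)"] have "\<forall>k\<in>{lo..q}. s k = (\<Sum>x\<in>X. v x * x powi k)"
    using lo by auto
  then show ?R using at X(2) by blast
next
  assume ?R
  then obtain X w where X: "atomic X w" "idx2 X = Suc N" "\<And>k. k \<in> {lo..q} \<Longrightarrow> s k = (\<Sum>x\<in>X. w x * x powi k)"
    by blast
  note Xp = atomicD[OF X(1)]
  have at: "atomic X (\<lambda>x. w x * x powi (k + 1))" for k
    using Xp by (intro atomic_rescale[OF X(1)]) simp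
  have nth: "map s [k + 1..m] ! i = (\<Sum>x\<in>X. w x * x powi (k + 1) * x ^ i)"
    if "i < length (map s [k + 1..m])" "lo \<le> k" "m \<le> q" for i k m
  proof -
    have "map s [k + 1..m] ! i = s (k + 1 + int i)" using that by simp
    also have "\<dots> = (\<Sum>x\<in>X. w x * x powi (k + 1 + int i))" using that by (intro X(3)) auto
    also have "\<dots> = (\<Sum>x\<in>X. w x * x powi (k + 1) * x ^ i)"
      by (rule sum.cong[OF refl]) (rule powi_shift_moment[OF X(1)])
    finally show ?thesis .
  qed
  have inv: "(\<Sum>x\<in>X. w x * x powi (k + 1) / x) = s k" if "k \<in> {lo..q}" for k
    unfolding X(3)[OF that]
    by (rule sum.cong[OF refl]) (use Xp(2) in \<open>force simp: power_int_add\<close>)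
  show ?L
  proof (intro conjI ballI)
    fix k assume k: "k \<in> {q - int N..q - 1}"
    have "t1 (map s [k + 1..q]) < ereal (\<Sum>x\<in>X. w x * x powi (k + 1) / x)"
    proof (rule t1_less_atomic[OF at])
      show "length (map s [k + 1..q]) < idx2 X" using k X(2) by (auto simp: nat_less_iff)
    qed (use k lo in \<open>auto intro!: nth simp del: nth_map\<close>)
    then show "t1 (map s [k + 1..q]) < ereal (s k)" using inv[of k] k lo by simp
  next
    fix k assume k: "k \<in> {lo..q - int N - 1}"
    have "t1 (map s [k + 1..k + int N + 1]) = ereal (\<Sum>x\<in>X. w x * x powi (k + 1) / x)"
      by (rule t1_atomic[OF at]) (use k lo X(2) in \<open>auto intro!: nth simp del: nth_map\<close>)
    then show "ereal (s k) = t1 (map s [k + 1..k + int N + 1])" using inv[of k] k by simp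
  qed
qed

section \<open>The Hausdorff moment problem\<close>

text \<open>This is (I - E)^r b at k, with E the shift. For the moments of a measure on [0,1] it is
  the integral of t^k (1 - t)^r.\<close>

definition fdiff :: "(nat \<Rightarrow> real) \<Rightarrow> nat \<Rightarrow> nat \<Rightarrow> real" where
  "fdiff b r k = (\<Sum>l=0..r. (-1) ^ l * real (r choose l) * b (l + k))"

definition completely_monotone :: "(nat \<Rightarrow> real) \<Rightarrow> bool" where
  "completely_monotone b \<longleftrightarrow> (\<forall>r k. fdiff b r k \<ge> 0)"

lemma fdiff_0 [simp]: "fdiff b 0 k = b k"
  by (simp add: fdiff_def)

lemma fdiff_Suc: "fdiff b (Suc r) k = fdiff b r k - fdiff b r (Suc k)"
proof -
  let ?t = "\<lambda>l. (-1) ^ l * real (r choose l) * b (l + k)"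
  have "fdiff b (Suc r) k = b k + (\<Sum>l\<le>r. (-1) ^ Suc l * real (Suc r choose Suc l) * b (Suc l + k))"
    unfolding fdiff_def atLeast0AtMost by (subst sum.atMost_Suc_shift) simp
  also have "(\<Sum>l\<le>r. (-1) ^ Suc l * real (Suc r choose Suc l) * b (Suc l + k))
      = (\<Sum>l\<le>r. ?t (Suc l)) - fdiff b r (Suc k)"
    unfolding fdiff_def atLeast0AtMost sum_subtractf[symmetric]
    by (rule sum.cong) (auto simp: algebra_simps)
  also have "b k + ((\<Sum>l\<le>r. ?t (Suc l)) - fdiff b r (Suc k)) = (\<Sum>l\<le>Suc r. ?t l) - fdiff b r (Suc k)"
    by (subst sum.atMost_Suc_shift) simp
  also have "(\<Sum>l\<le>Suc r. ?t l) = fdiff b r k"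
    by (simp add: fdiff_def atLeast0AtMost)
  finally show ?thesis .
qed

text \<open>One factor of (I - E)^(r+1) is spent on passing from a to its increments, and it
  contributes the minus sign. Alternation constrains only orders at least 1, so nothing is
  lost.\<close>

lemma completely_alternating_iff:
  "completely_alternating a \<longleftrightarrow> completely_monotone (\<lambda>n. a (Suc n) - a n)"
proof -
  have *: "fdiff a (Suc r) k = - fdiff (\<lambda>n. a (Suc n) - a n) r k" for r k
    unfolding fdiff_Suc unfolding fdiff_def
    by (simp add: sum_subtractf[symmetric] sum_negf[symmetric] algebra_simps del: sum_subtractf sum_negf)
  have "completely_alternating a \<longleftrightarrow> (\<forall>r k. fdiff a (Suc r) k \<le> 0)"
  proof
    assume "completely_alternating a"
    then show "\<forall>r k. fdiff a (Suc r) k \<le> 0"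
      unfolding completely_alternating_def fdiff_def by (auto simp del: sum.cl_ivl_Suc)
  next
    assume R: "\<forall>r k. fdiff a (Suc r) k \<le> 0"
    show "completely_alternating a"
      unfolding completely_alternating_def
    proof (intro allI impI)
      fix m n :: nat assume "n \<ge> 1"
      then obtain r where "n = Suc r" by (cases n) auto
      then show "(\<Sum>k=0..n. (-1) ^ k * real (n choose k) * a (k + m)) \<le> 0"
        using R unfolding fdiff_def by blast
    qed
  qed
  then show ?thesis by (simp add: * completely_monotone_def)
qed

text \<open>The operator form of ((1 - t) + t)^N = 1, applied to t^j.\<close>

lemma fdiff_Bernstein_sum:
  "(\<Sum>k\<le>N. real (N choose k) * fdiff b (N - k) (k + j)) = b j"
proof (induction N arbitrary: j)
  case (Suc N)
  let ?f = "\<lambda>k. fdiff b (Suc N - k) (k + j)"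
  have "(\<Sum>k\<le>Suc N. real (Suc N choose k) * ?f k)
      = ?f 0 + (\<Sum>k\<le>N. real (Suc N choose Suc k) * ?f (Suc k))"
    by (subst sum.atMost_Suc_shift) simp
  also have "(\<Sum>k\<le>N. real (Suc N choose Suc k) * ?f (Suc k))
      = (\<Sum>k\<le>N. real (N choose Suc k) * ?f (Suc k)) + (\<Sum>k\<le>N. real (N choose k) * ?f (Suc k))"
    unfolding sum.distrib[symmetric] by (rule sum.cong) (auto simp: algebra_simps)
  also have "?f 0 + ((\<Sum>k\<le>N. real (N choose Suc k) * ?f (Suc k)) + (\<Sum>k\<le>N. real (N choose k) * ?f (Suc k)))
     = (\<Sum>k\<le>Suc N. real (N choose k) * ?f k) + (\<Sum>k\<le>N. real (N choose k) * ?f (Suc k))"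
    by (subst sum.atMost_Suc_shift) simp
  also have "(\<Sum>k\<le>Suc N. real (N choose k) * ?f k) = (\<Sum>k\<le>N. real (N choose k) * ?f k)"
    by simp
  also have "\<dots> + (\<Sum>k\<le>N. real (N choose k) * ?f (Suc k))
      = (\<Sum>k\<le>N. real (N choose k) * fdiff b (N - k) (k + j))"
    unfolding sum.distrib[symmetric]
  proof (rule sum.cong[OF refl])
    fix k assume "k \<in> {..N}"
    then have "?f k = fdiff b (N - k) (k + j) - ?f (Suc k)"
      by (simp add: Suc_diff_le fdiff_Suc)
    then show "real (N choose k) * ?f k + real (N choose k) * ?f (Suc k)
        = real (N choose k) * fdiff b (N - k) (k + j)" by (simp flip: distrib_left)
  qed
  also have "\<dots> = b j" by (rule Suc.IH)
  finally show ?case .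
qed simp

text \<open>Since (n choose k)(k choose j) = (n choose j)(n - j choose k - j), the sum collapses to
  the partition of unity of order n - j. Bernstein weights thus reproduce factorial moments
  exactly.\<close>

lemma fdiff_Bernstein_moment:
  assumes "j \<le> n"
  shows "(\<Sum>k\<le>n. real (n choose k) * fdiff b (n - k) k * (real (k choose j) / real (n choose j))) = b j"
proof -
  have n0: "real (n choose j) \<noteq> 0" using assms by simp
  have "(\<Sum>k\<le>n. real (n choose k) * fdiff b (n - k) k * (real (k choose j) / real (n choose j)))
      = (\<Sum>k=j..n. real (n choose k) * fdiff b (n - k) k * (real (k choose j) / real (n choose j)))"
    by (rule sum.mono_neutral_right) (auto simp: not_le binomial_eq_0)
  also have "\<dots> = (\<Sum>k\<le>n - j. real (n choose (k + j)) * fdiff b (n - (k + j)) (k + j)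
      * (real ((k + j) choose j) / real (n choose j)))"
    using assms by (intro sum.reindex_bij_witness[of _ "\<lambda>k. k + j" "\<lambda>k. k - j"]) auto
  also have "\<dots> = (\<Sum>k\<le>n - j. real ((n - j) choose k) * fdiff b ((n - j) - k) (k + j))"
  proof (rule sum.cong[OF refl])
    fix k assume k: "k \<in> {..n - j}"
    have "(n choose (k + j)) * ((k + j) choose j) = (n choose j) * ((n - j) choose k)"
      using choose_mult[of j "k + j" n] k assms by simp
    then have "real (n choose (k + j)) * real ((k + j) choose j) = real (n choose j) * real ((n - j) choose k)"
      by (metis of_nat_mult)
    then have "real (n choose (k + j)) * (real ((k + j) choose j) / real (n choose j)) = real ((n - j) choose k)"
      using n0 by (simp add: field_simps)
    moreover have "n - (k + j) = n - j - k" by simp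
    ultimately show "real (n choose (k + j)) * fdiff b (n - (k + j)) (k + j)
      * (real ((k + j) choose j) / real (n choose j)) = real ((n - j) choose k) * fdiff b ((n - j) - k) (k + j)"
      by (metis mult.assoc mult.commute)
  qed
  also have "\<dots> = b j" by (rule fdiff_Bernstein_sum)
  finally show ?thesis .
qed

text \<open>Power moments are matched only up to this error of order 1/n. Both quantities are
  products of j factors of modulus at most 1, so their distance is at most the sum of the distances
  of the factors; \<open>2 * j \<le> n\<close> keeps each denominator n - i at least n/2.\<close>

lemma power_vs_binomial_ratio:
  assumes "k \<le> n" "2 * j \<le> n" "n > 0"
  shows "\<bar>(real k / real n) ^ j - real (k choose j) / real (n choose j)\<bar> \<le> 2 * real j ^ 2 / real n"
proof -
  have ratio: "real (k choose j) / real (n choose j) = (\<Prod>i<j. (real k - real i) / (real n - real i))"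
    unfolding binomial_gbinomial gbinomial_prod_rev by (simp add: prod_dividef atLeast0LessThan)
  have "\<bar>(real k / real n) ^ j - real (k choose j) / real (n choose j)\<bar>
      = norm ((\<Prod>i<j. real k / real n) - (\<Prod>i<j. (real k - real i) / (real n - real i)))"
    unfolding ratio by simp
  also have "\<dots> \<le> (\<Sum>i<j. norm (real k / real n - (real k - real i) / (real n - real i)))"
  proof (rule norm_prod_diff)
    show "norm (real k / real n) \<le> 1" using assms by simp
    fix i assume "i \<in> {..<j}"
    then have "real n - real i > 0" "\<bar>real k - real i\<bar> \<le> real n - real i" using assms by auto
    then show "norm ((real k - real i) / (real n - real i)) \<le> 1" by simp
  qed
  also have "\<dots> \<le> (\<Sum>i<j. 2 * real j / real n)"
  proof (rule sum_mono)
    fix i assume "i \<in> {..<j}"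
    then have i: "i < j" by simp
    then have ni: "real n - real i > 0" "real n \<le> 2 * (real n - real i)" using assms by auto
    have n0: "real n > 0" using assms by simp
    have "real k / real n - (real k - real i) / (real n - real i)
        = real i * (real n - real k) / (real n * (real n - real i))"
      using ni n0 by (simp add: field_simps)
    then have "norm (real k / real n - (real k - real i) / (real n - real i))
        = real i * (real n - real k) / (real n * (real n - real i))"
      using ni n0 assms by simp
    also have "\<dots> \<le> real i * real n / (real n * (real n - real i))"
      using ni n0 by (intro divide_right_mono mult_left_mono) auto
    also have "\<dots> = real i / (real n - real i)" using n0 by simp
    also have "\<dots> \<le> real j / (real n / 2)" using i ni n0 by (intro frac_le) auto
    finally show "norm (real k / real n - (real k - real i) / (real n - real i)) \<le> 2 * real j / real n"
      by (simp add: mult.commute)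
  qed
  also have "\<dots> = 2 * real j ^ 2 / real n" by (simp add: power2_eq_square)
  finally show ?thesis .
qed

lemma completely_monotone_nonneg: "completely_monotone b \<Longrightarrow> b k \<ge> 0"
  unfolding completely_monotone_def using fdiff_0 by metis

lemma completely_monotone_Suc_le: "completely_monotone b \<Longrightarrow> b (Suc k) \<le> b k"
  using fdiff_Suc[of b 0 k] unfolding completely_monotone_def
  by (metis diff_ge_0_iff_ge fdiff_0)

text \<open>Weak convergence on the line tests bounded continuous functions. Clamping makes the
  powers such functions, and later moves the limit onto [0,1] without a discussion of its
  support.\<close>

definition clamp01 :: "real \<Rightarrow> real" where "clamp01 x = max 0 (min 1 x)"

lemma clamp01: "clamp01 x \<in> {0..1}" "x \<in> {0..1} \<Longrightarrow> clamp01 x = x"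
  by (auto simp: clamp01_def)

lemma isCont_clamp01: "isCont clamp01 x"
proof -
  have "continuous_on UNIV clamp01" unfolding clamp01_def by (intro continuous_intros)
  then show ?thesis by (simp add: continuous_on_eq_continuous_at)
qed

lemma measurable_clamp01: "clamp01 \<in> measurable borel (restrict_space borel {0..1})"
  by (rule measurable_restrict_space2) (use clamp01(1) in \<open>auto intro!: borel_measurable_continuous_onI
      continuous_at_imp_continuous_on isCont_clamp01\<close>)

text \<open>Masses (n choose k) times the differences of b, divided by b 0, at the points k/n form a
  probability measure by complete monotonicity. All of these lie on [0,1], so the family is tight,
  and a weak limit has the moments b j / b 0. If b 0 = 0 nothing can be normalised, but then b
  decreases from 0 and vanishes.\<close>

lemma Hausdorff_moment_exists:
  assumes cm: "completely_monotone b"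
  obtains \<tau> where "sets \<tau> = sets (restrict_space borel {0..1::real})" "finite_measure \<tau>"
    "\<And>k. (\<integral>t. t ^ k \<partial>\<tau>) = b k"
proof (cases "b 0 = 0")
  case True
  have "b k = 0" for k
  proof (induction k)
    case (Suc k)
    then show ?case
      using completely_monotone_nonneg[OF cm, of "Suc k"] completely_monotone_Suc_le[OF cm, of k] by simp
  qed (fact True)
  moreover have "emeasure (disc_measure 0 {} (\<lambda>_. 0)) {0..1} = 0"
    by (subst emeasure_disc_measure) (auto simp: sets_restrict_space)
  then have "finite_measure (disc_measure 0 {} (\<lambda>_. 0))"
    by (intro finite_measureI) simp
  moreover have "(\<integral>t. t ^ k \<partial>disc_measure 0 {} (\<lambda>_. 0)) = 0" for k
    using integral_disc_measure[of "{}" 0 "\<lambda>_. 0" "\<lambda>t. t ^ k"] by simp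
  ultimately show thesis using that[of "disc_measure 0 {} (\<lambda>_. 0)"] by simp
next
  case False
  then have b0: "b 0 > 0" using completely_monotone_nonneg[OF cm, of 0] by simp
  define p where "p n k = real (n choose k) * fdiff b (n - k) k / b 0" for n k
  have p0: "p n k \<ge> 0" for n k
    using cm b0 by (auto simp: p_def completely_monotone_def)
  have psum: "(\<Sum>k\<le>n. p n k) = 1" for n
    using fdiff_Bernstein_sum[of n b 0] b0 by (simp add: p_def sum_divide_distrib[symmetric])
  define pm where "pm n = point_measure {..Suc n} (\<lambda>k. ennreal (p (Suc n) k))" for n
  define \<mu> where "\<mu> n = distr (pm n) borel (\<lambda>k. real k / real (Suc n))" for n
  have mg: "(\<lambda>k. real k / real (Suc n)) \<in> measurable (pm n) borel" for n
    unfolding pm_def by simp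
  have integral_mu: "(\<integral>t. f t \<partial>\<mu> n) = (\<Sum>k\<le>Suc n. p (Suc n) k * f (real k / real (Suc n)))"
    if "f \<in> borel_measurable borel" for f :: "real \<Rightarrow> real" and n
    unfolding \<mu>_def integral_distr[OF mg that] unfolding pm_def
    by (subst lebesgue_integral_point_measure_finite) (auto simp: p0 simp del: sum.atMost_Suc)
  have em: "emeasure (\<mu> n) A = 1" if "{0..1} \<subseteq> A" "A \<in> sets borel" for A n
  proof -
    have "emeasure (\<mu> n) A = emeasure (pm n) ((\<lambda>k. real k / real (Suc n)) -` A \<inter> space (pm n))"
      unfolding \<mu>_def using that by (intro emeasure_distr mg)
    also have "(\<lambda>k. real k / real (Suc n)) -` A \<inter> space (pm n) = {..Suc n}"
      using that(1) by (auto simp: pm_def space_point_measure subset_iff)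
    also have "emeasure (pm n) {..Suc n} = (\<Sum>k\<le>Suc n. ennreal (p (Suc n) k))"
      unfolding pm_def by (subst emeasure_point_measure_finite) auto
    also have "\<dots> = ennreal (\<Sum>k\<le>Suc n. p (Suc n) k)" by (rule sum_ennreal) (rule p0)
    finally show ?thesis by (simp only: psum) simp
  qed
  have rd: "real_distribution (\<mu> n)" for n
  proof -
    have "prob_space (\<mu> n)"
      by (rule prob_spaceI) (simp add: em[of UNIV] \<mu>_def[THEN arg_cong, of space])
    then show ?thesis
      unfolding real_distribution_def real_distribution_axioms_def by (simp add: \<mu>_def)
  qed
  have "tight \<mu>"
    unfolding tight_def
  proof (intro conjI allI impI)
    fix \<epsilon> :: real assume "\<epsilon> > 0"
    have "measure (\<mu> n) {-1<..1} = 1" for n 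
      by (simp add: measure_def em subset_iff)
    then show "\<exists>a b. a < b \<and> (\<forall>n. 1 - \<epsilon> < measure (\<mu> n) {a<..b})"
      using \<open>\<epsilon> > 0\<close> by (intro exI[of _ "-1"] exI[of _ 1]) simp
  qed (rule rd)
  then obtain r M where r: "strict_mono (r :: nat \<Rightarrow> nat)" and M: "real_distribution M"
    and wc: "weak_conv_m (\<mu> \<circ> id \<circ> r) M"
    using tight_imp_convergent_subsubsequence[of \<mu> id] by (auto simp: strict_mono_id)
  interpret M: real_distribution M by fact
  have cl: "(\<lambda>x. clamp01 x ^ j) \<in> borel_measurable borel" for j
    by (intro borel_measurable_continuous_onI continuous_at_imp_continuous_on ballI continuous_intros isCont_clamp01)
  have lim: "(\<lambda>n. \<integral>t. clamp01 t ^ j \<partial>\<mu> n) \<longlonglongrightarrow> b j / b 0" for j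
  proof (rule Lim_transform_eventually)
    let ?e = "\<lambda>n. \<Sum>k\<le>Suc n. p (Suc n) k * ((real k / real (Suc n)) ^ j - real (k choose j) / real (Suc n choose j))"
    have "?e \<longlonglongrightarrow> 0"
    proof (rule Lim_null_comparison)
      show "\<forall>\<^sub>F n in sequentially. norm (?e n) \<le> 2 * real j ^ 2 / real (Suc n)"
      proof (rule eventually_sequentiallyI)
        fix n assume n: "n \<ge> 2 * j"
        have "norm (?e n) \<le> (\<Sum>k\<le>Suc n. p (Suc n) k * (2 * real j ^ 2 / real (Suc n)))"
        proof (rule sum_norm_le)
          fix k assume "k \<in> {..Suc n}"
          then show "norm (p (Suc n) k * ((real k / real (Suc n)) ^ j - real (k choose j) / real (Suc n choose j)))
              \<le> p (Suc n) k * (2 * real j ^ 2 / real (Suc n))"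
            unfolding norm_mult using power_vs_binomial_ratio[of k "Suc n" j] n p0[of "Suc n" k]
            by (intro mult_mono) auto
        qed
        also have "\<dots> = 2 * real j ^ 2 / real (Suc n)"
          unfolding sum_distrib_right[symmetric] psum by simp
        finally show "norm (?e n) \<le> 2 * real j ^ 2 / real (Suc n)" .
      qed
      show "(\<lambda>n. 2 * real j ^ 2 / real (Suc n)) \<longlonglongrightarrow> 0"
        by (rule LIMSEQ_Suc[of "\<lambda>n. 2 * real j ^ 2 / real n"]) (rule lim_const_over_n)
    qed
    then have "(\<lambda>n. ?e n + b j / b 0) \<longlonglongrightarrow> 0 + b j / b 0" by (intro tendsto_intros)
    then show "(\<lambda>n. ?e n + b j / b 0) \<longlonglongrightarrow> b j / b 0" by simp
    show "\<forall>\<^sub>F n in sequentially. ?e n + b j / b 0 = (\<integral>t. clamp01 t ^ j \<partial>\<mu> n)"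
    proof (rule eventually_sequentiallyI)
      fix n assume n: "n \<ge> j"
      have "(\<Sum>k\<le>Suc n. p (Suc n) k * (real (k choose j) / real (Suc n choose j))) = b j / b 0"
      proof -
        have "(\<Sum>k\<le>Suc n. p (Suc n) k * (real (k choose j) / real (Suc n choose j)))
          = (\<Sum>k\<le>Suc n. real (Suc n choose k) * fdiff b (Suc n - k) k * (real (k choose j) / real (Suc n choose j))) / b 0"
          unfolding sum_divide_distrib p_def by (rule sum.cong) auto
        also have "\<dots> = b j / b 0" using fdiff_Bernstein_moment[of j "Suc n" b] n by simp
        finally show ?thesis .
      qed
      moreover have "(\<integral>t. clamp01 t ^ j \<partial>\<mu> n) = (\<Sum>k\<le>Suc n. p (Suc n) k * (real k / real (Suc n)) ^ j)"
        unfolding integral_mu[OF cl]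
        by (rule sum.cong[OF refl]) (simp add: clamp01(2) del: of_nat_Suc)
      ultimately show "?e n + b j / b 0 = (\<integral>t. clamp01 t ^ j \<partial>\<mu> n)"
        by (simp add: right_diff_distrib sum_subtractf del: sum.atMost_Suc)
    qed
  qed
  have momM: "(\<integral>t. clamp01 t ^ j \<partial>M) = b j / b 0" for j
  proof (rule LIMSEQ_unique)
    have "(\<lambda>n. \<integral>t. clamp01 t ^ j \<partial>(\<mu> \<circ> id \<circ> r) n) \<longlonglongrightarrow> (\<integral>t. clamp01 t ^ j \<partial>M)"
    proof (rule weak_conv_imp_integral_bdd_continuous_conv[OF _ M wc, of _ 1])
      show "norm (clamp01 x ^ j) \<le> 1" for x
        using clamp01(1)[of x] by (simp add: power_le_one)
    qed (auto simp: rd intro!: continuous_intros isCont_clamp01)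
    then show "(\<lambda>n. \<integral>t. clamp01 t ^ j \<partial>\<mu> (r n)) \<longlonglongrightarrow> (\<integral>t. clamp01 t ^ j \<partial>M)" by simp
    show "(\<lambda>n. \<integral>t. clamp01 t ^ j \<partial>\<mu> (r n)) \<longlonglongrightarrow> b j / b 0"
      using LIMSEQ_subseq_LIMSEQ[OF lim r] by (simp add: comp_def)
  qed
  define N where "N = density M (\<lambda>_. ennreal (b 0))"
  define \<tau> where "\<tau> = distr N (restrict_space borel {0..1}) clamp01"
  have mN: "clamp01 \<in> measurable N (restrict_space borel {0..1})"
    using measurable_clamp01 by (simp add: N_def cong: measurable_cong_sets)
  have "finite_measure N"
  proof (rule finite_measureI)
    have "emeasure N (space N) = ennreal (b 0)"
      using M.emeasure_space_1 by (simp add: N_def emeasure_density nn_integral_cmult_indicator)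
    then show "emeasure N (space N) \<noteq> \<infinity>" by simp
  qed
  then have "finite_measure \<tau>" unfolding \<tau>_def using mN by (rule finite_measure.finite_measure_distr)
  moreover have "(\<integral>t. t ^ k \<partial>\<tau>) = b k" for k
  proof -
    have "(\<integral>t. t ^ k \<partial>\<tau>) = (\<integral>t. clamp01 t ^ k \<partial>N)"
      unfolding \<tau>_def by (rule integral_distr[OF mN]) (rule measurable_restrict_space1, simp)
    also have "\<dots> = (\<integral>t. b 0 * clamp01 t ^ k \<partial>M)"
      unfolding N_def using b0 cl[of k] by (subst integral_density) (auto simp: measurable_cong_sets[OF M.events_eq_borel refl])
    also have "\<dots> = b k" using momM[of k] b0 by simp
    finally show ?thesis .
  qed
  ultimately show thesis using that[of \<tau>] by (simp add: \<tau>_def)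
qed

section \<open>Measures on [0,1] and their moments\<close>

lemma restrict_borel_measurable:
  fixes f :: "real \<Rightarrow> real"
  assumes "sets \<tau> = sets (restrict_space borel {0..1::real})" "f \<in> borel_measurable borel"
  shows "f \<in> borel_measurable \<tau>"
  using measurable_restrict_space1[OF assms(2), of "{0..1}"] assms(1) measurable_cong_sets by blast

lemma restrict_borel_space:
  "sets \<tau> = sets (restrict_space borel {0..1::real}) \<Longrightarrow> space \<tau> = {0..1}"
  by (drule sets_eq_imp_space_eq) (simp add: space_restrict_space)

lemma restrict_borel_integrable:
  fixes f :: "real \<Rightarrow> real"
  assumes \<tau>: "sets \<tau> = sets (restrict_space borel {0..1::real})" "finite_measure \<tau>"
    and f: "f \<in> borel_measurable borel" "\<And>x. x \<in> {0..1} \<Longrightarrow> \<bar>f x\<bar> \<le> B"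
  shows "integrable \<tau> f"
proof -
  interpret finite_measure \<tau> by fact
  show ?thesis
    by (rule integrable_const_bound[of _ B])
       (use f restrict_borel_space[OF \<tau>(1)] restrict_borel_measurable[OF \<tau>(1) f(1)] in auto)
qed

lemma integrable_power01:
  assumes "sets \<tau> = sets (restrict_space borel {0..1::real})" "finite_measure \<tau>"
  shows "integrable \<tau> (\<lambda>t. t ^ k)"
  by (rule restrict_borel_integrable[OF assms, of _ 1]) (auto simp: power_le_one)

text \<open>Equal moments give equal integrals of polynomials, then of continuous functions by
  Stone-Weierstrass, then equal distribution functions by approximating indicators of
  half-lines.\<close>

lemma Hausdorff_moment_unique:
  assumes 1: "sets \<tau>1 = sets (restrict_space borel {0..1::real})" "finite_measure \<tau>1"
    and 2: "sets \<tau>2 = sets (restrict_space borel {0..1::real})" "finite_measure \<tau>2"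
    and mom: "\<And>k. (\<integral>t. t ^ k \<partial>\<tau>1) = (\<integral>t. t ^ k \<partial>\<tau>2)"
  shows "\<tau>1 = \<tau>2"
proof -
  have cont_eq: "(\<integral>t. f t \<partial>\<tau>1) = (\<integral>t. f t \<partial>\<tau>2)" if f: "continuous_on UNIV f" for f :: "real \<Rightarrow> real"
  proof (rule ccontr)
    assume ne: "\<not> ?thesis"
    define d where "d = \<bar>(\<integral>t. f t \<partial>\<tau>1) - (\<integral>t. f t \<partial>\<tau>2)\<bar>"
    have d: "d > 0" using ne by (simp add: d_def)
    \<comment> \<open>The added 1 makes \<open>C\<close> exceed the two total masses together, so
      the approximation errors add up to strictly less than \<open>d\<close>.\<close>
    define C where "C = measure \<tau>1 {0..1} + measure \<tau>2 {0..1} + 1"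
    have C: "C > 0" by (auto simp: C_def intro!: add_nonneg_pos)
    have fm: "f \<in> borel_measurable borel" using f by (rule borel_measurable_continuous_onI)
    have "compact (f ` {0..1})"
      by (intro compact_continuous_image continuous_on_subset[OF f]) auto
    then obtain B where B: "\<And>x. x \<in> {0..1} \<Longrightarrow> \<bar>f x\<bar> \<le> B"
      using compact_imp_bounded[of "f ` {0..1}"] unfolding bounded_real by blast
    obtain g where g: "real_polynomial_function g" "\<And>x. x \<in> {0..1} \<Longrightarrow> \<bar>f x - g x\<bar> < d / C"
      using Stone_Weierstrass_real_polynomial_function[of "{0..1}" f "d / C"] d C continuous_on_subset[OF f]
      by (metis compact_Icc divide_pos_pos top_greatest)
    obtain a n where ga: "g = (\<lambda>x. \<Sum>i\<le>n. a i * x ^ i)"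
      using real_polynomial_function_imp_sum[OF g(1)] by blast
    have gm: "g \<in> borel_measurable borel" unfolding ga by simp
    have gi: "integrable \<tau> g" "(\<integral>t. g t \<partial>\<tau>) = (\<Sum>i\<le>n. a i * (\<integral>t. t ^ i \<partial>\<tau>))"
      if \<tau>: "sets \<tau> = sets (restrict_space borel {0..1::real})" "finite_measure \<tau>" for \<tau>
      unfolding ga using integrable_power01[OF \<tau>]
      by (auto intro!: Bochner_Integration.integrable_sum simp: Bochner_Integration.integral_sum)
    have close: "\<bar>(\<integral>t. f t \<partial>\<tau>) - (\<integral>t. g t \<partial>\<tau>)\<bar> \<le> d / C * measure \<tau> {0..1}"
      if \<tau>: "sets \<tau> = sets (restrict_space borel {0..1::real})" "finite_measure \<tau>" for \<tau>
    proof -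
      interpret finite_measure \<tau> by fact
      have fi: "integrable \<tau> f" by (rule restrict_borel_integrable[OF \<tau> fm B])
      have "\<bar>(\<integral>t. f t \<partial>\<tau>) - (\<integral>t. g t \<partial>\<tau>)\<bar> = norm (\<integral>t. f t - g t \<partial>\<tau>)"
        using fi gi(1)[OF \<tau>] by simp
      also have "\<dots> \<le> (\<integral>t. norm (f t - g t) \<partial>\<tau>)" by (rule integral_norm_bound)
      also have "\<dots> \<le> (\<integral>t. d / C \<partial>\<tau>)"
        using fi gi(1)[OF \<tau>] g(2) restrict_borel_space[OF \<tau>(1)]
        by (intro integral_mono) (auto simp: less_imp_le)
      also have "\<dots> = d / C * measure \<tau> {0..1}" using restrict_borel_space[OF \<tau>(1)] by simp
      finally show ?thesis .
    qed
    have "(\<integral>t. g t \<partial>\<tau>1) = (\<integral>t. g t \<partial>\<tau>2)" using gi(2)[OF 1] gi(2)[OF 2] mom by simp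
    then have "d \<le> d / C * measure \<tau>1 {0..1} + d / C * measure \<tau>2 {0..1}"
      using close[OF 1] close[OF 2] unfolding d_def[symmetric] by (simp add: d_def)
    also have "\<dots> = d * ((C - 1) / C)" by (simp add: C_def add_divide_distrib distrib_left)
    also have "\<dots> < d * 1" using d C by (intro mult_strict_left_mono) auto
    finally show False by simp
  qed
  define m where "m \<tau> = distr \<tau> borel (\<lambda>x::real. x)" for \<tau> :: "real measure"
  have mid: "(\<lambda>x. x) \<in> measurable \<tau> borel" if "sets \<tau> = sets (restrict_space borel {0..1::real})" for \<tau>
    using restrict_borel_measurable[OF that, of "\<lambda>x. x"] by simp
  have fbm: "finite_borel_measure (m \<tau>)"
    if \<tau>: "sets \<tau> = sets (restrict_space borel {0..1::real})" "finite_measure \<tau>" for \<tau>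
    unfolding finite_borel_measure_def finite_borel_measure_axioms_def m_def
    using finite_measure.finite_measure_distr[OF \<tau>(2) mid[OF \<tau>(1)]] by simp
  \<comment> \<open>For n at least 1 the integrand is a continuous ramp, equal to 1 up to x and to 0
    from x + 1/n on.\<close>
  have lim: "(\<lambda>n. \<integral>t. max 0 (min 1 (1 - real n * (t - x))) \<partial>\<tau>) \<longlonglongrightarrow> cdf (m \<tau>) x"
    if \<tau>: "sets \<tau> = sets (restrict_space borel {0..1::real})" "finite_measure \<tau>" for \<tau> x
  proof -
    interpret finite_measure \<tau> by fact
    have "(\<lambda>n. \<integral>t. max 0 (min 1 (1 - real n * (t - x))) \<partial>\<tau>) \<longlonglongrightarrow> (\<integral>t. indicator {..x} t \<partial>\<tau>)"
    proof (rule integral_dominated_convergence[where w = "\<lambda>_. 1"])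
      show "AE t in \<tau>. (\<lambda>n. max 0 (min 1 (1 - real n * (t - x)))) \<longlonglongrightarrow> indicat_real {..x} t"
      proof (rule AE_I2)
        fix t
        show "(\<lambda>n. max 0 (min 1 (1 - real n * (t - x)))) \<longlonglongrightarrow> indicat_real {..x} t"
        proof (cases "t \<le> x")
          case True
          then have "max 0 (min 1 (1 - real n * (t - x))) = 1" for n
            by (simp add: mult_nonneg_nonpos)
          then show ?thesis using True by simp
        next
          case False
          then obtain N where N: "real N * (t - x) > 1" using reals_Archimedean3[of "t - x"] by auto
          have "max 0 (min 1 (1 - real n * (t - x))) = 0" if "n \<ge> N" for n
          proof -
            have "real N * (t - x) \<le> real n * (t - x)" using that False by (intro mult_right_mono) auto
            then show ?thesis using N by simp
          qed
          then have "eventually (\<lambda>n. max 0 (min 1 (1 - real n * (t - x))) = 0) sequentially"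
            by (rule eventually_sequentiallyI)
          then show ?thesis using False by (simp add: tendsto_eventually)
        qed
      qed
      show "(\<lambda>t. max 0 (min 1 (1 - real n * (t - x)))) \<in> borel_measurable \<tau>" for n
        by (rule restrict_borel_measurable[OF \<tau>(1)]) simp
      show "indicat_real {..x} \<in> borel_measurable \<tau>"
        by (rule restrict_borel_measurable[OF \<tau>(1)]) simp
    qed auto
    also have "(\<integral>t. indicat_real {..x} t \<partial>\<tau>) = (\<integral>t. indicat_real {..x} t \<partial>m \<tau>)"
      unfolding m_def by (rule integral_distr[symmetric, OF mid[OF \<tau>(1)]]) simp
    also have "\<dots> = cdf (m \<tau>) x"
      by (simp add: cdf_def m_def)
    finally show ?thesis .
  qed
  have "cdf (m \<tau>1) x = cdf (m \<tau>2) x" for x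
  proof -
    have "(\<integral>t. max 0 (min 1 (1 - real n * (t - x))) \<partial>\<tau>1) = (\<integral>t. max 0 (min 1 (1 - real n * (t - x))) \<partial>\<tau>2)" for n
      by (rule cont_eq) (intro continuous_intros)
    then show ?thesis using LIMSEQ_unique[OF lim[OF 1, of x]] lim[OF 2, of x] by simp
  qed
  then have eq: "m \<tau>1 = m \<tau>2" using cdf_unique'[OF fbm[OF 1] fbm[OF 2]] by blast
  show ?thesis
  proof (rule measure_eqI)
    show "sets \<tau>1 = sets \<tau>2" using 1 2 by simp
    fix A assume A: "A \<in> sets \<tau>1"
    then have A': "A \<in> sets borel" "A \<subseteq> {0..1}" using 1 by (auto simp: sets_restrict_space)
    have *: "emeasure (m \<tau>) A = emeasure \<tau> A" if "sets \<tau> = sets (restrict_space borel {0..1::real})" for \<tau>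
      unfolding m_def using A' restrict_borel_space[OF that]
      by (subst emeasure_distr[OF mid[OF that]]) (auto simp: Int_absorb2)
    show "emeasure \<tau>1 A = emeasure \<tau>2 A" using *[OF 1(1)] *[OF 2(1)] eq by simp
  qed
qed

text \<open>The defining property of \<open>tau\<close>, for an arbitrary sequence in place of \<open>nsq ((wshift eta kappa lam ^^ n) (evec v))\<close>.\<close>
definition represents :: "(nat \<Rightarrow> real) \<Rightarrow> real measure \<Rightarrow> bool" where
  "represents a \<tau> \<longleftrightarrow> sets \<tau> = sets (restrict_space borel {0..1::real}) \<and>
      (\<forall>n\<ge>1. ennreal (a n) = 1 + (\<integral>\<^sup>+ t. ennreal (\<Sum>k<n. t ^ k) \<partial>\<tau>))"

text \<open>The defining equations telescope to the increments of a. The case n = 1 says that a 1 is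
  1 plus the total mass, so finiteness of the measure is a consequence; nonnegativity of a lets the
  equations in \<open>ennreal\<close> be read over the reals.\<close>

lemma represents_iff:
  assumes a0: "a 0 = 1" and a: "\<And>n. a n \<ge> 0"
  shows "represents a \<tau> \<longleftrightarrow> sets \<tau> = sets (restrict_space borel {0..1::real}) \<and> finite_measure \<tau> \<and>
     (\<forall>k. (\<integral>t. t ^ k \<partial>\<tau>) = a (Suc k) - a k)"
proof (cases "sets \<tau> = sets (restrict_space borel {0..1::real})")
  case sets: True
  have space: "space \<tau> = {0..1}" by (rule restrict_borel_space[OF sets])
  have nn: "(\<integral>\<^sup>+ t. ennreal (\<Sum>k<n. t ^ k) \<partial>\<tau>) = ennreal (\<Sum>k<n. \<integral>t. t ^ k \<partial>\<tau>)" "(\<Sum>k<n. \<integral>t. t ^ k \<partial>\<tau>) \<ge> 0"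
    if fin: "finite_measure \<tau>" for n
  proof -
    note i = integrable_power01[OF sets fin]
    have "(\<integral>\<^sup>+ t. ennreal (\<Sum>k<n. t ^ k) \<partial>\<tau>) = ennreal (\<integral>t. (\<Sum>k<n. t ^ k) \<partial>\<tau>)"
      by (rule nn_integral_eq_integral) (auto simp: i space intro!: AE_I2 sum_nonneg)
    then show "(\<integral>\<^sup>+ t. ennreal (\<Sum>k<n. t ^ k) \<partial>\<tau>) = ennreal (\<Sum>k<n. \<integral>t. t ^ k \<partial>\<tau>)"
      by (simp add: Bochner_Integration.integral_sum i)
    show "(\<Sum>k<n. \<integral>t. t ^ k \<partial>\<tau>) \<ge> 0"
      by (intro sum_nonneg integral_nonneg_AE AE_I2) (auto simp: space)
  qed
  show ?thesis
  proof
    assume R: "represents a \<tau>"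
    have "ennreal (a 1) = 1 + emeasure \<tau> (space \<tau>)"
      using R unfolding represents_def by (metis (no_types, lifting) One_nat_def ennreal_1 le_refl lessThan_0 lessThan_Suc mult.left_neutral nn_integral_const nn_integral_cong power_0 sum.empty sum.insert add.right_neutral finite.emptyI empty_iff)
    then have "emeasure \<tau> (space \<tau>) \<noteq> \<infinity>" by auto
    then have fin: "finite_measure \<tau>" by (rule finite_measureI)
    have an: "a n = 1 + (\<Sum>k<n. \<integral>t. t ^ k \<partial>\<tau>)" for n
    proof (cases n)
      case (Suc m)
      have "ennreal (a n) = 1 + ennreal (\<Sum>k<n. \<integral>t. t ^ k \<partial>\<tau>)"
        using R Suc unfolding represents_def nn(1)[OF fin] by auto
      also have "\<dots> = ennreal (1 + (\<Sum>k<n. \<integral>t. t ^ k \<partial>\<tau>))" using nn(2)[OF fin, of n] by (simp add: ennreal_plus)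
      finally show ?thesis using a nn(2)[OF fin, of n] by (subst (asm) ennreal_inj) auto
    qed (simp add: a0)
    show "sets \<tau> = sets (restrict_space borel {0..1::real}) \<and> finite_measure \<tau> \<and> (\<forall>k. (\<integral>t. t ^ k \<partial>\<tau>) = a (Suc k) - a k)"
      using sets fin an by simp
  next
    assume R: "sets \<tau> = sets (restrict_space borel {0..1::real}) \<and> finite_measure \<tau> \<and> (\<forall>k. (\<integral>t. t ^ k \<partial>\<tau>) = a (Suc k) - a k)"
    then have fin: "finite_measure \<tau>" by simp
    have an: "a n = 1 + (\<Sum>k<n. \<integral>t. t ^ k \<partial>\<tau>)" for n
      using R a0 by (simp add: sum_lessThan_telescope)
    show "represents a \<tau>"
      unfolding represents_def nn(1)[OF fin] using sets nn(2)[OF fin]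
      by (subst an) (auto simp: ennreal_plus)
  qed
qed (simp add: represents_def)

lemma represents_unique:
  assumes "a 0 = 1" "\<And>n. a n \<ge> 0" "represents a \<tau>1" "represents a \<tau>2"
  shows "\<tau>1 = \<tau>2"
  using assms(3,4) unfolding represents_iff[of a, OF assms(1,2)] by (intro Hausdorff_moment_unique) auto

lemma represents_ex1:
  assumes "a 0 = 1" "\<And>n. a n \<ge> 0" "completely_alternating a"
  shows "\<exists>!\<tau>. represents a \<tau>"
proof -
  have "completely_monotone (\<lambda>n. a (Suc n) - a n)" using assms(3) completely_alternating_iff by blast
  then obtain \<tau> where "sets \<tau> = sets (restrict_space borel {0..1::real})" "finite_measure \<tau>"
    "\<And>k. (\<integral>t. t ^ k \<partial>\<tau>) = a (Suc k) - a k"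
    by (rule Hausdorff_moment_exists) (rule that)
  then have "represents a \<tau>" unfolding represents_iff[of a, OF assms(1,2)] by simp
  then show ?thesis using represents_unique[of a, OF assms(1,2)] by blast
qed

text \<open>Every point outside the support has a null neighbourhood, and by Lindelof countably many
  of these cover the complement, which is therefore null. In a finite support each point is
  isolated, so the positive mass of its small balls sits at the point itself.\<close>

lemma finite_msupp_atomic:
  assumes \<tau>: "sets \<tau> = sets (restrict_space borel {0..1::real})" "finite_measure \<tau>"
    and fin: "finite (msupp \<tau>)" and sub: "msupp \<tau> \<subseteq> {0<..1}"
  shows "atomic (msupp \<tau>) (\<lambda>x. measure \<tau> {x})"
    and "(\<integral>t. t ^ k \<partial>\<tau>) = (\<Sum>x\<in>msupp \<tau>. measure \<tau> {x} * x ^ k)"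
proof -
  interpret finite_measure \<tau> by fact
  define X where "X = msupp \<tau>"
  have space: "space \<tau> = {0..1}" by (rule restrict_borel_space[OF \<tau>(1)])
  have X01: "X \<subseteq> {0..1}" using sub by (auto simp: X_def)
  have msets: "A \<inter> {0..1} \<in> sets \<tau>" if "A \<in> sets borel" for A
    using that \<tau>(1) by (auto simp: sets_restrict_space)
  have Xs: "A \<in> sets \<tau>" if "A \<subseteq> X" for A
  proof -
    have "finite A" using that fin finite_subset X_def by blast
    then have "A \<in> sets borel" by (simp add: borel_closed finite_imp_closed)
    moreover have "A \<inter> {0..1} = A" using that X01 by auto
    ultimately show ?thesis using msets by metis
  qed
  have null: "{0..1} - X \<in> null_sets \<tau>"
  proof -
    define F where "F = {ball t e |t e. t \<in> {0..1} - X \<and> e > 0 \<and> emeasure \<tau> (ball t e \<inter> {0..1}) = 0}"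
    obtain F' where F': "F' \<subseteq> F" "countable F'" "\<Union>F' = \<Union>F"
      by (rule Lindelof[of F]) (auto simp: F_def)
    have "(\<Union>S\<in>F'. S \<inter> {0..1}) \<in> null_sets \<tau>"
    proof (rule null_sets_UN'[OF F'(2)])
      fix S assume "S \<in> F'"
      then show "S \<inter> {0..1} \<in> null_sets \<tau>" using F'(1) msets by (auto simp: F_def null_sets_def)
    qed
    moreover have "{0..1} - X \<subseteq> (\<Union>S\<in>F'. S \<inter> {0..1})"
    proof
      fix t assume t: "t \<in> {0..1} - X"
      then obtain e where "e > 0" "emeasure \<tau> (ball t e \<inter> {0..1}) = 0"
        unfolding X_def msupp_def space by (auto simp: not_gr_zero)
      then have "t \<in> \<Union>F" using t by (auto simp: F_def intro!: exI[of _ "ball t e"])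
      then show "t \<in> (\<Union>S\<in>F'. S \<inter> {0..1})" using F'(3) t by auto
    qed
    moreover have "{0..1} - X \<in> sets \<tau>"
      using sets.compl_sets[OF Xs[of X]] space by simp
    ultimately show ?thesis by (meson null_sets_subset)
  qed
  show "atomic (msupp \<tau>) (\<lambda>x. measure \<tau> {x})"
    unfolding atomic_def
  proof (intro conjI ballI fin sub)
    fix x assume x: "x \<in> msupp \<tau>"
    have "open (- (X - {x}))" 
      using fin finite_imp_closed[of "X - {x}"] by (intro open_Compl) (simp add: X_def)
    then obtain e where e: "e > 0" "ball x e \<subseteq> - (X - {x})"
      using open_contains_ball[of "- (X - {x})"] by auto
    have "0 < emeasure \<tau> (ball x e \<inter> {0..1})" using x e(1) unfolding msupp_def space by auto
    also have "\<dots> \<le> emeasure \<tau> ({x} \<union> ({0..1} - X))"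
    proof (rule emeasure_mono)
      show "{x} \<union> ({0..1} - X) \<in> sets \<tau>"
        using null Xs[of "{x}"] x by (intro sets.Un) (auto simp: X_def)
    qed (use e(2) in auto)
    also have "\<dots> = emeasure \<tau> {x}"
      using null Xs[of "{x}"] x by (subst emeasure_Un_null_set) (auto simp: X_def)
    finally show "0 < measure \<tau> {x}" by (simp add: emeasure_eq_measure)
  qed
  have "(\<integral>t. t ^ k \<partial>\<tau>) = (\<integral>t. (\<Sum>x\<in>X. x ^ k * indicator {x} t) \<partial>\<tau>)"
  proof (rule integral_cong_AE)
    show "AE t in \<tau>. t ^ k = (\<Sum>x\<in>X. x ^ k * indicator {x} t)"
    proof (rule AE_I'[OF null], safe)
      fix t assume t: "t \<in> space \<tau>" "t ^ k \<noteq> (\<Sum>x\<in>X. x ^ k * indicator {x} t)"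
      then show "t \<in> {0..1}" using space by simp
      assume "t \<in> X"
      then have "(\<Sum>x\<in>X. x ^ k * indicator {x} t) = (\<Sum>x\<in>X. if x = t then t ^ k else 0)"
        by (intro sum.cong) (auto simp: indicator_def)
      also have "\<dots> = t ^ k" using \<open>t \<in> X\<close> fin by (simp add: X_def)
      finally show False using t by simp
    qed
    show "(\<lambda>t. t ^ k) \<in> borel_measurable \<tau>" by (rule restrict_borel_measurable[OF \<tau>(1)]) simp
    show "(\<lambda>t. \<Sum>x\<in>X. x ^ k * indicator {x} t) \<in> borel_measurable \<tau>"
      by (rule restrict_borel_measurable[OF \<tau>(1)]) simp
  qed
  also have "\<dots> = (\<Sum>x\<in>X. \<integral>t. x ^ k * indicator {x} t \<partial>\<tau>)"
    by (rule Bochner_Integration.integral_sum)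
       (use Xs in \<open>auto intro!: integrable_mult_right integrable_real_indicator simp: less_top[symmetric]\<close>)
  also have "\<dots> = (\<Sum>x\<in>X. measure \<tau> {x} * x ^ k)"
    using X01 space by (intro sum.cong) (auto simp: Int_absorb2)
  finally show "(\<integral>t. t ^ k \<partial>\<tau>) = (\<Sum>x\<in>msupp \<tau>. measure \<tau> {x} * x ^ k)" by (simp add: X_def)
qed

lemma msupp_disc_measure:
  assumes at: "atomic X w"
  shows "msupp (disc_measure 0 X w) = X"
proof -
  note X = atomicD[OF at]
  have X01: "X \<subseteq> {0..1}" using X by (auto simp: less_imp_le)
  have ms: "ball t e \<inter> {0..1} \<in> sets (restrict_space borel {0..1})" for t e :: real
    unfolding sets_restrict_space by (rule image_eqI[of _ _ "ball t e"]) auto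
  have em: "emeasure (disc_measure 0 X w) (ball t e \<inter> {0..1}) = (\<Sum>x\<in>ball t e \<inter> {0..1} \<inter> X. ennreal (w x))" for t e
    by (rule emeasure_disc_measure[OF X(1) X01 ms])
  show ?thesis
  proof (intro equalityI subsetI)
    fix t assume t: "t \<in> msupp (disc_measure 0 X w)"
    show "t \<in> X"
    proof (rule ccontr)
      assume "t \<notin> X"
      have "open (- X)" using X(1) by (simp add: open_Compl finite_imp_closed)
      then obtain e where e: "e > 0" "ball t e \<subseteq> - X"
        using open_contains_ball[of "- X"] \<open>t \<notin> X\<close> by auto
      then have "ball t e \<inter> {0..1} \<inter> X = {}" by auto
      then have "emeasure (disc_measure 0 X w) (ball t e \<inter> {0..1}) = 0" unfolding em by simp
      then show False using t e(1) unfolding msupp_def by auto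
    qed
  next
    fix t assume t: "t \<in> X"
    have "emeasure (disc_measure 0 X w) (ball t e \<inter> {0..1}) > 0" if "e > 0" for e
    proof -
      have "0 < ennreal (w t)" using X(4)[OF t] by simp
      also have "\<dots> \<le> (\<Sum>x\<in>ball t e \<inter> {0..1} \<inter> X. ennreal (w x))"
        using t X01 X(1) that by (intro member_le_sum) auto
      finally show ?thesis unfolding em .
    qed
    then show "t \<in> msupp (disc_measure 0 X w)" using t X01 unfolding msupp_def by auto
  qed
qed

lemma ind1_eq_idx2:
  assumes "finite (msupp \<tau>)" "msupp \<tau> \<subseteq> {0<..1}"
  shows "ind1 \<tau> = ereal (real (idx2 (msupp \<tau>)) / 2)"
  using assms by (simp add: ind1_def idx2_def)

lemma represents_ind1D:
  assumes "a 0 = 1" "\<And>n. a n \<ge> 0" "represents a \<tau>" "ind1 \<tau> = ereal K"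
  obtains X w where "atomic X w" "real (idx2 X) = 2 * K" "\<And>k. a (Suc k) - a k = (\<Sum>x\<in>X. w x * x ^ k)"
proof -
  have \<tau>: "sets \<tau> = sets (restrict_space borel {0..1::real})" "finite_measure \<tau>"
     "\<And>k. (\<integral>t. t ^ k \<partial>\<tau>) = a (Suc k) - a k"
    using assms(3) unfolding represents_iff[of a, OF assms(1,2)] by auto
  have s: "finite (msupp \<tau>)" "msupp \<tau> \<subseteq> {0<..1}" using assms(4) by (auto simp: ind1_def split: if_splits)
  note f = finite_msupp_atomic[OF \<tau>(1,2) s]
  show thesis
    using that[OF f(1)] f(2) \<tau>(3) ind1_eq_idx2[OF s] assms(4) by simp
qed

lemma ind1_The_represents:
  assumes a0: "a 0 = 1" and a: "\<And>n. a n \<ge> 0" and at: "atomic X w"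
    and mom: "\<And>k. a (Suc k) - a k = (\<Sum>x\<in>X. w x * x ^ k)"
  shows "ind1 (THE \<tau>. represents a \<tau>) = ereal (real (idx2 X) / 2)"
proof -
  note X = atomicD[OF at]
  have X01: "X \<subseteq> {0..1}" using X by (auto simp: less_imp_le)
  let ?m = "disc_measure 0 X w"
  have "emeasure ?m (space ?m) \<noteq> \<infinity>"
    using X X01 by (subst emeasure_disc_measure) (auto simp: sets_restrict_space)
  then have "finite_measure ?m" by (rule finite_measureI)
  moreover have "(\<integral>t. t ^ k \<partial>?m) = (\<Sum>x\<in>X. w x * x ^ k)" for k
    by (rule integral_disc_measure) (use X X01 in \<open>auto simp: less_imp_le\<close>)
  ultimately have "represents a ?m"
    unfolding represents_iff[of a, OF a0 a] using mom by simp
  then have "(THE \<tau>. represents a \<tau>) = ?m"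
    using represents_unique[of a, OF a0 a] by (intro the_equality) auto
  then show ?thesis
    using ind1_eq_idx2[of ?m] msupp_disc_measure[OF at] X by (auto simp: subset_iff)
qed

section \<open>Weighted shifts on the tree\<close>

lemma has_sum_diff_real:
  fixes f g :: "'i \<Rightarrow> real"
  assumes "(f has_sum a) A" "(g has_sum b) A"
  shows "((\<lambda>x. f x - g x) has_sum (a - b)) A"
  using has_sum_add[OF assms(1) has_sum_cmult_right[OF assms(2), of "-1"]] by simp

lemma has_sum_fdiff:
  assumes "\<And>n. ((\<lambda>i. f i n) has_sum S n) I"
  shows "((\<lambda>i. fdiff (f i) r k) has_sum fdiff S r k) I"
  by (induction r arbitrary: k) (simp_all add: assms fdiff_Suc has_sum_diff_real)

lemma fdiff_cmult: "fdiff (\<lambda>n. c * b n) r k = c * fdiff b r k"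
  by (induction r arbitrary: k) (simp_all add: fdiff_Suc algebra_simps)

lemma fdiff_add: "fdiff (\<lambda>n. b n + b' n) r k = fdiff b r k + fdiff b' r k"
  by (induction r arbitrary: k) (simp_all add: fdiff_Suc algebra_simps)

lemma fdiff_shift: "fdiff (\<lambda>n. b (n + m)) r k = fdiff b r (k + m)"
  by (induction r arbitrary: k) (simp_all add: fdiff_Suc)

text \<open>Needed at x = 0: the differences of \<open>0 ^ n\<close> at place k equal
  \<open>0 ^ k\<close> for every order r, so a mass at 0 reappears undiminished in all of
  them.\<close>

lemma fdiff_power: "fdiff (\<lambda>n. x ^ n) r k = x ^ k * (1 - x) ^ r"
  by (induction r arbitrary: k) (simp_all add: fdiff_Suc algebra_simps)

section \<open>Infinite mixtures of atomic moment sequences\<close>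

definition pmom :: "real set \<Rightarrow> (real \<Rightarrow> real) \<Rightarrow> int \<Rightarrow> real" where
  "pmom X w k = (\<Sum>x\<in>X. w x * x powi k)"

lemma pmom_of_nat: "pmom X w (int k) = (\<Sum>x\<in>X. w x * x ^ k)"
  by (simp add: pmom_def)

lemma pmom_nonneg:
  assumes "atomic X w" shows "pmom X w k \<ge> 0"
  unfolding pmom_def using atomicD[OF assms] by (intro sum_nonneg mult_nonneg_nonneg) (auto simp: less_imp_le)

lemma pmom_pos:
  assumes "atomic X w" "X \<noteq> {}" shows "pmom X w k > 0"
  unfolding pmom_def using atomicD[OF assms(1)] assms(2) by (intro sum_pos mult_pos_pos) auto

lemma fdiff_pmom:
  assumes "atomic X w"
  shows "fdiff (\<lambda>n. pmom X w (d + int n)) r k = (\<Sum>x\<in>X. w x * x powi (d + int k) * (1 - x) ^ r)"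
proof (induction r arbitrary: k)
  case (Suc r)
  have "(\<Sum>x\<in>X. w x * x powi (d + int k) * (1 - x) ^ r) - (\<Sum>x\<in>X. w x * x powi (d + int (Suc k)) * (1 - x) ^ r)
     = (\<Sum>x\<in>X. w x * x powi (d + int k) * (1 - x) ^ Suc r)"
    unfolding sum_subtractf[symmetric]
  proof (rule sum.cong[OF refl])
    fix x assume "x \<in> X"
    then have "x \<noteq> 0" using atomicD(2)[OF assms, of x] by auto
    moreover have "d + int (Suc k) = (d + int k) + 1" by simp
    ultimately have "x powi (d + int (Suc k)) = x powi (d + int k) * x"
      by (metis power_int_add_1)
    then show "w x * x powi (d + int k) * (1 - x) ^ r - w x * x powi (d + int (Suc k)) * (1 - x) ^ r
      = w x * x powi (d + int k) * (1 - x) ^ Suc r" by (simp add: algebra_simps)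
  qed
  then show ?case unfolding fdiff_Suc Suc by simp
qed (simp add: pmom_def)

lemma fdiff_pmom_nonneg:
  assumes "atomic X w"
  shows "fdiff (\<lambda>n. pmom X w (d + int n)) r k \<ge> 0"
  unfolding fdiff_pmom[OF assms]
  by (intro sum_nonneg) (use atomicD[OF assms] in \<open>auto simp: less_imp_le\<close>)

text \<open>Models a mass \<open>c\<close> at 0 plus \<open>P\<close> times the mixture of the
  branch measures multiplied by t^d. Differences are finite combinations, so they pass through the
  possibly infinite sum; \<open>h\<close> records their values together with convergence.\<close>

lemma fdiff_mixture:
  assumes at: "\<And>i. i \<in> I \<Longrightarrow> atomic (X i) (w i)"
    and summ: "\<And>n. (\<lambda>i. l i * pmom (X i) (w i) (d + int n)) summable_on I"
    and b: "\<And>n. b n = c * 0 ^ n + P * (\<Sum>\<^sub>\<infinity>i\<in>I. l i * pmom (X i) (w i) (d + int n))"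
  obtains h where "\<And>r k. ((\<lambda>i. l i * fdiff (\<lambda>n. pmom (X i) (w i) (d + int n)) r k) has_sum h r k) I"
    "\<And>r k. fdiff b r k = c * 0 ^ k + P * h r k"
proof -
  define h where "h r k = fdiff (\<lambda>n. \<Sum>\<^sub>\<infinity>i\<in>I. l i * pmom (X i) (w i) (d + int n)) r k" for r k
  have "((\<lambda>i. fdiff (\<lambda>n. l i * pmom (X i) (w i) (d + int n)) r k) has_sum h r k) I" for r k
    unfolding h_def by (rule has_sum_fdiff) (use summ in simp)
  then have "((\<lambda>i. l i * fdiff (\<lambda>n. pmom (X i) (w i) (d + int n)) r k) has_sum h r k) I" for r k
    by (simp only: fdiff_cmult)
  moreover have "fdiff b r k = c * 0 ^ k + P * h r k" for r k
  proof -
    have "b = (\<lambda>n. c * 0 ^ n + P * (\<Sum>\<^sub>\<infinity>i\<in>I. l i * pmom (X i) (w i) (d + int n)))" using b by auto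
    then show ?thesis by (simp only: fdiff_add fdiff_cmult fdiff_power h_def) simp
  qed
  ultimately show thesis by (rule that)
qed

lemma completely_monotone_mixture:
  assumes at: "\<And>i. i \<in> I \<Longrightarrow> atomic (X i) (w i)" and l: "\<And>i. i \<in> I \<Longrightarrow> l i \<ge> 0"
    and c: "c \<ge> 0" and P: "P \<ge> 0"
    and summ: "\<And>n. (\<lambda>i. l i * pmom (X i) (w i) (d + int n)) summable_on I"
    and b: "\<And>n. b n = c * 0 ^ n + P * (\<Sum>\<^sub>\<infinity>i\<in>I. l i * pmom (X i) (w i) (d + int n))"
  shows "completely_monotone b"
proof -
  obtain h where h: "\<And>r k. ((\<lambda>i. l i * fdiff (\<lambda>n. pmom (X i) (w i) (d + int n)) r k) has_sum h r k) I"
    "\<And>r k. fdiff b r k = c * 0 ^ k + P * h r k"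
    by (rule fdiff_mixture[OF at summ b]) (assumption, rule that)
  have "h r k \<ge> 0" for r k
    using h(1) by (rule has_sum_nonneg) (auto intro!: mult_nonneg_nonneg l fdiff_pmom_nonneg at)
  then show ?thesis unfolding completely_monotone_def h(2) using c P by simp
qed

text \<open>The telescoped differences give \<open>b 0 \<ge> (\<Sum>n<N. c + P \<Sum>\<^sub>i l\<^sub>i \<integral>t\<^sup>d (1 - t)\<^sup>n d\<mu>\<^sub>i)\<close> for every \<open>N\<close>.\<close>
lemma mixture_extend_backward:
  assumes at: "\<And>i. i \<in> I \<Longrightarrow> atomic (X i) (w i)" and l: "\<And>i. i \<in> I \<Longrightarrow> l i \<ge> 0"
    and c: "c \<ge> 0" and P: "P > 0" and cm: "completely_monotone b"
    and summ: "\<And>n. (\<lambda>i. l i * pmom (X i) (w i) (d + int n)) summable_on I"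
    and b: "\<And>n. b (Suc n) = c * 0 ^ n + P * (\<Sum>\<^sub>\<infinity>i\<in>I. l i * pmom (X i) (w i) (d + int n))"
  shows "c = 0" "(\<lambda>i. l i * pmom (X i) (w i) (d - 1)) summable_on I"
    "P * (\<Sum>\<^sub>\<infinity>i\<in>I. l i * pmom (X i) (w i) (d - 1)) \<le> b 0"
proof -
  obtain h where h: "\<And>r k. ((\<lambda>i. l i * fdiff (\<lambda>n. pmom (X i) (w i) (d + int n)) r k) has_sum h r k) I"
    "\<And>r k. fdiff (\<lambda>n. b (Suc n)) r k = c * 0 ^ k + P * h r k"
    by (rule fdiff_mixture[OF at summ b]) (assumption, rule that)
  \<comment> \<open>The geometric sum gives \<open>g i N\<close> as the integral of t^(d-1) (1 - (1
    - t)^N), which tends to the moment of order d - 1 as N grows.\<close>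
  define g where "g i N = (\<Sum>n<N. fdiff (\<lambda>n. pmom (X i) (w i) (d + int n)) n 0)" for i N
  have g0: "g i N \<ge> 0" if "i \<in> I" for i N
    unfolding g_def by (intro sum_nonneg fdiff_pmom_nonneg at that)
  have hg: "((\<lambda>i. l i * g i N) has_sum (\<Sum>n<N. h n 0)) I" for N
    unfolding g_def by (induction N) (auto simp: algebra_simps intro!: has_sum_add h(1)[simplified])
  have tel: "fdiff b N 0 = b 0 - (real N * c + P * (\<Sum>n<N. h n 0))" for N
  proof (induction N)
    case (Suc N)
    have "fdiff b N (Suc 0) = c + P * h N 0"
      using h(2)[of N 0] fdiff_shift[of b 1 N 0] by simp
    then show ?case using Suc by (simp add: fdiff_Suc algebra_simps)
  qed simp
  have bound: "real N * c + P * (\<Sum>n<N. h n 0) \<le> b 0" for N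
    using tel[of N] cm unfolding completely_monotone_def by (metis diff_ge_0_iff_ge)
  have hpos: "(\<Sum>n<N. h n 0) \<ge> 0" for N
    using hg by (rule has_sum_nonneg) (use l g0 in auto)
  have Nc: "real N * c \<le> b 0" for N
    using bound[of N] mult_nonneg_nonneg[of P, OF _ hpos[of N]] P by linarith
  show c0: "c = 0"
  proof (rule ccontr)
    assume "c \<noteq> 0"
    then have "c > 0" using c by simp
    then obtain N where "b 0 < real N * c" using reals_Archimedean3[of c] by auto
    then show False using Nc[of N] by simp
  qed
  have limg: "g i \<longlonglongrightarrow> pmom (X i) (w i) (d - 1)" if i: "i \<in> I" for i
  proof -
    note Xi = atomicD[OF at[OF i]]
    have gi: "g i N = (\<Sum>x\<in>X i. w i x * x powi (d - 1) * (1 - (1 - x) ^ N))" for N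
    proof -
      have "g i N = (\<Sum>n<N. \<Sum>x\<in>X i. w i x * x powi d * (1 - x) ^ n)"
        unfolding g_def by (simp add: fdiff_pmom[OF at[OF i]])
      also have "\<dots> = (\<Sum>x\<in>X i. w i x * x powi d * (\<Sum>n<N. (1 - x) ^ n))"
        by (subst sum.swap) (simp add: sum_distrib_left)
      also have "\<dots> = (\<Sum>x\<in>X i. w i x * x powi (d - 1) * (1 - (1 - x) ^ N))"
      proof (rule sum.cong[OF refl])
        fix x assume "x \<in> X i"
        then have x: "x \<noteq> 0" using Xi(2)[of x] by auto
        have "x powi d = x powi (d - 1) * x" using x power_int_add_1[of x "d - 1"] by simp
        moreover have "x * (\<Sum>n<N. (1 - x) ^ n) = 1 - (1 - x) ^ N"
          using one_diff_power_eq[of "1 - x" N] by simp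
        ultimately show "w i x * x powi d * (\<Sum>n<N. (1 - x) ^ n) = w i x * x powi (d - 1) * (1 - (1 - x) ^ N)"
          by (simp add: mult.assoc)
      qed
      finally show ?thesis .
    qed
    have "(\<lambda>N. \<Sum>x\<in>X i. w i x * x powi (d - 1) * (1 - (1 - x) ^ N))
        \<longlonglongrightarrow> (\<Sum>x\<in>X i. w i x * x powi (d - 1) * (1 - 0))"
      by (intro tendsto_intros LIMSEQ_power_zero) (use Xi in force)
    then show ?thesis unfolding gi pmom_def by simp
  qed
  \<comment> \<open>The limit in N is taken under finite sums over i only; the bound is uniform in
    \<open>F\<close>, hence gives summability over the whole index set.\<close>
  have fin: "(\<Sum>i\<in>F. l i * pmom (X i) (w i) (d - 1)) \<le> b 0 / P" if F: "finite F" "F \<subseteq> I" for F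
  proof (rule LIMSEQ_le_const2)
    show "(\<lambda>N. \<Sum>i\<in>F. l i * g i N) \<longlonglongrightarrow> (\<Sum>i\<in>F. l i * pmom (X i) (w i) (d - 1))"
      by (intro tendsto_intros limg) (use F in auto)
    have "(\<Sum>i\<in>F. l i * g i N) \<le> b 0 / P" for N
    proof -
      have "(\<Sum>i\<in>F. l i * g i N) \<le> (\<Sum>n<N. h n 0)"
        by (rule finite_sum_le_has_sum[OF hg F]) (use l g0 in auto)
      also have "\<dots> \<le> b 0 / P" using bound[of N] c0 P by (simp add: field_simps)
      finally show ?thesis .
    qed
    then show "\<exists>N. \<forall>n\<ge>N. (\<Sum>i\<in>F. l i * g i n) \<le> b 0 / P" by blast
  qed
  show s: "(\<lambda>i. l i * pmom (X i) (w i) (d - 1)) summable_on I"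
  proof (rule nonneg_bdd_above_summable_on)
    show "bdd_above (sum (\<lambda>i. l i * pmom (X i) (w i) (d - 1)) ` {F. F \<subseteq> I \<and> finite F})"
      using fin by (intro bdd_aboveI[of _ "b 0 / P"]) auto
  qed (use l at pmom_nonneg in auto)
  have "(\<Sum>\<^sub>\<infinity>i\<in>I. l i * pmom (X i) (w i) (d - 1)) \<le> b 0 / P"
    by (rule infsum_le_finite_sums[OF s fin])
  then show "P * (\<Sum>\<^sub>\<infinity>i\<in>I. l i * pmom (X i) (w i) (d - 1)) \<le> b 0"
    using P by (simp add: field_simps)
qed

section \<open>Tree structure and bounded weights\<close>

lemma children_Neg_0: "children eta kappa (Neg 0) = (\<lambda>i. Br i 1) ` Idx eta"
proof -
  have "u \<in> children eta kappa (Neg 0) \<longleftrightarrow> u \<in> (\<lambda>i. Br i 1) ` Idx eta" for u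
    by (cases u) (auto simp: children_def Vt_def root_def split: if_splits)
  then show ?thesis by blast
qed

lemma children_Neg_Suc: "Suc k \<le> kappa \<Longrightarrow> children eta kappa (Neg (Suc k)) = {Neg k}"
proof -
  assume "Suc k \<le> kappa"
  then have "u \<in> children eta kappa (Neg (Suc k)) \<longleftrightarrow> u = Neg k" for u
    by (cases u) (auto simp: children_def Vt_def root_def split: if_splits)
  then show ?thesis by blast
qed

lemma children_Br: "i \<in> Idx eta \<Longrightarrow> 1 \<le> j \<Longrightarrow> children eta kappa (Br i j) = {Br i (Suc j)}"
proof -
  assume "i \<in> Idx eta" "1 \<le> j"
  then have "u \<in> children eta kappa (Br i j) \<longleftrightarrow> u = Br i (Suc j)" for u
    by (cases u) (auto simp: children_def Vt_def root_def split: if_splits)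
  then show ?thesis by blast
qed

lemma par_in_Vt: "u \<in> Vt eta kappa \<Longrightarrow> u \<noteq> root kappa \<Longrightarrow> par u \<in> Vt eta kappa"
  by (cases u) (auto simp: Vt_def root_def)

lemma children_in_Vt: "u \<in> children eta kappa v \<Longrightarrow> u \<in> Vt eta kappa"
  by (auto simp: children_def)

text \<open>Replaces the extended-real supremum of infinite sums by one real bound on finite partial
  sums, the form used both for estimates and for the constructed completion.\<close>

lemma bounded_weights_iff:
  "bounded_weights eta kappa L \<longleftrightarrow>
     (\<exists>C. \<forall>v\<in>Vt eta kappa. \<forall>F. finite F \<and> F \<subseteq> children eta kappa v \<longrightarrow> (\<Sum>u\<in>F. (cmod (L u))\<^sup>2) \<le> C)"
    (is "_ \<longleftrightarrow> ?R")
proof -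
  let ?S = "\<lambda>v. \<Sum>\<^sub>\<infinity>u\<in>children eta kappa v. ennreal ((cmod (L u))\<^sup>2)"
  have S: "?S v = (SUP F\<in>{F. finite F \<and> F \<subseteq> children eta kappa v}. ennreal (\<Sum>u\<in>F. (cmod (L u))\<^sup>2))" for v
    by (subst nonneg_infsum_complete) (auto simp: sum_ennreal)
  show ?thesis
  proof
    assume bw: "bounded_weights eta kappa L"
    define C where "C = (SUP v\<in>Vt eta kappa. ?S v)"
    have C: "C < \<infinity>" using bw by (simp add: bounded_weights_def C_def)
    have "(\<Sum>u\<in>F. (cmod (L u))\<^sup>2) \<le> enn2real C" if "v \<in> Vt eta kappa" "finite F" "F \<subseteq> children eta kappa v" for v F
    proof -
      have "ennreal (\<Sum>u\<in>F. (cmod (L u))\<^sup>2) \<le> ?S v" unfolding S using that by (intro SUP_upper) auto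
      also have "\<dots> \<le> C" unfolding C_def using that by (intro SUP_upper) auto
      finally have "ennreal (\<Sum>u\<in>F. (cmod (L u))\<^sup>2) \<le> ennreal (enn2real C)" using C by (simp add: less_top)
      then show ?thesis by (subst (asm) ennreal_le_iff) auto
    qed
    then show ?R by blast
  next
    assume ?R
    then obtain C where C: "\<And>v F. v \<in> Vt eta kappa \<Longrightarrow> finite F \<Longrightarrow> F \<subseteq> children eta kappa v \<Longrightarrow>
        (\<Sum>u\<in>F. (cmod (L u))\<^sup>2) \<le> C" by blast
    have "(SUP v\<in>Vt eta kappa. ?S v) \<le> ennreal C"
      unfolding S by (intro SUP_least) (use C in \<open>auto intro!: ennreal_leI\<close>)
    then show "bounded_weights eta kappa L"
      unfolding bounded_weights_def using ennreal_less_top le_less_trans by (metis infinity_ennreal_def)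
  qed
qed

lemma evec_in_l2: "v \<in> V \<Longrightarrow> evec v \<in> l2 V"
proof -
  assume v: "v \<in> V"
  have "(\<lambda>u. (cmod (evec v u))\<^sup>2) summable_on {v}" by simp
  then have "(\<lambda>u. (cmod (evec v u))\<^sup>2) summable_on UNIV"
    by (subst summable_on_cong_neutral[of "{v}" UNIV]) (auto simp: evec_def)
  then show ?thesis using v by (auto simp: l2_def evec_def)
qed

text \<open>\<open>orbit_nsq eta kappa L n v\<close> is \<open>\<parallel>S\<^sup>n e\<^sub>v\<parallel>\<^sup>2\<close> for \<open>v\<close> in the tree.\<close>
primrec orbit_nsq :: "enat \<Rightarrow> nat \<Rightarrow> (vtx \<Rightarrow> complex) \<Rightarrow> nat \<Rightarrow> vtx \<Rightarrow> real" where
  "orbit_nsq eta kappa L 0 v = 1"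
| "orbit_nsq eta kappa L (Suc n) v = (\<Sum>\<^sub>\<infinity>u\<in>children eta kappa v. (cmod (L u))\<^sup>2 * orbit_nsq eta kappa L n u)"

section \<open>Orbit norms of a bounded shift\<close>

locale bounded_shift =
  fixes eta :: enat and kappa :: nat and L :: "vtx \<Rightarrow> complex"
  assumes bounded: "bounded_weights eta kappa L"
begin

abbreviation "V \<equiv> Vt eta kappa"
abbreviation "ch \<equiv> children eta kappa"
abbreviation "S \<equiv> wshift eta kappa L"
abbreviation "N \<equiv> orbit_nsq eta kappa L"

definition C :: real where
  "C = (SOME C. \<forall>v\<in>V. \<forall>F. finite F \<and> F \<subseteq> ch v \<longrightarrow> (\<Sum>u\<in>F. (cmod (L u))\<^sup>2) \<le> C)"

lemma C: "v \<in> V \<Longrightarrow> finite F \<Longrightarrow> F \<subseteq> ch v \<Longrightarrow> (\<Sum>u\<in>F. (cmod (L u))\<^sup>2) \<le> C"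
  using someI_ex[OF bounded[unfolded bounded_weights_iff]] unfolding C_def by blast

lemma C_nonneg: "C \<ge> 0"
proof -
  have "Neg 0 \<in> V" by (auto simp: Vt_def)
  from C[OF this, of "{}"] show ?thesis by simp
qed

lemma weighted_children_sum:
  assumes v: "v \<in> V" and g: "\<And>u. u \<in> V \<Longrightarrow> 0 \<le> g u" "\<And>u. u \<in> V \<Longrightarrow> g u \<le> G" and G: "G \<ge> 0"
  shows "(\<lambda>u. (cmod (L u))\<^sup>2 * g u) summable_on ch v"
    "(\<Sum>\<^sub>\<infinity>u\<in>ch v. (cmod (L u))\<^sup>2 * g u) \<le> C * G"
    "(\<Sum>\<^sub>\<infinity>u\<in>ch v. (cmod (L u))\<^sup>2 * g u) \<ge> 0"
proof -
  have fin: "(\<Sum>u\<in>F. (cmod (L u))\<^sup>2 * g u) \<le> C * G" if "finite F" "F \<subseteq> ch v" for F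
  proof -
    have "(\<Sum>u\<in>F. (cmod (L u))\<^sup>2 * g u) \<le> (\<Sum>u\<in>F. (cmod (L u))\<^sup>2 * G)"
      using that g by (intro sum_mono mult_left_mono) (auto dest: children_in_Vt)
    also have "\<dots> \<le> C * G"
      unfolding sum_distrib_right[symmetric] using C[OF v that] G by (intro mult_right_mono)
    finally show ?thesis .
  qed
  show s: "(\<lambda>u. (cmod (L u))\<^sup>2 * g u) summable_on ch v"
  proof (rule nonneg_bdd_above_summable_on)
    show "bdd_above (sum (\<lambda>u. (cmod (L u))\<^sup>2 * g u) ` {F. F \<subseteq> ch v \<and> finite F})"
      using fin by (intro bdd_aboveI[of _ "C * G"]) auto
  qed (use g in \<open>auto dest: children_in_Vt\<close>)
  show "(\<Sum>\<^sub>\<infinity>u\<in>ch v. (cmod (L u))\<^sup>2 * g u) \<le> C * G"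
    by (rule infsum_le_finite_sums[OF s fin])
  show "(\<Sum>\<^sub>\<infinity>u\<in>ch v. (cmod (L u))\<^sup>2 * g u) \<ge> 0"
    by (rule infsum_nonneg) (use g in \<open>auto dest: children_in_Vt\<close>)
qed

lemma orbit_nsq_bounds:
  assumes "v \<in> V"
  shows "0 \<le> N n v" "N n v \<le> C ^ n"
proof -
  have "\<forall>v\<in>V. 0 \<le> N n v \<and> N n v \<le> C ^ n"
  proof (induction n)
    case (Suc n)
    then show ?case
      using weighted_children_sum[of _ "N n" "C ^ n"] C_nonneg by auto
  qed simp
  then show "0 \<le> N n v" "N n v \<le> C ^ n" using assms by auto
qed

lemma bij_betw_par_Sigma: "bij_betw (\<lambda>u. (par u, u)) (V - {root kappa}) (Sigma V ch)"
  by (rule bij_betwI[of _ _ _ snd]) (auto simp: children_def par_in_Vt)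

text \<open>Sorts the non-root vertices by their parents and sums over the pairs (parent, child);
  absolute convergence comes from the bounded weights. With \<open>g = N n\<close> it is the
  induction step that makes the squared norm of S^n f diagonal in f.\<close>

lemma has_sum_wshift:
  assumes f: "f \<in> l2 V" and g: "\<And>u. u \<in> V \<Longrightarrow> 0 \<le> g u" "\<And>u. u \<in> V \<Longrightarrow> g u \<le> G" and G: "G \<ge> 0"
  obtains s where "((\<lambda>u. (cmod (S f u))\<^sup>2 * g u) has_sum s) UNIV"
    "((\<lambda>v. (cmod (f v))\<^sup>2 * (\<Sum>\<^sub>\<infinity>u\<in>ch v. (cmod (L u))\<^sup>2 * g u)) has_sum s) UNIV"
proof -
  define T where "T v = (\<Sum>\<^sub>\<infinity>u\<in>ch v. (cmod (L u))\<^sup>2 * g u)" for v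
  note T = weighted_children_sum[where g = g and G = G, OF _ g G, folded T_def]
  have fs: "(\<lambda>v. (cmod (f v))\<^sup>2) summable_on UNIV" and f0: "\<And>v. v \<notin> V \<Longrightarrow> f v = 0"
    using f by (auto simp: l2_def)
  have "(\<lambda>v. (cmod (f v))\<^sup>2 * (C * G)) summable_on V"
    using summable_on_subset_banach[OF fs, of V] by (intro summable_on_cmult_left) auto
  then have sT: "(\<lambda>v. (cmod (f v))\<^sup>2 * T v) summable_on V"
    by (rule summable_on_comparison_test) (use T in \<open>auto intro!: mult_left_mono mult_nonneg_nonneg\<close>)
  define s where "s = (\<Sum>\<^sub>\<infinity>v\<in>V. (cmod (f v))\<^sup>2 * T v)"
  have hs: "((\<lambda>v. (cmod (f v))\<^sup>2 * T v) has_sum s) V" using sT by (simp add: s_def)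
  let ?h = "\<lambda>p. (cmod (f (fst p)))\<^sup>2 * ((cmod (L (snd p)))\<^sup>2 * g (snd p))"
  have inner: "((\<lambda>u. ?h (v, u)) has_sum ((cmod (f v))\<^sup>2 * T v)) (ch v)" if "v \<in> V" for v
    using T(1)[OF that] by (auto simp: T_def intro!: has_sum_cmult_right)
  have "?h summable_on Sigma V ch"
    by (rule summable_on_SigmaI[OF inner sT]) (use g in \<open>auto intro!: mult_nonneg_nonneg dest: children_in_Vt\<close>)
  then have "(?h has_sum s) (Sigma V ch)"
    using has_sum_SigmaI[OF inner hs] by blast
  then have "((\<lambda>u. ?h (par u, u)) has_sum s) (V - {root kappa})"
    using has_sum_reindex_bij_betw[OF bij_betw_par_Sigma, of ?h s] by simp
  then have "((\<lambda>u. (cmod (S f u))\<^sup>2 * g u) has_sum s) UNIV"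
    by (subst has_sum_cong_neutral[of _ UNIV]) (auto simp: wshift_def norm_mult power_mult_distrib)
  moreover have "((\<lambda>v. (cmod (f v))\<^sup>2 * T v) has_sum s) UNIV"
    using hs by (subst has_sum_cong_neutral[of _ UNIV]) (auto simp: f0)
  ultimately show thesis using that by (simp add: T_def)
qed

lemma wshift_in_l2:
  assumes "f \<in> l2 V" shows "S f \<in> l2 V"
proof -
  obtain s where "((\<lambda>u. (cmod (S f u))\<^sup>2 * 1) has_sum s) UNIV"
    by (rule has_sum_wshift[OF assms, of "\<lambda>_. 1" 1]) auto
  then have "(\<lambda>u. (cmod (S f u))\<^sup>2) summable_on UNIV" by (auto simp: summable_on_def)
  then show ?thesis by (auto simp: l2_def wshift_def)
qed

lemma has_sum_orbit:
  assumes "f \<in> l2 V"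
  shows "((\<lambda>v. (cmod (f v))\<^sup>2 * N n v) has_sum nsq ((S ^^ n) f)) UNIV"
  using assms
proof (induction n arbitrary: f)
  case 0
  then show ?case by (simp add: l2_def nsq_def)
next
  case (Suc n)
  have "((\<lambda>v. (cmod (S f v))\<^sup>2 * N n v) has_sum nsq ((S ^^ n) (S f))) UNIV"
    by (rule Suc.IH[OF wshift_in_l2[OF Suc.prems]])
  moreover obtain s where "((\<lambda>u. (cmod (S f u))\<^sup>2 * N n u) has_sum s) UNIV"
    "((\<lambda>v. (cmod (f v))\<^sup>2 * N (Suc n) v) has_sum s) UNIV"
    by (rule has_sum_wshift[OF Suc.prems, of "N n" "C ^ n"]) (use orbit_nsq_bounds C_nonneg in auto)
  ultimately show ?case using has_sum_unique unfolding funpow_Suc_right comp_def by blast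
qed

lemma nsq_orbit_evec:
  assumes "v \<in> V"
  shows "nsq ((S ^^ n) (evec v)) = N n v"
proof -
  have "((\<lambda>u. (cmod (evec v u))\<^sup>2 * N n u) has_sum N n v) {v}"
    using has_sum_finite[of "{v}" "\<lambda>u. (cmod (evec v u))\<^sup>2 * N n u"] by (simp add: evec_def)
  moreover have "((\<lambda>u. (cmod (evec v u))\<^sup>2 * N n u) has_sum N n v) {v}
      \<longleftrightarrow> ((\<lambda>u. (cmod (evec v u))\<^sup>2 * N n u) has_sum N n v) UNIV"
    by (rule has_sum_cong_neutral) (auto simp: evec_def)
  ultimately have "((\<lambda>u. (cmod (evec v u))\<^sup>2 * N n u) has_sum N n v) UNIV" by simp
  then show ?thesis using has_sum_orbit[OF evec_in_l2[OF assms]] has_sum_unique by blast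
qed

text \<open>By \<open>has_sum_orbit\<close> the sequence for f is a sum of the sequences for basis
  vectors with nonnegative coefficients, and differences are taken termwise.\<close>

lemma CH_shift_iff: "CH_shift eta kappa L \<longleftrightarrow> (\<forall>v\<in>V. completely_monotone (\<lambda>n. N (Suc n) v - N n v))"
proof
  assume CH: "CH_shift eta kappa L"
  show "\<forall>v\<in>V. completely_monotone (\<lambda>n. N (Suc n) v - N n v)"
  proof
    fix v assume v: "v \<in> V"
    then have "completely_alternating (\<lambda>n. nsq ((S ^^ n) (evec v)))"
      using CH evec_in_l2 by (auto simp: CH_shift_def)
    then show "completely_monotone (\<lambda>n. N (Suc n) v - N n v)"
      unfolding completely_alternating_iff nsq_orbit_evec[OF v] .
  qed
next
  assume R: "\<forall>v\<in>V. completely_monotone (\<lambda>n. N (Suc n) v - N n v)"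
  show "CH_shift eta kappa L"
    unfolding CH_shift_def completely_alternating_iff completely_monotone_def
  proof (intro ballI allI)
    fix f r k assume f: "f \<in> l2 V"
    have *: "((\<lambda>v. (cmod (f v))\<^sup>2 * (N (Suc n) v - N n v)) has_sum (nsq ((S ^^ Suc n) f) - nsq ((S ^^ n) f))) UNIV" for n
      unfolding right_diff_distrib by (rule has_sum_diff_real[OF has_sum_orbit has_sum_orbit]) (rule f)+
    have "((\<lambda>v. fdiff (\<lambda>n. (cmod (f v))\<^sup>2 * (N (Suc n) v - N n v)) r k)
        has_sum fdiff (\<lambda>n. nsq ((S ^^ Suc n) f) - nsq ((S ^^ n) f)) r k) UNIV"
      by (rule has_sum_fdiff) (rule *)
    then show "fdiff (\<lambda>n. nsq ((S ^^ Suc n) f) - nsq ((S ^^ n) f)) r k \<ge> 0"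
    proof (rule has_sum_nonneg)
      fix v
      show "0 \<le> fdiff (\<lambda>n. (cmod (f v))\<^sup>2 * (N (Suc n) v - N n v)) r k"
        unfolding fdiff_cmult using R f
        by (cases "v \<in> V") (auto simp: completely_monotone_def l2_def)
    qed
  qed
qed

lemma orbit_Neg_0: "N (Suc n) (Neg 0) = (\<Sum>\<^sub>\<infinity>i\<in>Idx eta. (cmod (L (Br i 1)))\<^sup>2 * N n (Br i 1))"
  unfolding orbit_nsq.simps children_Neg_0 by (subst infsum_reindex) (auto simp: inj_on_def comp_def)

lemma summable_Neg_0: "(\<lambda>i. (cmod (L (Br i 1)))\<^sup>2 * N n (Br i 1)) summable_on Idx eta"
proof -
  have "Neg 0 \<in> V" by (auto simp: Vt_def)
  then have "(\<lambda>u. (cmod (L u))\<^sup>2 * N n u) summable_on ch (Neg 0)"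
    using weighted_children_sum(1)[of "Neg 0" "N n" "C ^ n"] orbit_nsq_bounds C_nonneg by auto
  then show ?thesis
    unfolding children_Neg_0 by (subst (asm) summable_on_reindex) (auto simp: inj_on_def comp_def)
qed

lemma orbit_Neg_Suc: "Suc k \<le> kappa \<Longrightarrow> N (Suc n) (Neg (Suc k)) = (cmod (L (Neg k)))\<^sup>2 * N n (Neg k)"
  by (simp add: children_Neg_Suc)

lemma orbit_Br:
  assumes "i \<in> Idx eta" "1 \<le> j"
  shows "N n (Br i j) = (\<Prod>l=Suc j..j + n. (cmod (L (Br i l)))\<^sup>2)"
  using assms(2)
proof (induction n arbitrary: j)
  case (Suc n)
  have "N (Suc n) (Br i j) = (cmod (L (Br i (Suc j))))\<^sup>2 * N n (Br i (Suc j))"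
    using Suc.prems assms(1) by (simp add: children_Br)
  also have "\<dots> = (cmod (L (Br i (Suc j))))\<^sup>2 * (\<Prod>l=Suc (Suc j)..Suc j + n. (cmod (L (Br i l)))\<^sup>2)"
    using Suc.IH[of "Suc j"] by simp
  also have "\<dots> = (\<Prod>l=Suc j..j + Suc n. (cmod (L (Br i l)))\<^sup>2)"
    by (subst (2) prod.atLeast_Suc_atMost) auto
  finally show ?case .
qed simp

end

text \<open>The measure attached to branch \<open>i\<close> is \<open>\<Sum>x\<in>X i. w i x \<delta>\<^sub>x\<close>.\<close>
locale atomic_shift = bounded_shift +
  fixes X :: "nat \<Rightarrow> real set" and w :: "nat \<Rightarrow> real \<Rightarrow> real"
  assumes at: "i \<in> Idx eta \<Longrightarrow> atomic (X i) (w i)"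
    and branch: "i \<in> Idx eta \<Longrightarrow> N (Suc n) (Br i 1) - N n (Br i 1) = pmom (X i) (w i) (int n)"
    and trunk: "k < kappa \<Longrightarrow> L (Neg k) \<noteq> 0"
begin

abbreviation "l i \<equiv> (cmod (L (Br i 1)))\<^sup>2"
abbreviation "B k n \<equiv> N (Suc n) (Neg k) - N n (Neg k)"
abbreviation "mix d \<equiv> (\<Sum>\<^sub>\<infinity>i\<in>Idx eta. l i * pmom (X i) (w i) d)"
abbreviation "mix_summable d \<equiv> (\<lambda>i. l i * pmom (X i) (w i) d) summable_on Idx eta"

text \<open>For k at most \<open>kappa\<close> this is the squared norm of S^k e_v at v =
  \<open>Neg k\<close>, the factor accumulated on the way to the branching vertex.\<close>

definition P :: "nat \<Rightarrow> real" where "P k = (\<Prod>j<k. (cmod (L (Neg j)))\<^sup>2)"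

text \<open>The squared norm of S e_v at v = \<open>Neg k\<close>, that is, the right-hand side of
  the trunk condition at that vertex.\<close>

definition E :: "nat \<Rightarrow> real" where
  "E k = (case k of 0 \<Rightarrow> (\<Sum>\<^sub>\<infinity>i\<in>Idx eta. l i) | Suc k' \<Rightarrow> (cmod (L (Neg k')))\<^sup>2)"

lemma P_pos: "k \<le> kappa \<Longrightarrow> P k > 0"
  unfolding P_def by (intro prod_pos) (simp add: trunk)

lemma mix_nat: "mix_summable (int n)" "B 0 (Suc n) = mix (int n)"
proof -
  have "((\<lambda>i. l i * N (Suc n) (Br i 1) - l i * N n (Br i 1)) has_sum (N (Suc (Suc n)) (Neg 0) - N (Suc n) (Neg 0))) (Idx eta)"
    unfolding orbit_Neg_0 by (intro has_sum_diff_real has_sum_infsum summable_Neg_0)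
  then have "((\<lambda>i. l i * pmom (X i) (w i) (int n)) has_sum (N (Suc (Suc n)) (Neg 0) - N (Suc n) (Neg 0))) (Idx eta)"
    by (rule has_sum_cong[THEN iffD1, rotated]) (simp add: branch[symmetric] right_diff_distrib del: orbit_nsq.simps)
  then show "mix_summable (int n)" "B 0 (Suc n) = mix (int n)"
    by (auto simp: summable_on_def infsumI simp del: orbit_nsq.simps)
qed

lemma B_0: "k \<le> kappa \<Longrightarrow> B k 0 = E k - 1"
proof (cases k)
  case 0
  then show ?thesis using orbit_Neg_0[of 0] by (simp add: E_def del: orbit_nsq.simps(2))
next
  case (Suc k')
  assume "k \<le> kappa"
  then show ?thesis using Suc orbit_Neg_Suc[of k' 0] by (simp add: E_def del: orbit_nsq.simps(2))
qed

lemma B_Suc: "Suc k \<le> kappa \<Longrightarrow> B (Suc k) (Suc n) = (cmod (L (Neg k)))\<^sup>2 * B k n"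
  by (simp only: orbit_Neg_Suc right_diff_distrib)

text \<open>Says that the increments at \<open>Neg k\<close> are the moments of a mass
  \<open>c\<close> at 0 plus \<open>P k\<close> times the mixture of the branch measures divided by
  t^(k+1).\<close>

definition level_rep :: "nat \<Rightarrow> real \<Rightarrow> bool" where
  "level_rep k c \<longleftrightarrow> (\<forall>n. mix_summable (- int k - 1 + int n)) \<and>
     (\<forall>n. B k n = c * 0 ^ n + P k * mix (- int k - 1 + int n))"

text \<open>Orders n at least 1 come from the preceding level, which must carry no mass at 0 since
  t^(-1) cannot be applied to it. Only order 0 is new, and there \<open>c\<close> is the defect in
  the trunk condition.\<close>

lemma level_repI:
  assumes k: "k \<le> kappa" and s: "mix_summable (- int k - 1)" and c: "c = E k - 1 - P k * mix (- int k - 1)"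
    and prev: "\<And>k'. k = Suc k' \<Longrightarrow> level_rep k' 0"
  shows "level_rep k c"
  unfolding level_rep_def
proof (intro conjI allI)
  fix n
  show "mix_summable (- int k - 1 + int n)"
  proof (cases n)
    case (Suc m)
    show ?thesis
    proof (cases k)
      case 0
      then show ?thesis using Suc mix_nat(1)[of m] by simp
    next
      case (Suc k')
      then have "mix_summable (- int k' - 1 + int m)" using prev unfolding level_rep_def by blast
      then show ?thesis using \<open>n = Suc m\<close> Suc by (simp add: algebra_simps)
    qed
  qed (use s in simp)
  show "B k n = c * 0 ^ n + P k * mix (- int k - 1 + int n)"
  proof (cases n)
    case 0
    then show ?thesis using B_0[OF k] c by simp
  next
    case (Suc m)
    show ?thesis
    proof (cases k)
      case 0
      then show ?thesis using Suc mix_nat(2)[of m] by (simp add: P_def del: orbit_nsq.simps)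
    next
      case (Suc k')
      have "B k n = (cmod (L (Neg k')))\<^sup>2 * B k' m"
        unfolding \<open>n = Suc m\<close> Suc by (rule B_Suc) (use k Suc in simp)
      also have "B k' m = P k' * mix (- int k' - 1 + int m)"
        using prev[OF Suc] unfolding level_rep_def by simp
      finally show ?thesis using \<open>n = Suc m\<close> Suc by (simp add: P_def algebra_simps del: orbit_nsq.simps)
    qed
  qed
qed

lemma level_rep_CM: "k \<le> kappa \<Longrightarrow> c \<ge> 0 \<Longrightarrow> level_rep k c \<Longrightarrow> completely_monotone (B k)"
  unfolding level_rep_def
  by (rule completely_monotone_mixture[where c = c and P = "P k" and d = "- int k - 1" and I = "Idx eta"
        and X = X and w = w and l = l]) (auto simp: at less_imp_le P_pos simp del: orbit_nsq.simps)

text \<open>Going towards the root, each level yields the next negative moment and a defect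
  \<open>c \<ge> 0\<close>; complete monotonicity one level further on then forces that defect to be
  0. The root has no next level, so its defect may stay positive.\<close>

lemma trunk_CM_iff:
  "(\<forall>k\<le>kappa. completely_monotone (B k)) \<longleftrightarrow>
   (\<forall>k\<le>kappa. mix_summable (- int k - 1) \<and> 1 + P k * mix (- int k - 1) \<le> E k \<and>
      (k < kappa \<longrightarrow> 1 + P k * mix (- int k - 1) = E k))" (is "?L \<longleftrightarrow> ?R")
proof
  assume L: ?L
  \<comment> \<open>Seen from the parent, the child's mass \<open>c\<close> becomes the mass
    \<open>q * c\<close> of the sequence with its first term removed;
    \<open>mixture_extend_backward\<close> makes it vanish, and \<open>q > 0\<close> gives
    \<open>c = 0\<close>.\<close>
  have step: "c = 0" "mix_summable (- int (Suc k) - 1)" "P (Suc k) * mix (- int (Suc k) - 1) \<le> B (Suc k) 0"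
    if k: "Suc k \<le> kappa" and c: "c \<ge> 0" and rep: "level_rep k c" for k c
  proof -
    define q where "q = (cmod (L (Neg k)))\<^sup>2"
    have q: "q > 0" using trunk[of k] k by (simp add: q_def)
    have b: "B (Suc k) (Suc n) = (q * c) * 0 ^ n + P (Suc k) * mix (- int k - 1 + int n)" for n
      unfolding B_Suc[OF k] using rep unfolding level_rep_def by (simp add: q_def P_def algebra_simps del: orbit_nsq.simps)
    have s: "mix_summable (- int k - 1 + int n)" for n using rep unfolding level_rep_def by blast
    have l0: "\<And>i. i \<in> Idx eta \<Longrightarrow> l i \<ge> 0" by simp
    have qc: "q * c \<ge> 0" using q c by simp
    have cm: "completely_monotone (B (Suc k))" using L k by blast
    have d: "- int k - 1 - 1 = - int (Suc k) - 1" by simp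
    note M = mixture_extend_backward[where b = "B (Suc k)", OF at l0 qc P_pos[OF k] cm s b, unfolded d]
    show "c = 0" using M(1) q by simp
    show "mix_summable (- int (Suc k) - 1)" "P (Suc k) * mix (- int (Suc k) - 1) \<le> B (Suc k) 0"
      by (rule M(2) M(3); assumption)+
  qed
  have base: "mix_summable (- 1)" "1 * mix (- 1) \<le> B 0 0"
  proof -
    have b: "B 0 (Suc n) = 0 * 0 ^ n + 1 * mix (0 + int n)" for n
      using mix_nat(2)[of n] by (simp del: orbit_nsq.simps)
    have s: "mix_summable (0 + int n)" for n using mix_nat(1) by simp
    have l0: "\<And>i. i \<in> Idx eta \<Longrightarrow> l i \<ge> 0" by simp
    have cm: "completely_monotone (B 0)" using L by blast
    have d: "0 - 1 = (- 1 :: int)" by simp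
    note M = mixture_extend_backward[where b = "B 0", OF at l0 order.refl zero_less_one cm s b, unfolded d]
    show "mix_summable (- 1)" "1 * mix (- 1) \<le> B 0 0" by (rule M(2) M(3); assumption)+
  qed
  have Q: "\<exists>c\<ge>0. c = E k - 1 - P k * mix (- int k - 1) \<and> level_rep k c" if "k \<le> kappa" for k
    using that
  proof (induction k)
    case 0
    have "level_rep 0 (E 0 - 1 - P 0 * mix (- int 0 - 1))"
      by (rule level_repI) (use base in auto)
    moreover have "E 0 - 1 - P 0 * mix (- int 0 - 1) \<ge> 0"
      using base(2) B_0[of 0] by (simp add: P_def del: orbit_nsq.simps)
    ultimately show ?case by blast
  next
    case (Suc k)
    obtain c where c: "c \<ge> 0" "level_rep k c" using Suc.IH[OF Suc_leD[OF Suc.prems]] by blast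
    note st = step[OF Suc.prems c]
    have "level_rep (Suc k) (E (Suc k) - 1 - P (Suc k) * mix (- int (Suc k) - 1))"
      by (rule level_repI[OF Suc.prems st(2) refl]) (use c(2) st(1) in auto)
    moreover have "E (Suc k) - 1 - P (Suc k) * mix (- int (Suc k) - 1) \<ge> 0"
      using st(3) B_0[OF Suc.prems] by simp
    ultimately show ?case by blast
  qed
  show ?R
  proof (intro allI impI)
    fix k assume k: "k \<le> kappa"
    obtain c where c: "c \<ge> 0" "c = E k - 1 - P k * mix (- int k - 1)" "level_rep k c" using Q[OF k] by blast
    have "mix_summable (- int k - 1 + int 0)" using c(3) unfolding level_rep_def by blast
    moreover have "c = 0" if "k < kappa" using step(1)[OF _ c(1,3)] that by simp
    ultimately show "mix_summable (- int k - 1) \<and> 1 + P k * mix (- int k - 1) \<le> E k \<and>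
      (k < kappa \<longrightarrow> 1 + P k * mix (- int k - 1) = E k)" using c by auto
  qed
next
  assume R: ?R
  have Q: "level_rep k (E k - 1 - P k * mix (- int k - 1))" if "k \<le> kappa" for k
    using that
  proof (induction k)
    case 0
    show ?case by (rule level_repI) (use R in auto)
  next
    case (Suc k)
    have "1 + P k * mix (- int k - 1) = E k" using R Suc.prems Suc_le_eq by (meson less_imp_le)
    then have e: "E k - 1 - P k * mix (- int k - 1) = 0" by simp
    have "level_rep k 0" using Suc.IH[OF Suc_leD[OF Suc.prems]] unfolding e .
    moreover have "mix_summable (- int (Suc k) - 1)" using R Suc.prems by blast
    ultimately show ?case by (intro level_repI[OF Suc.prems _ refl]) blast+
  qed
  show ?L
  proof (intro allI impI)
    fix k assume k: "k \<le> kappa"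
    show "completely_monotone (B k)" by (rule level_rep_CM[OF k _ Q[OF k]]) (use R k in auto)
  qed
qed

text \<open>Up to normalisation, e_(i,j) is the image of e_(i,1) under the power j - 1, so its
  increments are those of e_(i,1) shifted by j - 1 and divided by a positive constant.\<close>

lemma branch_CM:
  assumes i: "i \<in> Idx eta" and j: "1 \<le> j" and pos: "N (j - 1) (Br i 1) > 0"
  shows "completely_monotone (\<lambda>n. N (Suc n) (Br i j) - N n (Br i j))"
proof -
  define A where "A = N (j - 1) (Br i 1)"
  have shift: "N n (Br i j) = N (n + (j - 1)) (Br i 1) / A" for n
  proof -
    have "N (n + (j - 1)) (Br i 1) = (\<Prod>l=2..j + n. (cmod (L (Br i l)))\<^sup>2)"
      using j by (subst orbit_Br[OF i]) (auto simp: numeral_2_eq_2 add.commute)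
    also have "\<dots> = (\<Prod>l\<in>{2..j} \<union> {Suc j..j + n}. (cmod (L (Br i l)))\<^sup>2)"
      using j by (intro prod.cong) auto
    also have "\<dots> = (\<Prod>l=2..j. (cmod (L (Br i l)))\<^sup>2) * (\<Prod>l=Suc j..j + n. (cmod (L (Br i l)))\<^sup>2)"
      by (rule prod.union_disjoint) auto
    also have "(\<Prod>l=2..j. (cmod (L (Br i l)))\<^sup>2) = A"
      unfolding A_def using j by (subst orbit_Br[OF i]) (auto simp: numeral_2_eq_2)
    also have "(\<Prod>l=Suc j..j + n. (cmod (L (Br i l)))\<^sup>2) = N n (Br i j)"
      by (rule orbit_Br[OF i j, symmetric])
    finally show ?thesis using pos by (simp add: A_def)
  qed
  have "(\<lambda>n. N (Suc n) (Br i j) - N n (Br i j))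
      = (\<lambda>n. (1 / A) * pmom (X i) (w i) (int (j - 1) + int n))"
  proof
    fix n
    have "N (Suc n) (Br i j) - N n (Br i j) = (N (Suc (n + (j - 1))) (Br i 1) - N (n + (j - 1)) (Br i 1)) / A"
      unfolding shift by (simp add: diff_divide_distrib del: orbit_nsq.simps)
    also have "\<dots> = (1 / A) * pmom (X i) (w i) (int (j - 1) + int n)"
      unfolding branch[OF i] by (simp add: add.commute)
    finally show "N (Suc n) (Br i j) - N n (Br i j) = (1 / A) * pmom (X i) (w i) (int (j - 1) + int n)" .
  qed
  then show ?thesis
    using fdiff_pmom_nonneg[OF at[OF i]] pos by (simp only: completely_monotone_def fdiff_cmult) (simp add: A_def)
qed

end

section \<open>Completions\<close>

text \<open>Index bookkeeping between one condition for all \<open>k \<le> kappa\<close> and the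
  displayed cases: k = 0 has an empty product and the branch sum on the right, and k =
  \<open>kappa\<close> is the only place where inequality is allowed.\<close>

lemma trunk_conditions_iff:
  fixes sm :: "int \<Rightarrow> bool" and mx :: "int \<Rightarrow> real" and q :: "nat \<Rightarrow> real"
  shows "(\<forall>k\<le>kappa. sm (- int k - 1) \<and>
      1 + (\<Prod>j<k. q j) * mx (- int k - 1) \<le> (case k of 0 \<Rightarrow> e | Suc k' \<Rightarrow> q k') \<and>
      (k < kappa \<longrightarrow> 1 + (\<Prod>j<k. q j) * mx (- int k - 1) = (case k of 0 \<Rightarrow> e | Suc k' \<Rightarrow> q k')))
   \<longleftrightarrow> (kappa = 0 \<longrightarrow> sm (-1) \<and> 1 + mx (-1) \<le> e) \<and>
       (kappa > 0 \<longrightarrow> sm (-1) \<and> 1 + mx (-1) = e \<and>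
          (\<forall>k\<in>{1..kappa - 1}. sm (- int k - 1) \<and> 1 + (\<Prod>j=0..k-1. q j) * mx (- int k - 1) = q (k - 1)) \<and>
          sm (- int kappa - 1) \<and> 1 + (\<Prod>j=0..kappa-1. q j) * mx (- int kappa - 1) \<le> q (kappa - 1))"
    (is "(\<forall>k\<le>kappa. ?A k) \<longleftrightarrow> ?R")
proof (cases kappa)
  case 0
  then show ?thesis by simp
next
  case (Suc m)
  have pr: "(\<Prod>j<k. q j) = (\<Prod>j=0..k-1. q j)" "(case k of 0 \<Rightarrow> e | Suc k' \<Rightarrow> q k') = q (k - 1)" if "k \<ge> 1" for k
    using that by (auto intro!: prod.cong split: nat.splits)
  have A0: "?A 0 \<longleftrightarrow> sm (-1) \<and> 1 + mx (-1) = e" using Suc by auto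
  have Ak: "?A k \<longleftrightarrow> sm (- int k - 1) \<and> 1 + (\<Prod>j=0..k-1. q j) * mx (- int k - 1) = q (k - 1)"
    if "k \<in> {1..kappa - 1}" for k
    using that pr[of k] by auto
  have AK: "?A kappa \<longleftrightarrow> sm (- int kappa - 1) \<and> 1 + (\<Prod>j=0..kappa-1. q j) * mx (- int kappa - 1) \<le> q (kappa - 1)"
    using pr[of kappa] Suc by simp
  have split: "(\<forall>k\<le>kappa. A k) \<longleftrightarrow> A 0 \<and> (\<forall>k\<in>{1..kappa - 1}. A k) \<and> A kappa" for A
  proof -
    have "(\<forall>k\<le>kappa. A k) \<longleftrightarrow> (\<forall>k\<in>{..kappa}. A k)" by (simp add: Ball_def)
    also have "{..kappa} = insert 0 (insert kappa {1..kappa - 1})" using Suc by auto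
    finally show ?thesis by auto
  qed
  have "(\<forall>k\<le>kappa. ?A k) \<longleftrightarrow> ?A 0 \<and> (\<forall>k\<in>{1..kappa - 1}. ?A k) \<and> ?A kappa"
    by (rule split)
  also have "\<dots> \<longleftrightarrow> ?R" unfolding A0 AK using Ak Suc by simp
  finally show ?thesis .
qed

lemma (in atomic_shift) trunk_CM_iff_data:
  fixes lam :: "vtx \<Rightarrow> real" and s :: "nat \<Rightarrow> int \<Rightarrow> real"
  assumes Lt: "\<And>k. k < kappa \<Longrightarrow> (cmod (L (Neg k)))\<^sup>2 = (lam (Neg k))\<^sup>2"
    and Lb: "\<And>i. i \<in> Idx eta \<Longrightarrow> (cmod (L (Br i 1)))\<^sup>2 = (lam (Br i 1))\<^sup>2"
    and s: "\<And>i k. i \<in> Idx eta \<Longrightarrow> k \<in> {- int kappa - 1..-1} \<Longrightarrow> s i k = pmom (X i) (w i) k"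
  shows "(\<forall>k\<le>kappa. completely_monotone (B k)) \<longleftrightarrow>
        (kappa = 0 \<longrightarrow>
           (\<lambda>i. (lam (Br i 1))\<^sup>2 * s i (-1)) summable_on Idx eta \<and>
           1 + (\<Sum>\<^sub>\<infinity>i\<in>Idx eta. (lam (Br i 1))\<^sup>2 * s i (-1)) \<le> (\<Sum>\<^sub>\<infinity>i\<in>Idx eta. (lam (Br i 1))\<^sup>2)) \<and>
        (kappa > 0 \<longrightarrow>
           (\<lambda>i. (lam (Br i 1))\<^sup>2 * s i (-1)) summable_on Idx eta \<and>
           1 + (\<Sum>\<^sub>\<infinity>i\<in>Idx eta. (lam (Br i 1))\<^sup>2 * s i (-1)) = (\<Sum>\<^sub>\<infinity>i\<in>Idx eta. (lam (Br i 1))\<^sup>2) \<and>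
           (\<forall>k\<in>{1..kappa - 1}.
              (\<lambda>i. (lam (Br i 1))\<^sup>2 * s i (- int k - 1)) summable_on Idx eta \<and>
              1 + (\<Prod>j=0..k-1. (lam (Neg j))\<^sup>2) * (\<Sum>\<^sub>\<infinity>i\<in>Idx eta. (lam (Br i 1))\<^sup>2 * s i (- int k - 1))
                = (lam (Neg (k - 1)))\<^sup>2) \<and>
           (\<lambda>i. (lam (Br i 1))\<^sup>2 * s i (- int kappa - 1)) summable_on Idx eta \<and>
           1 + (\<Prod>j=0..kappa-1. (lam (Neg j))\<^sup>2) * (\<Sum>\<^sub>\<infinity>i\<in>Idx eta. (lam (Br i 1))\<^sup>2 * s i (- int kappa - 1))
             \<le> (lam (Neg (kappa - 1)))\<^sup>2)" (is "_ \<longleftrightarrow> ?R")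
proof -
  let ?sm = "\<lambda>d. (\<lambda>i. (lam (Br i 1))\<^sup>2 * s i d) summable_on Idx eta"
  let ?mx = "\<lambda>d. \<Sum>\<^sub>\<infinity>i\<in>Idx eta. (lam (Br i 1))\<^sup>2 * s i d"
  let ?q = "\<lambda>j. (lam (Neg j))\<^sup>2"
  let ?e = "\<Sum>\<^sub>\<infinity>i\<in>Idx eta. (lam (Br i 1))\<^sup>2"
  have "mix_summable (- int k - 1) \<longleftrightarrow> ?sm (- int k - 1)" "mix (- int k - 1) = ?mx (- int k - 1)"
    "P k = (\<Prod>j<k. ?q j)" "E k = (case k of 0 \<Rightarrow> ?e | Suc k' \<Rightarrow> ?q k')" if k: "k \<le> kappa" for k
  proof -
    have *: "l i * pmom (X i) (w i) (- int k - 1) = (lam (Br i 1))\<^sup>2 * s i (- int k - 1)" if "i \<in> Idx eta" for i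
      using Lb[OF that] s[OF that, of "- int k - 1"] k by simp
    show "mix_summable (- int k - 1) \<longleftrightarrow> ?sm (- int k - 1)" by (rule summable_on_cong) (rule *)
    show "mix (- int k - 1) = ?mx (- int k - 1)" by (rule infsum_cong) (rule *)
    show "P k = (\<Prod>j<k. ?q j)" unfolding P_def by (rule prod.cong) (use Lt k in auto)
    show "E k = (case k of 0 \<Rightarrow> ?e | Suc k' \<Rightarrow> ?q k')"
      unfolding E_def using k Lt by (auto intro!: infsum_cong Lb split: nat.splits simp del: One_nat_def)
  qed
  then have "(\<forall>k\<le>kappa. completely_monotone (B k)) \<longleftrightarrow>
    (\<forall>k\<le>kappa. ?sm (- int k - 1) \<and> 1 + (\<Prod>j<k. ?q j) * ?mx (- int k - 1) \<le> (case k of 0 \<Rightarrow> ?e | Suc k' \<Rightarrow> ?q k') \<and>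
      (k < kappa \<longrightarrow> 1 + (\<Prod>j<k. ?q j) * ?mx (- int k - 1) = (case k of 0 \<Rightarrow> ?e | Suc k' \<Rightarrow> ?q k')))"
    unfolding trunk_CM_iff by simp
  also have "\<dots> \<longleftrightarrow> ?R" by (rule trunk_conditions_iff)
  finally show ?thesis .
qed

lemma tau_eq_The_represents:
  assumes "bounded_weights eta kappa L" "v \<in> Vt eta kappa"
  shows "tau eta kappa L v = (THE \<tau>. represents (\<lambda>n. orbit_nsq eta kappa L n v) \<tau>)"
  unfolding tau_def represents_def
  by (simp only: bounded_shift.nsq_orbit_evec[OF bounded_shift.intro[OF assms(1)] assms(2)])

lemma sdat_pos:
  assumes "\<And>j. j \<in> {2..k + 2} \<Longrightarrow> lam (Br i j) > 1"
  shows "sdat lam i k > 0"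
proof -
  have "(\<Prod>j=2..k+1. (lam (Br i j))\<^sup>2) > 0"
    by (rule prod_pos) (use assms in force)
  moreover have "(lam (Br i (k + 2)))\<^sup>2 > 1" using assms[of "k + 2"] by (simp add: one_less_power)
  ultimately have "(\<Prod>j=2..k+1. (lam (Br i j))\<^sup>2) * 1 < (\<Prod>j=2..k+1. (lam (Br i j))\<^sup>2) * (lam (Br i (k + 2)))\<^sup>2"
    by (intro mult_strict_left_mono)
  then show ?thesis by (simp add: sdat_def mult.commute)
qed

theorem theorem9p2:
  fixes kappa p :: nat and eta :: enat and lam :: "vtx \<Rightarrow> real" and K :: "nat \<Rightarrow> real"
  assumes eta2: "eta \<ge> 2"
    and p2: "p \<ge> 2"
    and pos_neg: "\<forall>k<kappa. lam (Neg k) > 0"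
    and pos_br: "\<forall>i\<in>Idx eta. \<forall>j\<in>{1..p}. lam (Br i j) > 0"
    and gt1: "\<forall>i\<in>Idx eta. \<forall>j\<in>{2..p}. lam (Br i j) > 1"
    and summ: "(\<lambda>i. (lam (Br i 1))\<^sup>2) summable_on Idx eta"
    and K: "\<forall>i\<in>Idx eta. K i \<in> \<rat> \<and> 2 * K i \<in> \<nat> \<and> 1/2 \<le> K i \<and> K i \<le> (real p + real kappa) / 2"
  shows "(\<exists>lam'. is_completion eta kappa p lam lam' \<and> CH_shift eta kappa lam' \<and>
            (\<forall>i\<in>Idx eta. ind1 (tau eta kappa lam' (Br i 1)) = ereal (K i)))
     \<longleftrightarrow>
     (\<exists>s :: nat \<Rightarrow> int \<Rightarrow> real.
        (\<forall>i\<in>Idx eta. \<forall>k\<in>{0..int p - 2}. s i k = sdat lam i (nat k)) \<and>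
        (\<forall>i\<in>Idx eta. \<forall>k\<in>{- int kappa - 1..-1}. s i k > 0) \<and>
        (\<forall>i\<in>Idx eta. \<forall>k\<in>{int p - Nint (K i) - 2 .. int p - 3}.
            t1 (map (s i) [k + 1..int p - 2]) < ereal (s i k)) \<and>
        (\<forall>i\<in>Idx eta. \<forall>k\<in>{- int kappa - 1 .. int p - Nint (K i) - 3}.
            ereal (s i k) = t1 (map (s i) [k + 1..k + Nint (K i) + 1])) \<and>
        bdd_above ((\<lambda>i. s i 0) ` Idx eta) \<and>
        (kappa = 0 \<longrightarrow>
           (\<lambda>i. (lam (Br i 1))\<^sup>2 * s i (-1)) summable_on Idx eta \<and>
           1 + (\<Sum>\<^sub>\<infinity>i\<in>Idx eta. (lam (Br i 1))\<^sup>2 * s i (-1)) \<le> (\<Sum>\<^sub>\<infinity>i\<in>Idx eta. (lam (Br i 1))\<^sup>2)) \<and>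
        (kappa > 0 \<longrightarrow>
           (\<lambda>i. (lam (Br i 1))\<^sup>2 * s i (-1)) summable_on Idx eta \<and>
           1 + (\<Sum>\<^sub>\<infinity>i\<in>Idx eta. (lam (Br i 1))\<^sup>2 * s i (-1)) = (\<Sum>\<^sub>\<infinity>i\<in>Idx eta. (lam (Br i 1))\<^sup>2) \<and>
           (\<forall>k\<in>{1..kappa - 1}.
              (\<lambda>i. (lam (Br i 1))\<^sup>2 * s i (- int k - 1)) summable_on Idx eta \<and>
              1 + (\<Prod>j=0..k-1. (lam (Neg j))\<^sup>2) * (\<Sum>\<^sub>\<infinity>i\<in>Idx eta. (lam (Br i 1))\<^sup>2 * s i (- int k - 1))
                = (lam (Neg (k - 1)))\<^sup>2) \<and>
           (\<lambda>i. (lam (Br i 1))\<^sup>2 * s i (- int kappa - 1)) summable_on Idx eta \<and>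
           1 + (\<Prod>j=0..kappa-1. (lam (Neg j))\<^sup>2) * (\<Sum>\<^sub>\<infinity>i\<in>Idx eta. (lam (Br i 1))\<^sup>2 * s i (- int kappa - 1))
             \<le> (lam (Neg (kappa - 1)))\<^sup>2))"
    (is "?L \<longleftrightarrow> (\<exists>s. ?R1 s \<and> ?R2 s \<and> ?R3 s \<and> ?R4 s \<and> ?R5 s \<and> ?T s)")
proof -
  \<comment> \<open>The bound K_i \<le> (p + kappa)/2 says precisely that the orders p - 2 - N_i,
    ..., p - 2 of the top window do not go below - kappa - 1.\<close>
  have "\<exists>n. 2 * K i = real (Suc n) \<and> Nint (K i) = int n \<and> - int kappa - 1 \<le> int p - 2 - int n" if i: "i \<in> Idx eta" for i
  proof -
    have Ki: "2 * K i \<in> \<nat>" "1 \<le> 2 * K i" "2 * K i \<le> real p + real kappa" using K i by auto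
    then obtain M where M: "2 * K i = real M" by (auto elim: Nats_cases)
    then have "M \<ge> 1" "M \<le> p + kappa" using Ki by linarith+
    then show ?thesis using M by (intro exI[of _ "M - 1"]) (auto simp: Nint_def)
  qed
  then obtain n where n: "\<And>i. i \<in> Idx eta \<Longrightarrow> 2 * K i = real (Suc (n i))"
    "\<And>i. i \<in> Idx eta \<Longrightarrow> Nint (K i) = int (n i)"
    "\<And>i. i \<in> Idx eta \<Longrightarrow> - int kappa - 1 \<le> int p - 2 - int (n i)" by metis
  \<comment> \<open>The extension result with top order p - 2, the last datum, which is positive
    because the weights exceed 1, and lowest order - kappa - 1, the deepest moment that the root
    needs.\<close>
  have extension: "(?R3 s \<and> ?R4 s) \<longleftrightarrow> (\<forall>i\<in>Idx eta. \<exists>X w. atomic X w \<and> idx2 X = Suc (n i) \<and>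
      (\<forall>k\<in>{- int kappa - 1..int p - 2}. s i k = pmom X w k))" if R1: "?R1 s" for s :: "nat \<Rightarrow> int \<Rightarrow> real"
  proof -
    have "(\<forall>k\<in>{int p - Nint (K i) - 2 .. int p - 3}. t1 (map (s i) [k + 1..int p - 2]) < ereal (s i k)) \<and>
        (\<forall>k\<in>{- int kappa - 1 .. int p - Nint (K i) - 3}. ereal (s i k) = t1 (map (s i) [k + 1..k + Nint (K i) + 1]))
      \<longleftrightarrow> (\<exists>X w. atomic X w \<and> idx2 X = Suc (n i) \<and> (\<forall>k\<in>{- int kappa - 1..int p - 2}. s i k = pmom X w k))"
      if i: "i \<in> Idx eta" for i
    proof -
      have "s i (int p - 2) = sdat lam i (nat (int p - 2))" using R1 i p2 by auto
      moreover have "sdat lam i (nat (int p - 2)) > 0" using gt1 i p2 by (intro sdat_pos) auto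
      ultimately have "s i (int p - 2) > 0" by simp
      note * = backward_extension_iff[of "s i", OF this n(3)[OF i]]
      have "int p - int (n i) - 2 = int p - 2 - int (n i)" "int p - 3 = int p - 2 - 1"
        "int p - int (n i) - 3 = int p - 2 - int (n i) - 1" by auto
      then show ?thesis unfolding n(2)[OF i] pmom_def using * by (simp only:)
    qed
    then show ?thesis by blast
  qed
  show ?thesis
  proof
    assume ?L
    then obtain L where comp: "is_completion eta kappa p lam L" and CH: "CH_shift eta kappa L"
      and ind: "\<And>i. i \<in> Idx eta \<Longrightarrow> ind1 (tau eta kappa L (Br i 1)) = ereal (K i)" by blast
    have bw: "bounded_weights eta kappa L" using comp by (simp add: is_completion_def)
    interpret bounded_shift eta kappa L by unfold_locales (rule bw)
    have LB: "(cmod (L (Br i j)))\<^sup>2 = (lam (Br i j))\<^sup>2" if "i \<in> Idx eta" "j \<in> {1..p}" for i j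
      using comp that by (simp add: is_completion_def)
    have LN: "(cmod (L (Neg k)))\<^sup>2 = (lam (Neg k))\<^sup>2" "L (Neg k) \<noteq> 0" if "k < kappa" for k
      using comp pos_neg that by (force simp: is_completion_def)+
    have BrV: "Br i 1 \<in> V" if "i \<in> Idx eta" for i using that by (auto simp: Vt_def)
    have CM: "\<And>v. v \<in> V \<Longrightarrow> completely_monotone (\<lambda>n. N (Suc n) v - N n v)"
      using CH unfolding CH_shift_iff by blast
    have "\<exists>X w. atomic X w \<and> idx2 X = Suc (n i) \<and> (\<forall>k. N (Suc k) (Br i 1) - N k (Br i 1) = pmom X w (int k))"
      if i: "i \<in> Idx eta" for i
    proof -
      have a0: "N 0 (Br i 1) = 1" by simp
      have a: "\<And>n. N n (Br i 1) \<ge> 0" using orbit_nsq_bounds(1)[OF BrV[OF i]] .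
      have "completely_alternating (\<lambda>n. N n (Br i 1))"
        unfolding completely_alternating_iff by (rule CM[OF BrV[OF i]])
      then have "\<exists>!\<tau>. represents (\<lambda>n. N n (Br i 1)) \<tau>"
        using represents_ex1[of "\<lambda>n. N n (Br i 1)", OF a0 a] by blast
      then have rep: "represents (\<lambda>n. N n (Br i 1)) (tau eta kappa L (Br i 1))"
        unfolding tau_eq_The_represents[OF bw BrV[OF i]] by (rule theI')
      obtain X w where X: "atomic X w" "real (idx2 X) = 2 * K i"
        "\<And>k. N (Suc k) (Br i 1) - N k (Br i 1) = (\<Sum>x\<in>X. w x * x ^ k)"
        by (rule represents_ind1D[of "\<lambda>n. N n (Br i 1)", OF a0 a rep ind[OF i]]) (rule that)
      moreover have "idx2 X = Suc (n i)" using X(2) unfolding n(1)[OF i] by (simp only: of_nat_eq_iff)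
      ultimately show ?thesis unfolding pmom_of_nat by blast
    qed
    then obtain X w where Xw: "\<And>i. i \<in> Idx eta \<Longrightarrow> atomic (X i) (w i)"
      "\<And>i. i \<in> Idx eta \<Longrightarrow> idx2 (X i) = Suc (n i)"
      "\<And>i k. i \<in> Idx eta \<Longrightarrow> N (Suc k) (Br i 1) - N k (Br i 1) = pmom (X i) (w i) (int k)"
      by metis
    interpret atomic_shift eta kappa L X w
      by unfold_locales (use Xw LN in auto)
    define s where "s i k = pmom (X i) (w i) k" for i k
    have Nprod: "N m (Br i 1) = (\<Prod>j=2..m+1. (lam (Br i j))\<^sup>2)" if "i \<in> Idx eta" "m < p" for i m
    proof -
      have "N m (Br i 1) = (\<Prod>j=Suc 1..1 + m. (cmod (L (Br i j)))\<^sup>2)"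
        using that by (intro orbit_Br) auto
      also have "\<dots> = (\<Prod>j=2..m+1. (lam (Br i j))\<^sup>2)"
        using that by (intro prod.cong LB) auto
      finally show ?thesis .
    qed
    have R1: "?R1 s"
    proof (intro ballI)
      fix i k assume i: "i \<in> Idx eta" and k: "k \<in> {0..int p - 2}"
      have "s i k = N (Suc (nat k)) (Br i 1) - N (nat k) (Br i 1)"
        using Xw(3)[OF i, of "nat k"] k by (simp add: s_def del: orbit_nsq.simps)
      also have "\<dots> = sdat lam i (nat k)"
        unfolding sdat_def using i k by (subst (1 2) Nprod) auto
      finally show "s i k = sdat lam i (nat k)" .
    qed
    have R2: "?R2 s"
    proof (intro ballI)
      fix i k assume i: "i \<in> Idx eta"
      have "X i \<noteq> {}" using Xw(2)[OF i] by (auto simp: idx2_def)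
      then show "s i k > 0" unfolding s_def by (rule pmom_pos[OF Xw(1)[OF i]])
    qed
    have R34: "?R3 s \<and> ?R4 s"
      unfolding extension[OF R1] using Xw by (auto simp: s_def)
    have R5: "?R5 s"
    proof (rule bdd_aboveI2)
      fix i assume i: "i \<in> Idx eta"
      have "s i 0 = N 1 (Br i 1) - N 0 (Br i 1)" using Xw(3)[OF i, of 0] by (simp add: s_def)
      also have "\<dots> \<le> C ^ 1" using orbit_nsq_bounds(2)[OF BrV[OF i], of 1] by simp
      finally show "s i 0 \<le> C ^ 1" .
    qed
    have T: "?T s"
    proof (rule trunk_CM_iff_data[THEN iffD1])
      show "\<forall>k\<le>kappa. completely_monotone (B k)" using CM by (auto simp: Vt_def simp del: orbit_nsq.simps)
    qed (use LN LB p2 in \<open>auto simp: s_def\<close>)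
    show "\<exists>s. ?R1 s \<and> ?R2 s \<and> ?R3 s \<and> ?R4 s \<and> ?R5 s \<and> ?T s"
      by (rule exI[of _ s]) (intro conjI R1 R2 R34[THEN conjunct1] R34[THEN conjunct2] R5 T[THEN conjunct1] T[THEN conjunct2])
  next
    assume "\<exists>s. ?R1 s \<and> ?R2 s \<and> ?R3 s \<and> ?R4 s \<and> ?R5 s \<and> ?T s"
    then obtain s where R1: "?R1 s" and R34: "?R3 s \<and> ?R4 s" and R5: "?R5 s" and T: "?T s" by (elim exE conjE) blast
    obtain X w where Xw: "\<And>i. i \<in> Idx eta \<Longrightarrow> atomic (X i) (w i)"
      "\<And>i. i \<in> Idx eta \<Longrightarrow> idx2 (X i) = Suc (n i)"
      "\<And>i k. i \<in> Idx eta \<Longrightarrow> k \<in> {- int kappa - 1..int p - 2} \<Longrightarrow> s i k = pmom (X i) (w i) k"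
      using R34[unfolded extension[OF R1]] by metis
    \<comment> \<open>The squared norms of S^m e_(i,1) that the sought completion must have.\<close>
    define a where "a i m = 1 + (\<Sum>k<m. pmom (X i) (w i) (int k))" for i m
    have a1: "a i m \<ge> 1" if "i \<in> Idx eta" for i m
      unfolding a_def using pmom_nonneg[OF Xw(1)[OF that]] by (simp add: sum_nonneg)
    have a0: "a i 0 = 1" for i by (simp add: a_def)
    have aS: "a i (Suc m) = a i m + pmom (X i) (w i) (int m)" for i m by (simp add: a_def)
    have adata: "a i m = (\<Prod>j=2..m+1. (lam (Br i j))\<^sup>2)" if i: "i \<in> Idx eta" and "m < p" for i m
      using \<open>m < p\<close>
    proof (induction m)
      case (Suc m)
      have "pmom (X i) (w i) (int m) = s i (int m)" using Suc.prems by (intro Xw(3)[OF i, symmetric]) auto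
      also have "\<dots> = sdat lam i m" using R1 i Suc.prems by auto
      finally show ?case using Suc by (simp add: aS sdat_def del: prod.cl_ivl_Suc)
    qed (simp add: a0)
    \<comment> \<open>\<open>a i m\<close> is to be the product of the squared weights from 2 to m +
      1, so the square of weight j is \<open>a i (j - 1) / a i (j - 2)\<close>.\<close>
    define L where "L v = complex_of_real (case v of Neg k \<Rightarrow> lam (Neg k)
      | Br i j \<Rightarrow> if j \<le> p then lam (Br i j) else sqrt (a i (j - 1) / a i (j - 2)))" for v
    have LN: "(cmod (L (Neg k)))\<^sup>2 = (lam (Neg k))\<^sup>2" for k by (simp add: L_def)
    have L1: "(cmod (L (Br i 1)))\<^sup>2 = (lam (Br i 1))\<^sup>2" for i using p2 by (simp add: L_def)
    have LB: "(cmod (L (Br i (Suc (Suc m)))))\<^sup>2 = a i (Suc m) / a i m" if i: "i \<in> Idx eta" for i m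
    proof (cases "Suc (Suc m) \<le> p")
      case True
      have "a i (Suc m) = a i m * (lam (Br i (Suc (Suc m))))\<^sup>2"
        using True adata[OF i, of "Suc m"] adata[OF i, of m] by simp
      moreover have "a i m \<noteq> 0" using a1[OF i, of m] by auto
      ultimately show ?thesis using True by (simp add: L_def)
    next
      case False
      have "a i (Suc m) / a i m \<ge> 0" using a1[OF i, of m] a1[OF i, of "Suc m"] by simp
      then show ?thesis using False by (simp add: L_def)
    qed
    obtain C0 where C0: "\<And>i. i \<in> Idx eta \<Longrightarrow> s i 0 \<le> C0" using R5 by (auto simp: bdd_above_def)
    \<comment> \<open>The support lies in (0,1], so every increment of \<open>a i\<close> is at most
      the moment \<open>s i 0\<close>, while \<open>a i m\<close> is at least 1.\<close>
    have ratio: "a i (Suc m) / a i m \<le> 1 + \<bar>C0\<bar>" if i: "i \<in> Idx eta" for i m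
    proof -
      note Xi = atomicD[OF Xw(1)[OF i]]
      have "pmom (X i) (w i) (int m) \<le> pmom (X i) (w i) 0"
        unfolding pmom_def
        by (intro sum_mono) (use Xi in \<open>auto intro!: mult_left_le power_le_one simp: less_imp_le\<close>)
      also have "\<dots> = s i 0" using Xw(3)[OF i, of 0] p2 by simp
      also have "\<dots> \<le> \<bar>C0\<bar>" using C0[OF i] by simp
      also have "\<dots> \<le> \<bar>C0\<bar> * a i m" using a1[OF i, of m] by (simp add: mult_le_cancel_left1)
      finally have "a i (Suc m) \<le> (1 + \<bar>C0\<bar>) * a i m" by (simp add: aS algebra_simps)
      then show ?thesis using a1[OF i, of m] by (simp add: divide_le_eq)
    qed
    define D1 where "D1 = (\<Sum>\<^sub>\<infinity>i\<in>Idx eta. (lam (Br i 1))\<^sup>2)"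
    define D2 where "D2 = (\<Sum>k<kappa. (lam (Neg k))\<^sup>2)"
    have D: "D1 \<ge> 0" "D2 \<ge> 0" by (auto simp: D1_def D2_def intro: infsum_nonneg sum_nonneg)
    have bw: "bounded_weights eta kappa L"
      unfolding bounded_weights_iff
    proof (intro exI ballI allI impI)
      fix v F assume v: "v \<in> Vt eta kappa" and F: "finite F \<and> F \<subseteq> children eta kappa v"
      have single: "(\<Sum>u\<in>F. (cmod (L u))\<^sup>2) \<le> (cmod (L u0))\<^sup>2" if "children eta kappa v = {u0}" for u0
      proof -
        have "(\<Sum>u\<in>F. (cmod (L u))\<^sup>2) \<le> (\<Sum>u\<in>{u0}. (cmod (L u))\<^sup>2)"
          using F that by (intro sum_mono2) auto
        then show ?thesis by simp
      qed
      consider "v = Neg 0" | k where "v = Neg (Suc k)" "Suc k \<le> kappa" | i j where "v = Br i j" "i \<in> Idx eta" "1 \<le> j"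
        using v unfolding Vt_def by (auto, metis not0_implies_Suc)
      then show "(\<Sum>u\<in>F. (cmod (L u))\<^sup>2) \<le> D1 + D2 + (1 + \<bar>C0\<bar>)"
      proof cases
        case 1
        obtain G where G: "finite G" "G \<subseteq> Idx eta" "F = (\<lambda>i. Br i 1) ` G"
          using F finite_subset_image[of F "\<lambda>i. Br i 1" "Idx eta"] unfolding 1 children_Neg_0 by blast
        have "(\<Sum>u\<in>F. (cmod (L u))\<^sup>2) = (\<Sum>i\<in>G. (lam (Br i 1))\<^sup>2)"
          unfolding G(3) by (subst sum.reindex) (auto simp: inj_on_def L1 simp del: One_nat_def)
        also have "\<dots> \<le> D1" unfolding D1_def by (rule finite_sum_le_infsum[OF summ G(1,2)]) simp
        finally show ?thesis using D by linarith
      next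
        case (2 k)
        have "(\<Sum>u\<in>F. (cmod (L u))\<^sup>2) \<le> (lam (Neg k))\<^sup>2"
          using single[of "Neg k"] 2 by (simp add: children_Neg_Suc LN)
        also have "\<dots> \<le> D2" unfolding D2_def using 2 by (intro member_le_sum) auto
        finally show ?thesis using D by linarith
      next
        case (3 i j)
        obtain m where m: "j = Suc m" using 3 by (cases j) auto
        have "(\<Sum>u\<in>F. (cmod (L u))\<^sup>2) \<le> (cmod (L (Br i (Suc (Suc m)))))\<^sup>2"
          using single[of "Br i (Suc j)"] 3 m by (simp add: children_Br)
        also have "\<dots> \<le> 1 + \<bar>C0\<bar>" unfolding LB[OF 3(2)] by (rule ratio[OF 3(2)])
        finally show ?thesis using D by linarith
      qed
    qed
    interpret bounded_shift eta kappa L by unfold_locales (rule bw)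
    have Na: "N m (Br i 1) = a i m" if i: "i \<in> Idx eta" for i m
    proof -
      have "N m (Br i 1) = (\<Prod>j=2..m+1. (cmod (L (Br i j)))\<^sup>2)"
        by (subst orbit_Br[OF i]) (auto simp: numeral_2_eq_2)
      also have "\<dots> = a i m"
      proof (induction m)
        case (Suc m)
        have "a i m \<noteq> 0" using a1[OF i, of m] by auto
        then show ?case using Suc LB[OF i, of m] by simp
      qed (simp add: a0)
      finally show ?thesis .
    qed
    interpret atomic_shift eta kappa L X w
    proof unfold_locales
      show "N (Suc m) (Br i 1) - N m (Br i 1) = pmom (X i) (w i) (int m)" if "i \<in> Idx eta" for i m
        unfolding Na[OF that] by (simp add: aS)
      show "L (Neg k) \<noteq> 0" if "k < kappa" for k using pos_neg that by (force simp: L_def)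
    qed (rule Xw(1))
    have trunkCM: "\<forall>k\<le>kappa. completely_monotone (B k)"
    proof (rule trunk_CM_iff_data[THEN iffD2, OF _ _ _ T])
      fix i k assume "i \<in> Idx eta" "k \<in> {- int kappa - 1..-1}"
      then show "s i k = pmom (X i) (w i) k" using p2 by (intro Xw(3)) auto
    qed (rule LN L1)+
    have "CH_shift eta kappa L"
      unfolding CH_shift_iff
    proof
      fix v assume "v \<in> V"
      then consider k where "v = Neg k" "k \<le> kappa" | i j where "v = Br i j" "i \<in> Idx eta" "1 \<le> j"
        unfolding Vt_def by auto
      then show "completely_monotone (\<lambda>n. N (Suc n) v - N n v)"
      proof cases
        case 1
        then show ?thesis using trunkCM by blast
      next
        case (2 i j)
        have "N (j - 1) (Br i 1) > 0" unfolding Na[OF 2(2)] using a1[OF 2(2), of "j - 1"] by simp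
        then show ?thesis unfolding 2(1) by (rule branch_CM[OF 2(2,3)])
      qed
    qed
    moreover have "is_completion eta kappa p lam L"
      using bw by (auto simp: is_completion_def L_def)
    moreover have "ind1 (tau eta kappa L (Br i 1)) = ereal (K i)" if i: "i \<in> Idx eta" for i
    proof -
      have v: "Br i 1 \<in> V" using i by (auto simp: Vt_def)
      have "ind1 (THE \<tau>. represents (\<lambda>n. N n (Br i 1)) \<tau>) = ereal (real (idx2 (X i)) / 2)"
      proof (rule ind1_The_represents[OF _ _ Xw(1)[OF i]])
        show "N (Suc k) (Br i 1) - N k (Br i 1) = (\<Sum>x\<in>X i. w i x * x ^ k)" for k
          unfolding branch[OF i] by (rule pmom_of_nat)
      qed (use orbit_nsq_bounds(1)[OF v] in simp_all)
      then show ?thesis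
        unfolding tau_eq_The_represents[OF bw v] Xw(2)[OF i] n(1)[OF i, symmetric] by simp
    qed
    ultimately show ?L by blast
  qed
qed

end
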